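(* Let $k$ be an even integer, written as $k = 4\ell + k'$ with $\ell \in \mathbb{Z}$ and $k' \in \{0,2\}$, and let $n \ge -\ell$ be an integer. Let $f_{k,n}^{(2)}(z)$ be the unique element of $M_k^\sharp(2)$ whose Fourier expansion at $\infty$ has the form $f_{k,n}^{(2)}(z) = q^{-n} + O(q^{\ell+1})$. If either $\ell \ge 0$ and $n \ge 14\ell + 8$, or $\ell < 0$ and $n \ge 15|\ell| + 8$, then at least $\lfloor \frac{\sqrt{3}}{2} n + \frac{k}{6} \rfloor$ of the $n + \lfloor \frac{k}{4} \rfloor$ nontrivial zeros of $f_{k,n}^{(2)}$ in the fundamental domain $\mathcal{F}_2$ lie on the lower boundary of $\mathcal{F}_2$.
   Context: Let $\Gamma_0(2) = \{\left(\begin{smallmatrix} a & b\\ c & d\end{smallmatrix}\right) \in \mathrm{SL}_2(\mathbb{Z}) : c \equiv 0 \pmod 2\}$, $\mathbb{H}$ the upper half plane, and $q = e^{2\pi i z}$. For even $k$, $M_k^\sharp(2)$ denotes the space of weakly holomorphic modular forms of weight $k$ for $\Gamma_0(2)$ (holomorphic on $\mathbb{H}$, meromorphic at the cusps) that are holomorphic at every cusp other than $\infty$ (in particular at the cusp $0$); the forms $q^{-n}+O(q^{\ell+1})$, $n\ge -\ell$, form a basis of this space. The fundamental domain $\mathcal{F}_2$ for $\Gamma_0(2)$ is the region of $\mathbb{H}$ bounded by the lines $\mathrm{Re}(z) = \pm\frac12$ and lying outside the circles $|z+\frac12| = \frac12$ and $|z - \frac12| = \frac12$, where only the left half of the boundary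 is included (i.e. the line $\mathrm{Re}(z)=-\frac12$ and the arc $|z+\frac12|=\frac12$ are included, their images under $z\mapsto z+1$ and $z \mapsto z/(2z+1)$ are not). Its lower boundary is the arc $\{-\frac12 + \frac12 e^{i\theta} : 0 < \theta \le \frac{\pi}{2}\}$. The point $-\frac12+\frac i2$ is an elliptic point of order 2. By the valence formula, $f_{k,n}^{(2)}$ has, counted with multiplicity, exactly $n + \lfloor k/4\rfloor$ zeros in $\mathcal{F}_2$ besides, when $k' = 2$, one trivial (forced) zero at the elliptic point $-\frac12+\frac i2$ coming from the weight; these $n+\lfloor k/4\rfloor$ zeros are the nontrivial zeros. *)

theory Defs
  imports "HOL-Complex_Analysis.Complex_Analysis" "HOL-Number_Theory.Cong"
begin

definition upper_half_plane :: "complex set" where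
  "upper_half_plane = {z. Im z > 0}"

definition SL2Z :: "(int^2^2) set" where
  "SL2Z = {A. det A = 1}"

definition Gamma0_2 :: "(int^2^2) set" where
  "Gamma0_2 = {A \<in> SL2Z. [A $ 2 $ 1 = 0] (mod 2)}"

definition slash :: "int \<Rightarrow> (complex \<Rightarrow> complex) \<Rightarrow> int^2^2 \<Rightarrow> complex \<Rightarrow> complex" where
  "slash k f A z =
     (of_int (A $ 2 $ 1) * z + of_int (A $ 2 $ 2)) powi (- k) *
     f ((of_int (A $ 1 $ 1) * z + of_int (A $ 1 $ 2)) /
        (of_int (A $ 2 $ 1) * z + of_int (A $ 2 $ 2)))"

definition has_fourier_expansion ::
  "nat \<Rightarrow> (complex \<Rightarrow> complex) \<Rightarrow> (int \<Rightarrow> complex) \<Rightarrow> bool" where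
  "has_fourier_expansion h g a \<longleftrightarrow>
     (\<forall>z\<in>upper_half_plane.
        ((\<lambda>m. a m * exp (2 * of_real pi * \<i> * of_int m * z / of_nat h)) has_sum g z) UNIV)"

text \<open>
  The cusps are the points \<open>A \<infinity>\<close> with \<open>A \<in> SL2Z\<close>. Since the principal congruence subgroup of
  level 2 is normal and contained in \<open>Gamma0_2\<close>, the function \<open>slash k f A\<close> has period 2 for every
  \<open>A\<close>, so every cusp can be treated with the local parameter \<open>exp (\<pi> \<i> z)\<close>, whatever its
  actual width (1 at \<open>\<infinity>\<close>, 2 at \<open>0\<close>).
\<close>

definition meromorphic_at_cusp :: "int \<Rightarrow> (complex \<Rightarrow> complex) \<Rightarrow> int^2^2 \<Rightarrow> bool" where
  "meromorphic_at_cusp k f A \<longleftrightarrow>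
     (\<exists>a m0. has_fourier_expansion 2 (slash k f A) a \<and> (\<forall>m<m0. a m = 0))"

definition holomorphic_at_cusp :: "int \<Rightarrow> (complex \<Rightarrow> complex) \<Rightarrow> int^2^2 \<Rightarrow> bool" where
  "holomorphic_at_cusp k f A \<longleftrightarrow>
     (\<exists>a. has_fourier_expansion 2 (slash k f A) a \<and> (\<forall>m<0. a m = 0))"

definition weakly_holomorphic_forms :: "int \<Rightarrow> (complex \<Rightarrow> complex) set" where
  "weakly_holomorphic_forms k =
     {f. f holomorphic_on upper_half_plane \<and>
         (\<forall>A\<in>Gamma0_2. \<forall>z\<in>upper_half_plane. slash k f A z = f z) \<and>
         (\<forall>A\<in>SL2Z. meromorphic_at_cusp k f A)}"

text \<open>
  The cusp \<open>A \<infinity>\<close> is equivalent to \<open>\<infinity>\<close> under \<open>Gamma0_2\<close> iff \<open>A \<in> Gamma0_2\<close>.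
\<close>

definition M_sharp :: "int \<Rightarrow> (complex \<Rightarrow> complex) set" where
  "M_sharp k =
     {f \<in> weakly_holomorphic_forms k. \<forall>A \<in> SL2Z - Gamma0_2. holomorphic_at_cusp k f A}"

text \<open>\<open>f = q^(-n) + O(q^(l+1))\<close> with \<open>q = exp (2 \<pi> \<i> z)\<close>, where \<open>-n \<le> l\<close>\<close>

definition has_leading_form :: "(complex \<Rightarrow> complex) \<Rightarrow> int \<Rightarrow> int \<Rightarrow> bool" where
  "has_leading_form f n l \<longleftrightarrow>
     (\<exists>a. has_fourier_expansion 1 f a \<and> a (- n) = 1 \<and> (\<forall>m\<le>l. m \<noteq> - n \<longrightarrow> a m = 0))"

definition fundamental_domain_2 :: "complex set" where
  "fundamental_domain_2 =
     {z \<in> upper_half_plane. - 1/2 \<le> Re z \<and> Re z < 1/2 \<and>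
        cmod (z + 1/2) \<ge> 1/2 \<and> cmod (z - 1/2) > 1/2}"

definition lower_boundary_2 :: "complex set" where
  "lower_boundary_2 = (\<lambda>\<theta>. - 1/2 + 1/2 * exp (\<i> * of_real \<theta>)) ` {0<..pi/2}"

definition elliptic_point :: complex where
  "elliptic_point = - 1/2 + \<i>/2"

text \<open>
  Number of nontrivial zeros at a point of the fundamental domain, as counted by the valence
  formula, where the order at the elliptic point of order 2 has weight 1/2. The order of a nonzero
  form of weight \<open>k\<close> there is congruent to \<open>k/2\<close> modulo 2; if \<open>k mod 4 = 2\<close>, one zero is forced by
  the weight and is removed. The division below is therefore exact.
\<close>

definition nontrivial_multiplicity :: "int \<Rightarrow> (complex \<Rightarrow> complex) \<Rightarrow> complex \<Rightarrow> int" where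
  "nontrivial_multiplicity k f z =
     (if z = elliptic_point
      then (zorder f z - (if k mod 4 = 2 then 1 else 0)) div 2
      else zorder f z)"

definition nontrivial_zeros_count :: "int \<Rightarrow> (complex \<Rightarrow> complex) \<Rightarrow> complex set \<Rightarrow> int" where
  "nontrivial_zeros_count k f S =
     (\<Sum>z | z \<in> fundamental_domain_2 \<inter> S \<and> f z = 0. nontrivial_multiplicity k f z)"

end

theory Submission
  imports Defs
begin

text \<open>
  With \<open>e = k'/2\<close>, the form is \<open>S^l F^e p(1/v)\<close>, where \<open>S\<close> has weight 4 and its only zero at \<open>\<infinity>\<close>, \<open>1/v\<close> is a
  Hauptmodul, \<open>F = q v'/v\<close> has weight 2, and \<open>p\<close> is a real polynomial. The value \<open>p x\<close> is the residue at
  \<open>q = 0\<close> of an explicit kernel with denominator \<open>1 - x v(q)\<close>. If \<open>x = 1/v(q\<^sub>1)\<close> for \<open>q\<^sub>1\<close> coming from the point \<open>z\<close>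
  with angle \<open>\<theta>\<close> of the lower boundary, then the only other poles in \<open>\<bar>q\<bar> < 8/25\<close> are \<open>q\<^sub>1\<close> and its
  conjugate. The residue theorem therefore gives
  \<open>e^(ik\<theta>/2) e^(-\<pi> n sin \<theta>) f(z) = 2 cos (\<pi> (n (cos \<theta> - 1) - k\<theta>/(2\<pi>))) + error\<close>, with the error bounded by the integral
  over the circle. The left hand side is real, and as \<open>\<theta>\<close> decreases from \<open>\<pi>/2\<close> to about \<open>\<pi>/6\<close> the cosine takes
  enough alternating values larger than the error. When \<open>k' = 2\<close>, \<open>\<theta> = \<pi>/6\<close> may fall just short of the
  last sample, and \<open>\<theta>\<close> runs down to \<open>arccos (7/8)\<close> unless \<open>n\<close> is small.
\<close>

section \<open>Infinite q-products\<close>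

text \<open>The number in the theorem is the phase gained on the arc between \<pi>/2 and \<pi>/6. At
  \<pi>/6 the phase is \<open>n (sqrt 3 / 2 - 1) - k / 12\<close>; the first sample is
  \<open>- n - l\<close> with \<open>l = k / 4 - e / 2\<close>, so the gain is
  \<open>sqrt 3 / 2 n + k / 6 - e / 2\<close>. For \<open>e = 0\<close> this suffices. For
  \<open>e = 1\<close> half a unit is missing and must come from the tolerance of the cosine, from
  the floor, or from angles below \<pi>/6. The obstacle is the error. It behaves like the
  \<open>(n + l)\<close>-th power of the quotient of \<open>norm q1\<close> by the radius of the
  contour, which asks for a large circle; but a larger disc may contain more solutions of
  \<open>x * fv q = 1\<close>, and the bounds on the q-products deteriorate. The radius 8/25
  balances this: apart from 0 there are exactly two poles inside, and \<open>1 - x * fv q\<close>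
  has modulus at least 2/5 on the circle. The slopes 14 and 15 in the hypotheses pay for the
  quotient of \<open>fG q1\<close> and \<open>fG q\<close> to the power \<open>8 l\<close>, the
  constant 8 for what remains. Where a q-product converges too slowly, the Fricke involution
  \<open>- 1 / (2 * \<tau>)\<close>, which exchanges the two cusps, moves it to a smaller
  nome.\<close>

lemma norm_Ln_one_minus_le:
  assumes "norm w < 1"
  shows "norm (Ln (1 - w)) \<le> norm w / (1 - norm w)"
proof -
  have "(\<lambda>n. - ((- (- w)) ^ n) / of_nat n) sums Ln (1 + (- w))"
    by (rule Ln_series') (use assms in auto)
  then have "(\<lambda>n. - (w ^ n) / of_nat n) sums Ln (1 - w)" by simp
  then have s: "(\<lambda>n. - (w ^ Suc n) / of_nat (Suc n)) sums Ln (1 - w)"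
    by (subst sums_Suc_iff) simp
  have g: "(\<lambda>n. norm w * norm w ^ n) sums (norm w * (1 / (1 - norm w)))"
    using assms by (intro sums_mult geometric_sums) auto
  have le: "norm (- (w ^ Suc n) / of_nat (Suc n)) \<le> norm w * norm w ^ n" for n
  proof -
    have "norm (- (w ^ Suc n) / of_nat (Suc n)) = norm w * norm w ^ n / real (Suc n)"
      by (simp add: norm_divide norm_mult norm_power del: of_nat_Suc)
    also have "\<dots> \<le> norm w * norm w ^ n / 1"
      by (intro divide_left_mono) auto
    finally show ?thesis by simp
  qed
  have "norm (\<Sum>n. - (w ^ Suc n) / of_nat (Suc n)) \<le> (\<Sum>n. norm w * norm w ^ n)"
    by (rule norm_suminf_le[OF le sums_summable[OF g]])
  then show ?thesis
    using s g by (simp add: sums_iff)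
qed

text \<open>\<open>qpoch a q\<close> is the product of the factors \<open>1 - a q^n\<close> over \<open>n \<ge> 0\<close>; both constants are meaningful only for
  \<open>norm a < 1\<close> and \<open>norm q < 1\<close>.\<close>
definition qlog :: "complex \<Rightarrow> complex \<Rightarrow> complex" where
  "qlog a q = (\<Sum>n. Ln (1 - a * q ^ n))"

definition qpoch :: "complex \<Rightarrow> complex \<Rightarrow> complex" where
  "qpoch a q = exp (qlog a q)"

lemma qpoch_nonzero [simp]: "qpoch a q \<noteq> 0"
  by (simp add: qpoch_def)

lemma norm_mult_power_le:
  fixes a q :: complex
  assumes "norm q \<le> 1"
  shows "norm (a * q ^ n) \<le> norm a"
  using assms by (simp add: norm_mult norm_power mult_left_le power_le_one)

lemma norm_qlog_term_le:
  assumes "norm a \<le> c" "c < 1" "norm q \<le> b" "b < 1"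
  shows "norm (Ln (1 - a * q ^ n)) \<le> c / (1 - c) * b ^ n"
proof -
  have 1: "norm (a * q ^ n) \<le> c"
    using norm_mult_power_le[of q a n] assms by linarith
  have 2: "norm (a * q ^ n) \<le> c * b ^ n"
    unfolding norm_mult norm_power
    by (intro mult_mono power_mono assms zero_le_power norm_ge_zero order_trans[OF norm_ge_zero assms(1)])
  have "norm (Ln (1 - a * q ^ n)) \<le> norm (a * q ^ n) / (1 - norm (a * q ^ n))"
    by (rule norm_Ln_one_minus_le) (use 1 assms in linarith)
  also have "\<dots> \<le> (c * b ^ n) / (1 - c)"
    using 1 2 assms by (intro frac_le) (auto intro: order_trans[OF norm_ge_zero])
  finally show ?thesis by (simp add: field_simps)
qed

lemma summable_qlog:
  assumes "norm a < 1" "norm q < 1"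
  shows "summable (\<lambda>n. Ln (1 - a * q ^ n))"
proof (rule summable_comparison_test)
  show "\<exists>N. \<forall>n\<ge>N. norm (Ln (1 - a * q ^ n)) \<le> norm a / (1 - norm a) * norm q ^ n"
    using norm_qlog_term_le[OF order_refl assms(1) order_refl assms(2)] by blast
  show "summable (\<lambda>n. norm a / (1 - norm a) * norm q ^ n)"
    using assms by (intro summable_mult summable_geometric) auto
qed

lemma norm_qlog_le:
  assumes "norm a < 1" "norm q < 1"
  shows "norm (qlog a q) \<le> norm a / ((1 - norm a) * (1 - norm q))"
proof -
  have "(\<lambda>n. norm a / (1 - norm a) * norm q ^ n) sums (norm a / (1 - norm a) * (1 / (1 - norm q)))"
    using assms by (intro sums_mult geometric_sums) auto
  then have "summable (\<lambda>n. norm a / (1 - norm a) * norm q ^ n)"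
    and e: "(\<Sum>n. norm a / (1 - norm a) * norm q ^ n) = norm a / (1 - norm a) * (1 / (1 - norm q))"
    by (auto simp only: sums_iff)
  from norm_suminf_le[OF norm_qlog_term_le[OF order_refl assms(1) order_refl assms(2)] this(1)]
  show ?thesis unfolding qlog_def e by simp
qed

lemma qlog_rec:
  assumes "norm a < 1" "norm q < 1"
  shows "qlog a q = Ln (1 - a) + qlog (a * q) q"
  using suminf_split_head[OF summable_qlog[OF assms]]
  by (simp add: qlog_def mult.assoc)

lemma qpoch_rec:
  assumes "norm a < 1" "norm q < 1"
  shows "qpoch a q = (1 - a) * qpoch (a * q) q"
proof -
  have "1 - a \<noteq> 0" using assms by auto
  then show ?thesis by (simp add: qpoch_def qlog_rec[OF assms] exp_add)
qed

text \<open>Both factors have positive real part, so their arguments lie in (-\<pi>/2, \<pi>/2) and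
  the principal logarithms add up without a multiple of 2\<pi>i.\<close>

lemma Ln_one_minus_square:
  assumes "norm w < 1"
  shows "Ln (1 - w\<^sup>2) = Ln (1 - w) + Ln (1 + w)"
proof -
  have r: "Re (1 - w) > 0" "Re (1 + w) > 0"
    using assms abs_Re_le_cmod[of w] by auto
  then have nz: "1 - w \<noteq> 0" "1 + w \<noteq> 0" by (metis less_irrefl zero_complex.sel(1))+
  have "\<bar>Im (Ln (1 - w))\<bar> < pi / 2" "\<bar>Im (Ln (1 + w))\<bar> < pi / 2"
    using r nz Re_Ln_pos_lt by blast+
  then have "Ln ((1 - w) * (1 + w)) = Ln (1 - w) + Ln (1 + w)"
    by (intro Ln_times_simple nz) (auto simp: abs_less_iff)
  then show ?thesis by (simp add: algebra_simps power2_eq_square)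
qed

lemma qpoch_square:
  assumes "norm a < 1" "norm q < 1"
  shows "qpoch (a\<^sup>2) (q\<^sup>2) = qpoch a q * qpoch (- a) q"
proof -
  have "Ln (1 - a\<^sup>2 * (q\<^sup>2) ^ n) = Ln (1 - a * q ^ n) + Ln (1 - (- a) * q ^ n)" for n
  proof -
    have "norm (a * q ^ n) < 1" using norm_mult_power_le[of q a n] assms by linarith
    from Ln_one_minus_square[OF this] show ?thesis
      by (simp add: power_mult_distrib flip: power_mult) (simp add: mult.commute)
  qed
  then have "qlog (a\<^sup>2) (q\<^sup>2) = qlog a q + qlog (- a) q"
    using suminf_add[OF summable_qlog[of a q] summable_qlog[of "- a" q]] assms
    unfolding qlog_def by simp
  then show ?thesis by (simp add: qpoch_def exp_add)
qed

lemma qpoch_even_odd: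
  assumes "norm a < 1" "norm q < 1"
  shows "qpoch a q = qpoch a (q\<^sup>2) * qpoch (a * q) (q\<^sup>2)"
proof -
  have q2: "norm (q\<^sup>2) < 1" using assms by (simp add: norm_power power_less_one_iff)
  have aq: "norm (a * q) < 1" using norm_mult_power_le[of q a 1] assms by simp
  have "(\<lambda>n. sum (\<lambda>n. Ln (1 - a * q ^ n)) {n * 2..<n * 2 + 2}) sums qlog a q"
    unfolding qlog_def by (intro sums_group summable_sums summable_qlog assms) auto
  moreover have "sum (\<lambda>n. Ln (1 - a * q ^ n)) {n * 2..<n * 2 + 2}
       = Ln (1 - a * (q\<^sup>2) ^ n) + Ln (1 - a * q * (q\<^sup>2) ^ n)" for n
  proof -
    have "q ^ (n * 2) = (q\<^sup>2) ^ n" by (simp only: mult.commute[of n 2] power_mult)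
    moreover have "{n * 2..<n * 2 + 2} = {n * 2, Suc (n * 2)}" by auto
    ultimately show ?thesis by (simp add: mult.assoc)
  qed
  ultimately have "(\<lambda>n. Ln (1 - a * (q\<^sup>2) ^ n) + Ln (1 - a * q * (q\<^sup>2) ^ n)) sums qlog a q" by simp
  moreover have "(\<lambda>n. Ln (1 - a * (q\<^sup>2) ^ n) + Ln (1 - a * q * (q\<^sup>2) ^ n))
       sums (qlog a (q\<^sup>2) + qlog (a * q) (q\<^sup>2))"
    unfolding qlog_def by (intro sums_add summable_sums summable_qlog assms q2 aq)
  ultimately have "qlog a q = qlog a (q\<^sup>2) + qlog (a * q) (q\<^sup>2)" by (rule sums_unique2)
  then show ?thesis by (simp add: qpoch_def exp_add)
qed

text \<open>A geometric series dominates the logarithms locally uniformly, so the sum may be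
  differentiated term by term. The series of derivatives is part of the conclusion because
  \<open>norm_fF_le\<close> estimates it termwise.\<close>

lemma qlog_has_field_derivative:
  assumes "open S" and g: "g holomorphic_on S" and h: "h holomorphic_on S"
    and g1: "\<And>z. z \<in> S \<Longrightarrow> norm (g z) < 1" and h1: "\<And>z. z \<in> S \<Longrightarrow> norm (h z) < 1"
    and "z \<in> S"
  shows "\<exists>D. (\<lambda>n. deriv (\<lambda>z. Ln (1 - g z * h z ^ n)) z) sums D \<and>
             ((\<lambda>z. qlog (g z) (h z)) has_field_derivative D) (at z)"
proof -
  have "\<exists>G G'. \<forall>x \<in> S. ((\<lambda>n. Ln (1 - g x * h x ^ n)) sums G x) \<and>
      ((\<lambda>n. deriv (\<lambda>z. Ln (1 - g z * h z ^ n)) x) sums G' x) \<and> (G has_field_derivative G' x) (at x)"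
  proof (rule series_and_derivative_comparison_local[OF \<open>open S\<close>])
    fix n x assume x: "x \<in> S"
    have "1 - g y * h y ^ n \<notin> \<real>\<^sub>\<le>\<^sub>0" if "y \<in> S" for y
    proof -
      have "norm (g y * h y ^ n) < 1"
        using norm_mult_power_le[of "h y" "g y" n] g1[OF that] h1[OF that] by linarith
      then have "Re (1 - g y * h y ^ n) > 0"
        using complex_Re_le_cmod[of "g y * h y ^ n"] by simp
      then show ?thesis by (auto simp: complex_nonpos_Reals_iff)
    qed
    then have "(\<lambda>z. Ln (1 - g z * h z ^ n)) holomorphic_on S"
      by (intro holomorphic_intros g h) auto
    then show "((\<lambda>z. Ln (1 - g z * h z ^ n)) has_field_derivative
        deriv (\<lambda>z. Ln (1 - g z * h z ^ n)) x) (at x)"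
      using \<open>open S\<close> x holomorphic_derivI by blast
  next
    fix x assume x: "x \<in> S"
    obtain e where e: "e > 0" "cball x e \<subseteq> S"
      using \<open>open S\<close> x open_contains_cball by blast
    \<comment> \<open>On a compact ball the maxima of both moduli are still below 1; they provide
      the constant and the ratio of the dominating geometric series.\<close>
    have "continuous_on (cball x e) (\<lambda>z. norm (g z))" "continuous_on (cball x e) (\<lambda>z. norm (h z))"
      using g h e by (auto intro!: continuous_on_norm holomorphic_on_imp_continuous_on
          intro: holomorphic_on_subset)
    then obtain y1 y2 where y: "y1 \<in> cball x e" "y2 \<in> cball x e"
      "\<And>z. z \<in> cball x e \<Longrightarrow> norm (g z) \<le> norm (g y1)"
      "\<And>z. z \<in> cball x e \<Longrightarrow> norm (h z) \<le> norm (h y2)"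
      using continuous_attains_sup[of "cball x e" "\<lambda>z. norm (g z)"]
        continuous_attains_sup[of "cball x e" "\<lambda>z. norm (h z)"] e by (auto simp: not_less)
    have lt: "norm (g y1) < 1" "norm (h y2) < 1" using y e g1 h1 by auto
    show "\<exists>d h'. 0 < d \<and> summable h' \<and>
       (\<forall>\<^sub>F n in sequentially. \<forall>y\<in>ball x d \<inter> S. norm (Ln (1 - g y * h y ^ n)) \<le> h' n)"
    proof (intro exI[of _ e] exI[of _ "\<lambda>n. norm (g y1) / (1 - norm (g y1)) * norm (h y2) ^ n"] conjI
        always_eventually allI ballI)
      show "summable (\<lambda>n. norm (g y1) / (1 - norm (g y1)) * norm (h y2) ^ n)"
        using lt by (intro summable_mult summable_geometric) auto
      fix n y assume "y \<in> ball x e \<inter> S"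
      then show "norm (Ln (1 - g y * h y ^ n)) \<le> norm (g y1) / (1 - norm (g y1)) * norm (h y2) ^ n"
        by (intro norm_qlog_term_le lt y) auto
    qed (rule e)
  qed
  then obtain G G' where GG: "\<And>x. x \<in> S \<Longrightarrow> (\<lambda>n. Ln (1 - g x * h x ^ n)) sums G x"
      "\<And>x. x \<in> S \<Longrightarrow> (\<lambda>n. deriv (\<lambda>z. Ln (1 - g z * h z ^ n)) x) sums G' x"
      "\<And>x. x \<in> S \<Longrightarrow> (G has_field_derivative G' x) (at x)" by blast
  have "((\<lambda>z. qlog (g z) (h z)) has_field_derivative G' z) (at z)"
    by (rule has_field_derivative_transform_within_open[OF GG(3)])
      (use GG(1) \<open>z \<in> S\<close> \<open>open S\<close> in \<open>auto simp: qlog_def sums_iff\<close>)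
  with GG(2)[OF \<open>z \<in> S\<close>] show ?thesis by blast
qed

lemma qlog_holomorphic:
  assumes "open S" "g holomorphic_on S" "h holomorphic_on S"
    "\<And>z. z \<in> S \<Longrightarrow> norm (g z) < 1" "\<And>z. z \<in> S \<Longrightarrow> norm (h z) < 1"
  shows "(\<lambda>z. qlog (g z) (h z)) holomorphic_on S"
  using qlog_has_field_derivative[OF assms] \<open>open S\<close>
  by (auto simp: holomorphic_on_open)

lemma qpoch_holomorphic:
  assumes "open S" "g holomorphic_on S" "h holomorphic_on S"
    "\<And>z. z \<in> S \<Longrightarrow> norm (g z) < 1" "\<And>z. z \<in> S \<Longrightarrow> norm (h z) < 1"
  shows "(\<lambda>z. qpoch (g z) (h z)) holomorphic_on S"
  unfolding qpoch_def by (intro holomorphic_intros qlog_holomorphic assms)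

lemma qlog_cnj:
  assumes "norm a < 1" "norm q < 1"
  shows "qlog (cnj a) (cnj q) = cnj (qlog a q)"
proof -
  have "Ln (1 - cnj a * cnj q ^ n) = cnj (Ln (1 - a * q ^ n))" for n
  proof -
    have "norm (a * q ^ n) < 1" using norm_mult_power_le[of q a n] assms by linarith
    then have "Re (1 - a * q ^ n) > 0" using complex_Re_le_cmod[of "a * q ^ n"] by simp
    then have "1 - a * q ^ n \<notin> \<real>\<^sub>\<le>\<^sub>0" by (auto simp: complex_nonpos_Reals_iff)
    then show ?thesis by (subst cnj_Ln) simp_all
  qed
  then show ?thesis
    using sums_cnj[THEN iffD2, OF summable_sums[OF summable_qlog[OF assms]]]
    unfolding qlog_def by (simp add: sums_iff)
qed

lemma qpoch_cnj:
  assumes "norm a < 1" "norm q < 1"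
  shows "qpoch (cnj a) (cnj q) = cnj (qpoch a q)"
  by (simp add: qpoch_def qlog_cnj[OF assms] exp_cnj)

lemma qpoch_bounds:
  assumes "norm a < 1" "norm q < 1"
  shows "exp (- (norm a / ((1 - norm a) * (1 - norm q)))) \<le> norm (qpoch a q)"
    and "norm (qpoch a q) \<le> exp (norm a / ((1 - norm a) * (1 - norm q)))"
  using norm_qlog_le[OF assms] abs_Re_le_cmod[of "qlog a q"] by (auto simp: qpoch_def)

section \<open>The Fricke involution\<close>

definition ee :: "complex \<Rightarrow> complex" where
  "ee z = exp (2 * of_real pi * \<i> * z)"

lemma norm_ee: "norm (ee z) = exp (- 2 * pi * Im z)"
  by (simp add: ee_def)

lemma norm_ee_less_1: "Im z > 0 \<Longrightarrow> norm (ee z) < 1"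
  by (simp add: norm_ee)

lemma ee_nonzero [simp]: "ee z \<noteq> 0"
  by (simp add: ee_def)

lemma ee_add: "ee (z + w) = ee z * ee w"
  by (simp add: ee_def exp_add ring_distribs)

lemma ee_minus: "ee (- z) = inverse (ee z)"
  by (simp add: ee_def exp_minus)

lemma ee_diff: "ee (z - w) = ee z / ee w"
  using ee_add[of z "- w"] by (simp add: ee_minus field_simps)

lemma ee_of_nat_mult: "ee (of_nat n * z) = ee z ^ n"
  by (simp add: ee_def exp_of_nat_mult[symmetric] mult_ac)

lemma ee_1 [simp]: "ee 1 = 1"
  by (simp add: ee_def)

lemma ee_0 [simp]: "ee 0 = 1"
  by (simp add: ee_def)

lemma ee_half [simp]: "ee (1 / 2) = - 1"
  by (simp add: ee_def)

lemma ee_eq_1_iff: "ee z = 1 \<longleftrightarrow> z \<in> \<int>"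
proof
  assume "ee z = 1"
  then have "Re (2 * of_real pi * \<i> * z) = 0 \<and> (\<exists>n::int. Im (2 * of_real pi * \<i> * z) = of_int (2 * n) * pi)"
    unfolding ee_def exp_eq_1 .
  then obtain n :: int where "z = of_int n" by (auto simp: complex_eq_iff)
  then show "z \<in> \<int>" by simp
qed (auto simp: ee_def elim!: Ints_cases simp: exp_eq_1)

lemma ee_cnj: "ee (- cnj z) = cnj (ee z)"
  by (simp add: ee_def exp_cnj)

lemma ee_holomorphic [holomorphic_intros]:
  "f holomorphic_on S \<Longrightarrow> (\<lambda>z. ee (f z)) holomorphic_on S"
  unfolding ee_def by (intro holomorphic_intros)

lemma Im_fricke: "Im (- 1 / (2 * \<tau>)) = Im \<tau> / (2 * (norm \<tau>)\<^sup>2)"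
proof -
  have "4 * (Re \<tau>)\<^sup>2 + 4 * (Im \<tau>)\<^sup>2 = 4 * (norm \<tau>)\<^sup>2" by (simp add: cmod_power2)
  then show ?thesis by (simp add: Im_divide power_mult_distrib)
qed

lemma Re_fricke: "Re (- 1 / (2 * \<tau>)) = - Re \<tau> / (2 * (norm \<tau>)\<^sup>2)"
proof -
  have "4 * (Re \<tau>)\<^sup>2 + 4 * (Im \<tau>)\<^sup>2 = 4 * (norm \<tau>)\<^sup>2" by (simp add: cmod_power2)
  then show ?thesis by (simp add: Re_divide power_mult_distrib)
qed

lemma Im_fricke_pos: "Im \<tau> > 0 \<Longrightarrow> Im (- 1 / (2 * \<tau>)) > 0"
  unfolding Im_fricke by (intro divide_pos_pos mult_pos_pos zero_less_power) auto

section \<open>Inversion of the theta quotient\<close>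

text \<open>By the Jacobi triple product, \<open>(1 - ee z) * theta0 \<tau> z\<close> is a Jacobi theta function up to elementary factors.\<close>
definition theta0 :: "complex \<Rightarrow> complex \<Rightarrow> complex" where
  "theta0 \<tau> z = qpoch (ee (\<tau> + z)) (ee \<tau>) * qpoch (ee (\<tau> - z)) (ee \<tau>)"

lemma theta0_nonzero [simp]: "theta0 \<tau> z \<noteq> 0"
  by (simp add: theta0_def)

lemma theta0_periodic: "theta0 \<tau> (z + 1) = theta0 \<tau> z"
proof -
  have "ee (\<tau> + (z + 1)) = ee (\<tau> + z)" "ee (\<tau> - (z + 1)) = ee (\<tau> - z)"
    by (simp_all add: ee_add ee_diff)
  then show ?thesis by (simp add: theta0_def)
qed

lemma theta0_holomorphic:
  assumes "Im \<tau> > 0" "open S" "f holomorphic_on S" "\<And>z. z \<in> S \<Longrightarrow> \<bar>Im (f z)\<bar> < Im \<tau>"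
  shows "(\<lambda>z. theta0 \<tau> (f z)) holomorphic_on S"
  unfolding theta0_def
  by (intro holomorphic_intros qpoch_holomorphic assms norm_ee_less_1)
    (use assms(1,4) in \<open>force simp: abs_less_iff\<close>)+

text \<open>The shift by \<tau> moves one factor from the second product to the first. The strip is
  exactly where \<open>qpoch_rec\<close> applies to both \<open>ee (z + \<tau>)\<close> and
  \<open>ee (- z)\<close>.\<close>

lemma theta0_shift:
  assumes "- Im \<tau> < Im z" "Im z < 0"
  shows "(1 - ee (z + \<tau>)) * theta0 \<tau> (z + \<tau>) = - ee (- z) * (1 - ee z) * theta0 \<tau> z"
proof -
  let ?q = "ee \<tau>"
  have 1: "norm ?q < 1" "norm (ee (z + \<tau>)) < 1" "norm (ee (- z)) < 1"
    using assms by (auto intro!: norm_ee_less_1)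
  have "qpoch (ee (z + \<tau>)) ?q = (1 - ee (z + \<tau>)) * qpoch (ee (\<tau> + (z + \<tau>))) ?q"
    using qpoch_rec[OF 1(2,1)] ee_add[of "z + \<tau>" \<tau>] by (simp only: add.commute)
  moreover have "qpoch (ee (- z)) ?q = (1 - ee (- z)) * qpoch (ee (\<tau> - z)) ?q"
    using qpoch_rec[OF 1(3,1)] ee_add[of "- z" \<tau>] by simp
  moreover have "- ee (- z) * (1 - ee z) = 1 - ee (- z)"
    by (simp add: ee_minus field_simps)
  ultimately show ?thesis
    unfolding theta0_def by (simp add: add.commute[of z \<tau>])
qed

lemma exp_pi_ii_odd: "exp (of_real pi * \<i> * (- 2 * z - 1)) = - ee (- z)"
proof -
  have "of_real pi * \<i> * (- 2 * z - 1) = 2 * of_real pi * \<i> * (- z) - of_real pi * \<i>"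
    by (simp add: algebra_simps)
  then show ?thesis by (simp add: ee_def exp_diff)
qed

text \<open>The quotient of the theta functions for \<open>-1/\<tau>\<close> and \<open>\<tau>\<close>, with its Gaussian factor, is holomorphic on the
  set of \<open>s + t \<tau>\<close> with \<open>\<bar>s\<bar>, \<bar>t\<bar> < 1\<close> and doubly periodic there, so its modulus has an interior maximum
  and it is constant. Comparing its values at \<open>0\<close> and \<open>1/2\<close> yields the transformation law.\<close>
context
  fixes \<tau> :: complex
  assumes tau: "Im \<tau> > 0"
begin

private definition tc :: "complex \<Rightarrow> real" where "tc z = Im z / Im \<tau>"
private definition sc :: "complex \<Rightarrow> real" where "sc z = Re z - tc z * Re \<tau>"

private lemma coords: "z = of_real (sc z) + of_real (tc z) * \<tau>"
  using tau by (simp add: complex_eq_iff sc_def tc_def)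

private lemma coords_eq: "sc (of_real s + of_real t * \<tau>) = s" "tc (of_real s + of_real t * \<tau>) = t"
  using tau by (simp_all add: sc_def tc_def)

private lemma tau_nz: "\<tau> \<noteq> 0"
  using tau by auto

private lemma im_inv: "Im (- 1 / \<tau>) > 0"
  using tau tau_nz by (simp add: Im_divide Re_divide sum_power2_gt_zero_iff complex_eq_iff)

private lemma im_div: "Im (z / \<tau>) = - sc z * Im (- 1 / \<tau>)"
proof -
  have "z / \<tau> = of_real (sc z) * (1 / \<tau>) + of_real (tc z)"
    using tau_nz by (subst coords[of z]) (simp add: field_simps)
  then have "Im (z / \<tau>) = sc z * Im (1 / \<tau>)"
    by (simp only: plus_complex.sel times_complex.sel Re_complex_of_real Im_complex_of_real)
  then show ?thesis by (simp only: minus_divide_left[symmetric] uminus_complex.sel)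
qed

private definition Rg :: "complex set" where "Rg = {z. \<bar>sc z\<bar> < 1 \<and> \<bar>tc z\<bar> < 1}"

text \<open>These two strips are where the products of both theta quotients converge; hence the
  restriction of the argument to an open parallelogram instead of the whole plane.\<close>

private lemma RgD:
  assumes "z \<in> Rg"
  shows "\<bar>Im z\<bar> < Im \<tau>" "\<bar>Im (z / \<tau>)\<bar> < Im (- 1 / \<tau>)"
proof -
  show "\<bar>Im z\<bar> < Im \<tau>"
  proof -
    have "\<bar>Im z\<bar> / Im \<tau> < 1" using assms tau by (auto simp: Rg_def tc_def abs_divide)
    then show ?thesis using tau by (simp add: divide_less_eq)
  qed
  have "\<bar>Im (z / \<tau>)\<bar> = \<bar>sc z\<bar> * Im (- 1 / \<tau>)"
    using im_inv by (subst im_div) (simp only: abs_mult abs_minus_cancel abs_of_pos)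
  also have "\<dots> < 1 * Im (- 1 / \<tau>)"
    using assms im_inv by (intro mult_strict_right_mono) (auto simp: Rg_def)
  finally show "\<bar>Im (z / \<tau>)\<bar> < Im (- 1 / \<tau>)" by simp
qed

private lemma open_Rg: "open Rg"
  unfolding Rg_def sc_def tc_def
  by (intro open_Collect_conj open_Collect_less continuous_intros) (use tau in auto)

private lemma connected_Rg: "connected Rg"
proof -
  have "Rg = (\<lambda>(s, t). of_real s + of_real t * \<tau>) ` ({-1<..<1} \<times> {-1<..<1})"
  proof (intro equalityI subsetI)
    fix z assume "z \<in> Rg"
    then show "z \<in> (\<lambda>(s, t). of_real s + of_real t * \<tau>) ` ({-1<..<1} \<times> {-1<..<1})"
      by (intro image_eqI[of _ _ "(sc z, tc z)"]) (auto simp: Rg_def simp flip: coords)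
  qed (auto simp: Rg_def coords_eq)
  moreover have "connected (({-1<..<1} \<times> {-1<..<1}) :: (real \<times> real) set)"
    by (intro connected_Times) auto
  ultimately show ?thesis
    by (auto intro!: connected_continuous_image continuous_intros simp: case_prod_unfold)
qed

text \<open>The quadratic term is the classical multiplier of theta inversion. The linear terms
  compensate for writing \<open>1 - ee z\<close> and \<open>1 - ee (z / \<tau>)\<close> in place of
  the corresponding sines.\<close>

private definition gs :: "complex \<Rightarrow> complex" where
  "gs z = exp (of_real pi * \<i> * (- z\<^sup>2 / \<tau> + z - z / \<tau>))"

private definition Q :: "complex \<Rightarrow> complex" where
  "Q z = gs z * (if z = 0 then 1 / \<tau> else (1 - ee (z / \<tau>)) / (1 - ee z))
           * (theta0 (- 1 / \<tau>) (z / \<tau>) / theta0 \<tau> z)"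

private lemma ee_neq_1: "z \<in> Rg \<Longrightarrow> z \<noteq> 0 \<Longrightarrow> ee z \<noteq> 1"
proof
  assume z: "z \<in> Rg" "z \<noteq> 0" and "ee z = 1"
  then obtain m :: int where m: "z = of_int m" by (auto simp: ee_eq_1_iff elim: Ints_cases)
  then have "tc z = 0" by (simp add: tc_def)
  then have "\<bar>real_of_int m\<bar> < 1" using z m by (simp add: Rg_def sc_def)
  then have "m = 0" by linarith
  with m z show False by simp
qed

text \<open>The only zero of \<open>1 - ee z\<close> in \<open>Rg\<close> is 0, and there the
  quotient of the linear terms tends to \<open>1 / \<tau>\<close>, the value prescribed in
  \<open>Q\<close>; the singularity is therefore removable.\<close>

private lemma Q_holomorphic: "Q holomorphic_on Rg"
proof -
  define R where "R z = (if z = 0 then 1 / \<tau> else (1 - ee (z / \<tau>)) / (1 - ee z))" for z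
  have 0: "(0::complex) \<in> Rg" by (simp add: Rg_def sc_def tc_def)
  have R0: "R holomorphic_on (Rg - {0})"
  proof (rule holomorphic_transform)
    show "(\<lambda>z. (1 - ee (z / \<tau>)) / (1 - ee z)) holomorphic_on (Rg - {0})"
      using ee_neq_1 tau_nz by (intro holomorphic_intros) force+
  qed (auto simp: R_def)
  have lim: "(R \<longlongrightarrow> R 0) (at 0)"
  proof -
    have d: "((\<lambda>z. 1 - ee (z / c)) has_field_derivative (- 2 * of_real pi * \<i> / c)) (at 0)" if "c \<noteq> 0" for c
      unfolding ee_def by (rule derivative_eq_intros refl | simp add: that)+
    have l: "((\<lambda>z. (1 - ee (z / c)) / z) \<longlongrightarrow> - 2 * of_real pi * \<i> / c) (at 0)" if "c \<noteq> 0" for c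
      using d[OF that] by (simp add: has_field_derivative_iff)
    have "((\<lambda>z. ((1 - ee (z / \<tau>)) / z) / ((1 - ee (z / 1)) / z)) \<longlongrightarrow>
        (- 2 * of_real pi * \<i> / \<tau>) / (- 2 * of_real pi * \<i> / 1)) (at 0)"
      by (rule tendsto_divide[OF l[OF tau_nz] l]) auto
    then have "((\<lambda>z. ((1 - ee (z / \<tau>)) / z) / ((1 - ee (z / 1)) / z)) \<longlongrightarrow> R 0) (at 0)"
      by (simp add: R_def)
    then show ?thesis
      by (rule Lim_transform_eventually) (auto simp: eventually_at_filter R_def)
  qed
  have "R holomorphic_on Rg"
    by (rule no_isolated_singularity'[OF _ R0 open_Rg])
      (use lim in \<open>auto intro: tendsto_within_subset\<close>)
  moreover have "Q = (\<lambda>z. exp (of_real pi * \<i> * (- z\<^sup>2 / \<tau> + z - z / \<tau>)) * R z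
      * (theta0 (- 1 / \<tau>) (z / \<tau>) / theta0 \<tau> z))"
    by (simp add: fun_eq_iff Q_def gs_def R_def)
  ultimately show ?thesis
    by (simp only:, intro holomorphic_intros theta0_holomorphic tau im_inv open_Rg RgD theta0_nonzero)
      (simp_all add: tau_nz)
qed

private lemma Q_shift_tau:
  assumes "z \<in> Rg" "z + \<tau> \<in> Rg"
  shows "Q (z + \<tau>) = Q z"
proof -
  have t: "- Im \<tau> < Im z" "Im z < 0"
    using RgD(1)[OF assms(1)] RgD(1)[OF assms(2)] by auto
  then have nz: "z \<noteq> 0" "z + \<tau> \<noteq> 0" using tau by (auto simp: complex_eq_iff)
  have e1: "ee ((z + \<tau>) / \<tau>) = ee (z / \<tau>)" and e2: "theta0 (- 1 / \<tau>) ((z + \<tau>) / \<tau>) = theta0 (- 1 / \<tau>) (z / \<tau>)"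
    using tau_nz theta0_periodic[of "- 1 / \<tau>" "z / \<tau>"] by (simp_all add: add_divide_distrib ee_add)
  have "of_real pi * \<i> * (- (z + \<tau>)\<^sup>2 / \<tau> + (z + \<tau>) - (z + \<tau>) / \<tau>) =
      of_real pi * \<i> * (- z\<^sup>2 / \<tau> + z - z / \<tau>) + of_real pi * \<i> * (- 2 * z - 1)"
    using tau_nz by (simp add: field_simps power2_eq_square)
  then have g: "gs (z + \<tau>) = gs z * (- ee (- z))"
    unfolding gs_def by (simp only: exp_add exp_pi_ii_odd)
  have "Q (z + \<tau>) = gs z * (- ee (- z)) * (1 - ee (z / \<tau>)) * theta0 (- 1 / \<tau>) (z / \<tau>)
      / ((1 - ee (z + \<tau>)) * theta0 \<tau> (z + \<tau>))"
    unfolding Q_def g e1 e2 using nz by simp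
  also have "\<dots> = Q z"
    unfolding theta0_shift[OF t] using nz ee_neq_1[OF assms(1)] by (simp add: Q_def)
  finally show ?thesis .
qed

private lemma Q_shift_1:
  assumes "z \<in> Rg" "z + 1 \<in> Rg"
  shows "Q (z + 1) = Q z"
proof -
  have s: "tc (z + 1) = tc z" "sc (z + 1) = sc z + 1" by (simp_all add: sc_def tc_def)
  have nz: "z \<noteq> 0" "z + 1 \<noteq> 0" using assms s by (auto simp: Rg_def sc_def tc_def add_eq_0_iff2)
  have e: "ee (z + 1) = ee z" by (simp add: ee_add)
  define w where "w = (z + 1) / \<tau>"
  have w: "z / \<tau> = w + (- 1 / \<tau>)" by (simp add: w_def add_divide_distrib)
  have 1: "- Im (- 1 / \<tau>) < Im w"
    using RgD(2)[OF assms(2)] by (simp add: w_def)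
  have "Im w = Im (z / \<tau>) - Im (- 1 / \<tau>)" unfolding w by simp
  then have 2: "Im w < 0" using RgD(2)[OF assms(1)] by simp
  have "of_real pi * \<i> * (- (z + 1)\<^sup>2 / \<tau> + (z + 1) - (z + 1) / \<tau>) =
      of_real pi * \<i> * (- z\<^sup>2 / \<tau> + z - z / \<tau>) + of_real pi * \<i> * (- 2 * w - 1) + 2 * of_real pi * \<i>"
    using tau_nz by (simp add: field_simps power2_eq_square w_def)
  then have g: "gs (z + 1) = gs z * (- ee (- w))"
    unfolding gs_def by (simp only: exp_add exp_pi_ii_odd) simp
  have "Q (z + 1) = gs z * ((- ee (- w)) * (1 - ee w) * theta0 (- 1 / \<tau>) w)
      / ((1 - ee z) * theta0 \<tau> z)"
    unfolding Q_def g e theta0_periodic w_def[symmetric] using nz by simp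
  also have "\<dots> = Q z"
    unfolding theta0_shift[OF 1 2, symmetric] using nz by (simp add: Q_def w)
  finally show ?thesis .
qed

private lemma Q_constant: "Q constant_on Rg"
proof -
  \<comment> \<open>Shifts by \<tau> and by 1 carry every point of \<open>Rg\<close> into this
    compact parallelogram without changing \<open>Q\<close>, so a maximum over \<open>K\<close> is
    one over \<open>Rg\<close>.\<close>
  define K where "K = (\<lambda>(s, t). complex_of_real s + of_real t * \<tau>) ` ({-1/2..1/2} \<times> {-1/2..1/2})"
  have K: "compact K"
    unfolding K_def by (intro compact_continuous_image compact_Times compact_Icc)
      (auto intro!: continuous_intros simp: case_prod_unfold)
  have KR: "K \<subseteq> Rg" by (auto simp: K_def Rg_def coords_eq)
  have K0: "0 \<in> K" by (auto simp: K_def intro!: image_eqI[of _ _ "(0,0)"])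
  have inK: "z \<in> K" if "\<bar>sc z\<bar> \<le> 1/2" "\<bar>tc z\<bar> \<le> 1/2" for z
    unfolding K_def by (rule image_eqI[of _ _ "(sc z, tc z)"]) (use that in \<open>auto simp flip: coords\<close>)
  have "continuous_on K (\<lambda>z. norm (Q z))"
    using Q_holomorphic KR
    by (auto intro!: continuous_on_norm holomorphic_on_imp_continuous_on intro: holomorphic_on_subset)
  then obtain z0 where z0: "z0 \<in> K" "\<And>z. z \<in> K \<Longrightarrow> norm (Q z) \<le> norm (Q z0)"
    using continuous_attains_sup[OF K, of "\<lambda>z. norm (Q z)"] K0 by auto
  \<comment> \<open>A shift by \<tau> leaves \<open>sc\<close> fixed and a shift by 1 leaves
    \<open>tc\<close> fixed, so the coordinates can be reduced one after the other.\<close>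
  have t_red: "\<exists>w. w \<in> Rg \<and> sc w = sc z \<and> \<bar>tc w\<bar> \<le> 1/2 \<and> Q w = Q z" if z: "z \<in> Rg" for z
  proof -
    have st: "tc (z + \<tau>) = tc z + 1" "sc (z + \<tau>) = sc z" "tc (z - \<tau>) = tc z - 1" "sc (z - \<tau>) = sc z"
      using tau by (simp_all add: tc_def sc_def field_simps)
    consider "\<bar>tc z\<bar> \<le> 1/2" | "tc z < -1/2" | "tc z > 1/2" by linarith
    then show ?thesis
    proof cases
      case 2
      then have R: "z + \<tau> \<in> Rg" using z st by (simp add: Rg_def)
      moreover have "Q (z + \<tau>) = Q z" using Q_shift_tau[OF z R] z by simp
      moreover have "\<bar>tc (z + \<tau>)\<bar> \<le> 1/2" using 2 z st by (auto simp: Rg_def abs_le_iff abs_less_iff)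
      ultimately show ?thesis using st by blast
    next
      case 3
      then have R: "z - \<tau> \<in> Rg" using z st by (simp add: Rg_def)
      moreover have "Q (z - \<tau>) = Q z" using Q_shift_tau[OF R] z by simp
      moreover have "\<bar>tc (z - \<tau>)\<bar> \<le> 1/2" using 3 z st by (auto simp: Rg_def abs_le_iff abs_less_iff)
      ultimately show ?thesis using st by blast
    qed (use z in blast)
  qed
  have s_red: "\<exists>w. w \<in> Rg \<and> tc w = tc z \<and> \<bar>sc w\<bar> \<le> 1/2 \<and> Q w = Q z" if z: "z \<in> Rg" for z
  proof -
    have st: "tc (z + 1) = tc z" "sc (z + 1) = sc z + 1" "tc (z - 1) = tc z" "sc (z - 1) = sc z - 1"
      by (simp_all add: tc_def sc_def)
    consider "\<bar>sc z\<bar> \<le> 1/2" | "sc z < -1/2" | "sc z > 1/2" by linarith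
    then show ?thesis
    proof cases
      case 2
      then have R: "z + 1 \<in> Rg" using z st by (simp add: Rg_def)
      moreover have "Q (z + 1) = Q z" using Q_shift_1[OF z R] z by simp
      moreover have "\<bar>sc (z + 1)\<bar> \<le> 1/2" using 2 z st by (auto simp: Rg_def abs_le_iff abs_less_iff)
      ultimately show ?thesis using st by blast
    next
      case 3
      then have R: "z - 1 \<in> Rg" using z st by (simp add: Rg_def)
      moreover have "Q (z - 1) = Q z" using Q_shift_1[OF R] z by simp
      moreover have "\<bar>sc (z - 1)\<bar> \<le> 1/2" using 3 z st by (auto simp: Rg_def abs_le_iff abs_less_iff)
      ultimately show ?thesis using st by blast
    qed (use z in blast)
  qed
  have "norm (Q z) \<le> norm (Q z0)" if "z \<in> Rg" for z
    using t_red[OF that] s_red inK z0(2) by metis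
  then show ?thesis
    using z0(1) KR
    by (intro maximum_modulus_principle[OF Q_holomorphic open_Rg connected_Rg open_Rg order_refl]) auto
qed

lemma theta_fricke:
  defines "q \<equiv> ee \<tau>" and "p \<equiv> ee (- 1 / (2 * \<tau>))"
  shows "16 * p * (qpoch (p\<^sup>2) (p\<^sup>2) * qpoch (- q) q) ^ 8 = \<tau> ^ 4 * (qpoch q q * qpoch p (p\<^sup>2)) ^ 8"
proof -
  have "0 \<in> Rg" "1/2 \<in> Rg" by (simp_all add: Rg_def sc_def tc_def)
  then have Q: "Q 0 = Q (1/2)" using Q_constant by (auto simp: constant_on_def)
  have p2: "ee (- 1 / \<tau>) = p\<^sup>2"
    using ee_of_nat_mult[of 2 "- 1 / (2 * \<tau>)"] by (simp add: p_def)
  have np: "norm p < 1" unfolding p_def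
    by (intro norm_ee_less_1 Im_fricke_pos tau)
  have Q0: "Q 0 = qpoch (p\<^sup>2) (p\<^sup>2) ^ 2 / (\<tau> * qpoch q q ^ 2)"
    using p2 by (simp add: Q_def gs_def theta0_def q_def power2_eq_square)
  have w: "(1/2) / \<tau> = - (- 1 / (2 * \<tau>))" by simp
  have ew: "ee ((1/2) / \<tau>) = 1 / p" unfolding w ee_minus p_def by (simp add: field_simps)
  have e1: "ee (- 1 / \<tau> + (1/2) / \<tau>) = p" unfolding ee_add p2 ew by (simp add: power2_eq_square p_def)
  have e2: "ee (- 1 / \<tau> - (1/2) / \<tau>) = p * p\<^sup>2" unfolding ee_diff p2 ew by (simp add: power2_eq_square p_def)
  have pn: "p \<noteq> 0" by (simp add: p_def)
  have th1: "theta0 \<tau> (1/2) = qpoch (- q) q ^ 2"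
    unfolding theta0_def ee_add ee_diff q_def by (simp add: power2_eq_square)
  have "qpoch p (p\<^sup>2) = (1 - p) * qpoch (p * p\<^sup>2) (p\<^sup>2)"
    using np by (intro qpoch_rec) (auto simp: norm_power power_less_one_iff)
  moreover have "(1 - 1/p) * (c * d) = - (1/p) * (c * ((1 - p) * d))" for c d
    using pn by (simp add: field_simps)
  ultimately have th2: "(1 - 1/p) * theta0 (- 1 / \<tau>) ((1/2) / \<tau>) = - (1/p) * qpoch p (p\<^sup>2) ^ 2"
    unfolding theta0_def e1 e2 p2 power2_eq_square[of "qpoch p (p\<^sup>2)"] by simp
  \<comment> \<open>Only the fourth power of the Gaussian factor is an integral power of
    \<open>p\<close>. Since the products enter \<open>Q\<close> as squares, this is the source of
    the eighth powers in the statement.\<close>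
  have g4: "gs (1/2) ^ 4 = p ^ 3"
  proof -
    have "gs (1/2) ^ 4 = exp (of_nat 4 * (of_real pi * \<i> * (- (1/2)\<^sup>2 / \<tau> + (1/2) - (1/2) / \<tau>)))"
      unfolding gs_def exp_of_nat_mult by simp
    also have "of_nat 4 * (of_real pi * \<i> * (- (1/2)\<^sup>2 / \<tau> + (1/2) - (1/2) / \<tau>)) =
      of_nat 3 * (2 * of_real pi * \<i> * (- 1 / (2 * \<tau>))) + 2 * of_real pi * \<i>"
      using tau_nz by (simp add: field_simps power2_eq_square)
    also have "exp \<dots> = p ^ 3"
      unfolding exp_add exp_of_nat_mult p_def ee_def by simp
    finally show ?thesis .
  qed
  have "Q (1/2) = gs (1/2) * ((1 - 1/p) * theta0 (- 1 / \<tau>) ((1/2) / \<tau>)) / (2 * theta0 \<tau> (1/2))"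
    using tau_nz by (simp add: Q_def ew[simplified])
  then have "Q (1/2) = gs (1/2) * (- (1/p) * qpoch p (p\<^sup>2) ^ 2) / (2 * qpoch (- q) q ^ 2)"
    by (simp only: th1 th2)
  then have "Q (1/2) ^ 4 = p ^ 3 * ((1/p) ^ 4 * qpoch p (p\<^sup>2) ^ 8) / (16 * qpoch (- q) q ^ 8)"
    by (simp add: power_divide power_mult_distrib g4 flip: power_mult)
  moreover have "Q 0 ^ 4 = qpoch (p\<^sup>2) (p\<^sup>2) ^ 8 / (\<tau> ^ 4 * qpoch q q ^ 8)"
    unfolding Q0 by (simp add: power_divide power_mult_distrib flip: power_mult)
  moreover have "p ^ 3 * ((1/p) ^ 4 * qpoch p (p\<^sup>2) ^ 8) = qpoch p (p\<^sup>2) ^ 8 / p"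
    using pn by (simp add: power_divide eval_nat_numeral)
  ultimately have "qpoch (p\<^sup>2) (p\<^sup>2) ^ 8 / (\<tau> ^ 4 * qpoch q q ^ 8) =
      qpoch p (p\<^sup>2) ^ 8 / (p * (16 * qpoch (- q) q ^ 8))"
    using Q by simp
  then have "qpoch (p\<^sup>2) (p\<^sup>2) ^ 8 * (p * (16 * qpoch (- q) q ^ 8)) =
      qpoch p (p\<^sup>2) ^ 8 * (\<tau> ^ 4 * qpoch q q ^ 8)"
    using pn tau_nz by (subst (asm) frac_eq_eq) auto
  then show ?thesis
    by (simp only: power_mult_distrib mult_ac)
qed

end

section \<open>Transformation of the eta quotients of level 2\<close>

text \<open>In the variable \<open>q = ee \<tau>\<close>: \<open>fS\<close> and \<open>fT\<close> are the forms of weight 4 for \<open>\<Gamma>\<^sub>0(2)\<close> whose zeros lie at the cusps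
  \<open>\<infinity>\<close> and \<open>0\<close> respectively, and \<open>1 / fv\<close> is a Hauptmodul with its pole at \<open>\<infinity>\<close>.\<close>
definition eP :: "complex \<Rightarrow> complex" where "eP q = qpoch q q"
definition eA :: "complex \<Rightarrow> complex" where "eA q = qpoch (- q) q"
definition fG :: "complex \<Rightarrow> complex" where "fG q = eP q * eA q ^ 2"
definition fS :: "complex \<Rightarrow> complex" where "fS q = q * fG q ^ 8"
definition fT :: "complex \<Rightarrow> complex" where "fT q = (eP q / eA q) ^ 8"
definition fv :: "complex \<Rightarrow> complex" where "fv q = q * eA q ^ 24"

lemma e_nonzero [simp]: "eP q \<noteq> 0" "eA q \<noteq> 0" "fG q \<noteq> 0" "fT q \<noteq> 0"
  by (simp_all add: eP_def eA_def fG_def fT_def)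

lemma fS_eq_0_iff [simp]: "fS q = 0 \<longleftrightarrow> q = 0" and fv_eq_0_iff [simp]: "fv q = 0 \<longleftrightarrow> q = 0"
  by (simp_all add: fS_def fv_def)

lemma fS_eq: "fS q = fv q * fT q"
proof -
  have e: "eA q ^ 24 = eA q ^ 16 * eA q ^ 8" by (simp flip: power_add)
  have "fv q * fT q = q * (eA q ^ 16 * eP q ^ 8)"
    unfolding fv_def fT_def e power_divide by (simp del: power_add_numeral power_add_numeral2)
  also have "\<dots> = fS q"
    by (simp add: fS_def fG_def power_mult_distrib flip: power_mult)
  finally show ?thesis by simp
qed

lemma eP_square: "norm q < 1 \<Longrightarrow> eP (q\<^sup>2) = eP q * eA q"
  unfolding eP_def eA_def by (rule qpoch_square)

text \<open>Euler's identity between odd and distinct parts: split \<open>eP q\<close> by the parity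
  of the exponents and cancel \<open>eP (q\<^sup>2)\<close> against
  \<open>eP_square\<close>.\<close>

lemma euler_odd: "norm q < 1 \<Longrightarrow> qpoch q (q\<^sup>2) * eA q = 1"
proof -
  assume q: "norm q < 1"
  have "eP q = qpoch q (q\<^sup>2) * eP (q\<^sup>2)"
    unfolding eP_def using qpoch_even_odd[OF q q] by (simp add: power2_eq_square)
  then show ?thesis using eP_square[OF q] by (simp add: mult_ac)
qed

text \<open>The Fricke involution exchanges the cusps 0 and \<infinity>, hence the two forms of
  weight 4 with their zero at one cusp. By \<open>euler_odd\<close> and \<open>eP_square\<close> the
  products in \<open>p\<^sup>2\<close> occurring in \<open>theta_fricke\<close> reduce to
  \<open>eP p\<close> and \<open>eA p\<close>.\<close>

lemma fricke_fT:
  assumes "Im \<tau> > 0"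
  shows "\<tau> ^ 4 * fT (ee \<tau>) = 16 * fS (ee (- 1 / (2 * \<tau>)))"
proof -
  define q p where "q = ee \<tau>" and "p = ee (- 1 / (2 * \<tau>))"
  have np: "norm p < 1" unfolding p_def by (intro norm_ee_less_1 Im_fricke_pos assms)
  have C: "qpoch p (p\<^sup>2) = 1 / eA p" using euler_odd[OF np] by (simp add: field_simps)
  have "16 * p * (eP (p\<^sup>2) * eA q) ^ 8 = \<tau> ^ 4 * (eP q * (1 / eA p)) ^ 8"
    using theta_fricke[OF assms] unfolding C[symmetric] by (simp add: p_def q_def eP_def eA_def)
  then have "16 * p * (eP p * eA p * eA q) ^ 8 = \<tau> ^ 4 * (eP q / eA p) ^ 8"
    by (simp add: eP_square[OF np])
  then have "16 * p * (eP p * eA p * eA q) ^ 8 * (eA p / eA q) ^ 8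
      = \<tau> ^ 4 * (eP q / eA p) ^ 8 * (eA p / eA q) ^ 8" by simp
  then have "16 * p * (eP p * eA p * eA q * (eA p / eA q)) ^ 8
      = \<tau> ^ 4 * (eP q / eA p * (eA p / eA q)) ^ 8" by (simp only: power_mult_distrib mult.assoc)
  then have "16 * (p * (eP p * eA p ^ 2) ^ 8) = \<tau> ^ 4 * (eP q / eA q) ^ 8"
    by (simp add: power2_eq_square mult.assoc)
  then show ?thesis by (simp add: fS_def fT_def fG_def p_def q_def)
qed

text \<open>\<open>fricke_fT\<close> is used at \<tau> and at its image. In the product of the two
  equations the values of \<open>fT\<close> cancel, since \<open>fS = fv * fT\<close>.\<close>

lemma fricke_fv:
  assumes "Im \<tau> > 0"
  shows "4096 * fv (ee \<tau>) * fv (ee (- 1 / (2 * \<tau>))) = 1"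
proof -
  have nz: "\<tau> \<noteq> 0" using assms by auto
  define w where "w = - 1 / (2 * \<tau>)"
  have "Im w > 0" unfolding w_def by (rule Im_fricke_pos[OF assms])
  from fricke_fT[OF this] have 1: "w ^ 4 * fT (ee w) = 16 * fS (ee \<tau>)"
    using nz by (simp add: w_def)
  have 2: "\<tau> ^ 4 * fT (ee \<tau>) = 16 * fS (ee w)" using fricke_fT[OF assms] by (simp add: w_def)
  have "(\<tau> * w) ^ 4 * (fT (ee w) * fT (ee \<tau>)) = 256 * fS (ee w) * fS (ee \<tau>)"
  proof -
    have "(\<tau> * w) ^ 4 * (fT (ee w) * fT (ee \<tau>)) = (w ^ 4 * fT (ee w)) * (\<tau> ^ 4 * fT (ee \<tau>))"
      by (simp only: power_mult_distrib mult_ac)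
    then show ?thesis unfolding 1 2 by simp
  qed
  moreover have "(\<tau> * w) ^ 4 = 1 / 16" using nz by (simp add: w_def power_divide)
  ultimately have "fT (ee w) * fT (ee \<tau>) = 4096 * (fv (ee w) * fv (ee \<tau>)) * (fT (ee w) * fT (ee \<tau>))"
    by (simp add: fS_eq)
  then have "4096 * (fv (ee w) * fv (ee \<tau>)) = 1" by simp
  then show ?thesis by (simp add: w_def mult_ac)
qed

lemma e_holomorphic:
  shows eP_holomorphic: "eP holomorphic_on ball 0 1" and eA_holomorphic: "eA holomorphic_on ball 0 1"
  unfolding eP_def[abs_def] eA_def[abs_def]
  by (intro qpoch_holomorphic holomorphic_intros; simp)+

lemma f_holomorphic:
  shows fG_holomorphic: "fG holomorphic_on ball 0 1" and fS_holomorphic: "fS holomorphic_on ball 0 1"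
    and fT_holomorphic: "fT holomorphic_on ball 0 1" and fv_holomorphic: "fv holomorphic_on ball 0 1"
  unfolding fG_def[abs_def] fS_def[abs_def] fT_def[abs_def] fv_def[abs_def]
  by (intro holomorphic_intros e_holomorphic; simp)+

text \<open>The form of weight 2 that is the logarithmic derivative \<open>q fv'(q) / fv q\<close>.\<close>
definition fF :: "complex \<Rightarrow> complex" where
  "fF q = 1 + 24 * q * deriv eA q / eA q"

lemma fF_holomorphic: "fF holomorphic_on ball 0 1"
  unfolding fF_def[abs_def] by (intro holomorphic_intros e_holomorphic) auto

lemma fv_has_field_derivative:
  assumes "norm q < 1"
  shows "(fv has_field_derivative eA q ^ 24 * fF q) (at q)"
proof -
  have d: "(eA has_field_derivative deriv eA q) (at q)"
    using holomorphic_derivI[OF eA_holomorphic open_ball] assms by simp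
  have "((\<lambda>q. q * eA q ^ 24) has_field_derivative
      1 * eA q ^ 24 + of_nat 24 * (deriv eA q * eA q ^ (24 - Suc 0)) * q) (at q)"
    by (rule DERIV_mult[OF DERIV_ident DERIV_power[OF d]])
  moreover have "1 * eA q ^ 24 + of_nat 24 * (deriv eA q * eA q ^ (24 - Suc 0)) * q = eA q ^ 24 * fF q"
  proof -
    have "eA q ^ 24 = eA q * eA q ^ 23" by (simp flip: power_Suc)
    then show ?thesis by (simp add: fF_def algebra_simps)
  qed
  ultimately show ?thesis by (simp add: fv_def[abs_def])
qed

lemma fv_ee_has_field_derivative:
  assumes "Im \<tau> > 0"
  shows "((\<lambda>\<tau>. fv (ee \<tau>)) has_field_derivative 2 * of_real pi * \<i> * fv (ee \<tau>) * fF (ee \<tau>)) (at \<tau>)"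
proof -
  have "(ee has_field_derivative ee \<tau> * (2 * of_real pi * \<i>)) (at \<tau>)"
    unfolding ee_def[abs_def] by (rule derivative_eq_intros refl | simp)+
  from DERIV_chain2[OF fv_has_field_derivative[OF norm_ee_less_1[OF assms]] this]
  show ?thesis by (rule back_subst[where P = "\<lambda>D. (_ has_field_derivative D) _"]) (simp add: fv_def mult_ac)
qed

lemma fricke_fS:
  assumes "Im \<tau> > 0"
  shows "fS (ee (- 1 / (2 * \<tau>))) = \<tau> ^ 4 * fT (ee \<tau>) / 16"
  using fricke_fT[OF assms] by simp

lemma fricke_fv':
  assumes "Im \<tau> > 0"
  shows "fv (ee (- 1 / (2 * \<tau>))) = 1 / (4096 * fv (ee \<tau>))"
  using fricke_fv[OF assms] by (simp add: eq_divide_eq mult_ac)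

text \<open>Differentiate the constant product in \<open>fricke_fv\<close> and divide by that
  product; \<open>fF\<close> is the logarithmic derivative of \<open>fv\<close>.\<close>

lemma fricke_fF:
  assumes "Im \<tau> > 0"
  shows "fF (ee (- 1 / (2 * \<tau>))) = - 2 * \<tau>\<^sup>2 * fF (ee \<tau>)"
proof -
  define w where "w = - 1 / (2 * \<tau>)"
  have nz: "\<tau> \<noteq> 0" using assms by auto
  have w: "Im w > 0" unfolding w_def by (rule Im_fricke_pos[OF assms])
  have dw: "((\<lambda>\<tau>. - 1 / (2 * \<tau>)) has_field_derivative 1 / (2 * \<tau>\<^sup>2)) (at \<tau>)"
    using nz by (auto intro!: derivative_eq_intros simp: power2_eq_square field_simps)
  define u where "u = 2 * of_real pi * \<i>"
  have 1: "((\<lambda>\<tau>. fv (ee \<tau>)) has_field_derivative u * fv (ee \<tau>) * fF (ee \<tau>)) (at \<tau>)"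
    using fv_ee_has_field_derivative[OF assms] by (simp add: u_def)
  have 2: "((\<lambda>\<tau>. fv (ee (- 1 / (2 * \<tau>)))) has_field_derivative u * fv (ee w) * fF (ee w) * (1 / (2 * \<tau>\<^sup>2))) (at \<tau>)"
    using DERIV_chain2[OF fv_ee_has_field_derivative[of "- 1 / (2 * \<tau>)", OF w[unfolded w_def]] dw]
    by (simp add: u_def w_def)
  have "((\<lambda>\<tau>. 4096 * (fv (ee \<tau>) * fv (ee (- 1 / (2 * \<tau>))))) has_field_derivative
     4096 * (u * fv (ee \<tau>) * fF (ee \<tau>) * fv (ee w) + u * fv (ee w) * fF (ee w) * (1 / (2 * \<tau>\<^sup>2)) * fv (ee \<tau>))) (at \<tau>)"
    unfolding w_def[symmetric] using DERIV_cmult[OF DERIV_mult[OF 1 2], of 4096] by (simp add: w_def)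
  moreover have "((\<lambda>\<tau>. 4096 * (fv (ee \<tau>) * fv (ee (- 1 / (2 * \<tau>))))) has_field_derivative 0) (at \<tau>)"
    by (rule has_field_derivative_transform_within_open[OF DERIV_const[of 1] open_halfspace_Im_gt[of 0]])
      (use assms fricke_fv in \<open>auto simp: mult.assoc\<close>)
  ultimately have "4096 * (u * fv (ee \<tau>) * fF (ee \<tau>) * fv (ee w) + u * fv (ee w) * fF (ee w) * (1 / (2 * \<tau>\<^sup>2)) * fv (ee \<tau>)) = 0"
    by (rule DERIV_unique)
  moreover have "4096 * (u * a * b * c + u * c * d * e * a) = 4096 * (u * a * c * (b + d * e))" for a b c d e
    by (simp add: algebra_simps)
  ultimately have "4096 * (u * fv (ee \<tau>) * fv (ee w) * (fF (ee \<tau>) + fF (ee w) * (1 / (2 * \<tau>\<^sup>2)))) = 0"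
    by metis
  then have "fF (ee \<tau>) + fF (ee w) * (1 / (2 * \<tau>\<^sup>2)) = 0" by (simp add: u_def)
  then show ?thesis using nz unfolding w_def[symmetric] by (simp add: field_simps add_eq_0_iff)
qed

text \<open>The involution conjugates the map \<open>\<tau> / (2 * \<tau> + 1)\<close> to the
  translation \<open>w - 1\<close>, under which \<open>ee\<close> is invariant. All three laws
  follow by applying the Fricke formulas on both sides of this translation.\<close>

lemma gamma_transform:
  assumes "Im \<tau> > 0"
  shows gamma_fv: "fv (ee (\<tau> / (2 * \<tau> + 1))) = fv (ee \<tau>)"
    and gamma_fS: "fS (ee (\<tau> / (2 * \<tau> + 1))) = (2 * \<tau> + 1) ^ 4 * fS (ee \<tau>)"
    and gamma_fF: "fF (ee (\<tau> / (2 * \<tau> + 1))) = (2 * \<tau> + 1)\<^sup>2 * fF (ee \<tau>)"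
proof -
  define w where "w = - 1 / (2 * \<tau>)"
  have nz: "\<tau> \<noteq> 0" "2 * \<tau> + 1 \<noteq> 0" using assms by (auto simp: complex_eq_iff)
  have w: "Im w > 0" unfolding w_def by (rule Im_fricke_pos[OF assms])
  have w1: "Im (w - 1) > 0" using w by simp
  have wn: "w \<noteq> 0" "w - 1 \<noteq> 0" using w w1 by (auto simp del: minus_complex.sel)
  have e: "\<tau> = - 1 / (2 * w)" using nz by (simp add: w_def)
  have r: "w - 1 = (2 * \<tau> + 1) * w" using nz by (simp add: w_def field_simps)
  have g: "\<tau> / (2 * \<tau> + 1) = - 1 / (2 * (w - 1))"
  proof -
    have "2 * (w - 1) = - 1 / \<tau> - 2" by (simp add: w_def right_diff_distrib)
    also have "\<dots> = - ((2 * \<tau> + 1) / \<tau>)" using nz by (simp add: add_divide_distrib)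
    finally show ?thesis by simp
  qed
  have ew: "ee (w - 1) = ee w" by (simp add: ee_diff)
  show "fv (ee (\<tau> / (2 * \<tau> + 1))) = fv (ee \<tau>)"
    unfolding g fricke_fv'[OF w1] ew using fricke_fv'[OF w] by (simp add: e)
  have "fS (ee \<tau>) = w ^ 4 * fT (ee w) / 16" using fricke_fS[OF w] by (simp add: e)
  then show "fS (ee (\<tau> / (2 * \<tau> + 1))) = (2 * \<tau> + 1) ^ 4 * fS (ee \<tau>)"
    unfolding g fricke_fS[OF w1] ew unfolding r by (simp add: power_mult_distrib)
  have "fF (ee \<tau>) = - 2 * w\<^sup>2 * fF (ee w)" using fricke_fF[OF w] by (simp add: e)
  then show "fF (ee (\<tau> / (2 * \<tau> + 1))) = (2 * \<tau> + 1)\<^sup>2 * fF (ee \<tau>)"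
    unfolding g fricke_fF[OF w1] ew unfolding r by (simp add: power_mult_distrib)
qed

section \<open>Conjugation symmetry and size of the q-products\<close>

lemma f_0 [simp]: "eP 0 = 1" "eA 0 = 1" "fG 0 = 1" "fF 0 = 1"
proof -
  have "qlog 0 0 = 0" by (simp add: qlog_def)
  then show "eP 0 = 1" "eA 0 = 1" by (simp_all add: eP_def eA_def qpoch_def)
  then show "fG 0 = 1" "fF 0 = 1" by (simp_all add: fG_def fF_def)
qed

lemma f_cnj:
  assumes "norm q < 1"
  shows eA_cnj: "eA (cnj q) = cnj (eA q)" and fG_cnj: "fG (cnj q) = cnj (fG q)"
    and fv_cnj: "fv (cnj q) = cnj (fv q)" and fS_cnj: "fS (cnj q) = cnj (fS q)"
    and fF_cnj: "fF (cnj q) = cnj (fF q)"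
proof -
  have A: "eA (cnj q) = cnj (eA q)" if "norm q < 1" for q
    using qpoch_cnj[of "- q" q] that by (simp add: eA_def)
  have P: "eP (cnj q) = cnj (eP q)"
    using qpoch_cnj[of q q] assms by (simp add: eP_def)
  show "eA (cnj q) = cnj (eA q)" by (rule A[OF assms])
  show G: "fG (cnj q) = cnj (fG q)" using P A[OF assms] by (simp add: fG_def)
  show "fv (cnj q) = cnj (fv q)" "fS (cnj q) = cnj (fS q)" using G A[OF assms] by (simp_all add: fv_def fS_def)
  have "(eA has_field_derivative deriv eA (cnj q)) (at (cnj q))"
    using holomorphic_derivI[OF eA_holomorphic open_ball] assms by simp
  then have "((cnj \<circ> eA \<circ> cnj) has_field_derivative cnj (deriv eA (cnj q))) (at q)"
    using has_field_derivative_cnj_cnj[of eA "deriv eA (cnj q)" q] by simp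
  then have "(eA has_field_derivative cnj (deriv eA (cnj q))) (at q)"
    by (rule has_field_derivative_transform_within_open[where S = "ball 0 1"]) (use A assms in auto)
  moreover have "(eA has_field_derivative deriv eA q) (at q)"
    using holomorphic_derivI[OF eA_holomorphic open_ball] assms by simp
  ultimately have "cnj (deriv eA (cnj q)) = deriv eA q" by (rule DERIV_unique)
  then have "deriv eA (cnj q) = cnj (deriv eA q)" by (metis complex_cnj_cnj)
  then show "fF (cnj q) = cnj (fF q)" using A[OF assms] by (simp add: fF_def)
qed

text \<open>Differentiating the product gives \<open>fF q\<close> as 1 plus 24 times the sum of
  \<open>m q^m / (1 + q^m)\<close>. The denominator is bounded below by \<open>1 - r\<close> for
  \<open>m = 1\<close> and by \<open>1 - r\<^sup>2\<close> for all later terms; separating the first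
  term keeps the constants sharp.\<close>

lemma norm_fF_le:
  assumes "norm q < 1"
  defines "r \<equiv> norm q"
  shows "norm (fF q) \<le> 1 + 24 * (r / (1 - r) + (r / (1 - r)\<^sup>2 - r) / (1 - r\<^sup>2))"
proof -
  have r: "0 \<le> r" "r < 1" using assms by auto
  have "open (ball (0::complex) 1)" "q \<in> ball 0 1" using assms by auto
  then have "\<exists>D. (\<lambda>n. deriv (\<lambda>q. Ln (1 - (- q) * q ^ n)) q) sums D \<and>
             ((\<lambda>q. qlog (- q) q) has_field_derivative D) (at q)"
    by (intro qlog_has_field_derivative[where S = "ball 0 1"] holomorphic_intros) auto
  then obtain D where D: "(\<lambda>n. deriv (\<lambda>q. Ln (1 - (- q) * q ^ n)) q) sums D"
    "((\<lambda>q. qlog (- q) q) has_field_derivative D) (at q)" by blast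
  have "(eA has_field_derivative eA q * D) (at q)"
    unfolding eA_def[abs_def] qpoch_def using D(2) by (auto intro!: derivative_eq_intros)
  then have F: "fF q = 1 + 24 * (q * D)" by (simp add: fF_def DERIV_imp_deriv)
  have small: "norm (q ^ Suc n) < 1" for n
    unfolding norm_power r_def[symmetric] using r by (subst power_less_one_iff) auto
  have der: "deriv (\<lambda>q. Ln (1 - (- q) * q ^ n)) q = of_nat (Suc n) * q ^ n / (1 + q ^ Suc n)" for n
  proof (rule DERIV_imp_deriv)
    have "Re (1 + q ^ Suc n) > 0"
      using small[of n] abs_Re_le_cmod[of "q ^ Suc n"] by simp
    then have "1 + q ^ Suc n \<notin> \<real>\<^sub>\<le>\<^sub>0" by (auto simp: complex_nonpos_Reals_iff)
    then have "((\<lambda>q. Ln (1 + q ^ Suc n)) has_field_derivative of_nat (Suc n) * q ^ n / (1 + q ^ Suc n)) (at q)"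
      by (intro derivative_eq_intros) (auto simp: field_simps)
    then show "((\<lambda>q. Ln (1 - (- q) * q ^ n)) has_field_derivative of_nat (Suc n) * q ^ n / (1 + q ^ Suc n)) (at q)"
      by simp
  qed
  define g where "g n = (if n = 0 then r / (1 - r) else real (Suc n) * r ^ Suc n / (1 - r\<^sup>2))" for n
  have q: "(\<lambda>n. q * (of_nat (Suc n) * q ^ n / (1 + q ^ Suc n))) sums (q * D)"
    using D(1) unfolding der by (rule sums_mult)
  have le: "norm (q * (of_nat (Suc n) * q ^ n / (1 + q ^ Suc n))) \<le> g n" for n
  proof -
    have "norm (1 + q ^ Suc n) \<ge> 1 - r ^ Suc n"
      using norm_diff_ineq[of 1 "q ^ Suc n"] by (simp add: norm_power norm_mult r_def)
    moreover have "r ^ Suc n \<le> r ^ 2" if "n \<noteq> 0" using that r by (intro power_decreasing) auto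
    ultimately have lb: "norm (1 + q ^ Suc n) \<ge> (if n = 0 then 1 - r else 1 - r\<^sup>2)" by auto
    have "norm (q * (of_nat (Suc n) * q ^ n / (1 + q ^ Suc n))) = real (Suc n) * r ^ Suc n / norm (1 + q ^ Suc n)"
      by (simp add: norm_divide norm_mult norm_power r_def del: of_nat_Suc)
    also have "\<dots> \<le> real (Suc n) * r ^ Suc n / (if n = 0 then 1 - r else 1 - r\<^sup>2)"
    proof -
      have pos: "0 < (if n = 0 then 1 - r else 1 - r\<^sup>2)" using r by (auto simp: power_less_one_iff)
      show ?thesis
        by (rule divide_left_mono[OF lb _ mult_pos_pos[OF less_le_trans[OF pos lb] pos]]) (use r in auto)
    qed
    also have "\<dots> = g n" by (simp add: g_def)
    finally show ?thesis .
  qed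
  have "(\<lambda>n. of_nat (Suc n) * r ^ n) sums (1 / (1 - r)\<^sup>2)"
    using geometric_deriv_sums[of r] r by simp
  then have "(\<lambda>n. of_nat (Suc (Suc n)) * r ^ Suc n) sums (1 / (1 - r)\<^sup>2 - 1)"
    by (subst sums_Suc_iff) simp
  then have "(\<lambda>n. r / (1 - r\<^sup>2) * (of_nat (Suc (Suc n)) * r ^ Suc n)) sums (r / (1 - r\<^sup>2) * (1 / (1 - r)\<^sup>2 - 1))"
    by (rule sums_mult)
  then have "(\<lambda>n. g (Suc n)) sums (r / (1 - r\<^sup>2) * (1 / (1 - r)\<^sup>2 - 1))"
    by (rule back_subst[where P = "\<lambda>f. f sums _"]) (simp add: g_def fun_eq_iff)
  then have "g sums (r / (1 - r\<^sup>2) * (1 / (1 - r)\<^sup>2 - 1) + g 0)"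
    by (subst (asm) sums_Suc_iff) simp
  then have gs: "summable g" "suminf g = r / (1 - r) + (r / (1 - r)\<^sup>2 - r) / (1 - r\<^sup>2)"
  proof -
    have e: "(a * b - a) / c = a / c * (b - 1)" for a b c :: real
      by (simp add: right_diff_distrib diff_divide_distrib)
    assume "g sums (r / (1 - r\<^sup>2) * (1 / (1 - r)\<^sup>2 - 1) + g 0)"
    then show "summable g" "suminf g = r / (1 - r) + (r / (1 - r)\<^sup>2 - r) / (1 - r\<^sup>2)"
      using e[of r "1 / (1 - r)\<^sup>2" "1 - r\<^sup>2"] by (auto simp: sums_iff g_def)
  qed
  have "norm (q * D) \<le> suminf g"
    using norm_suminf_le[OF le gs(1)] q by (simp add: sums_iff)
  then have "norm (fF q) \<le> 1 + 24 * suminf g"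
    unfolding F by (intro norm_triangle_le) (simp add: norm_mult)
  then show ?thesis unfolding gs(2) .
qed

text \<open>In this form only the factors \<open>1 + q^m\<close> with odd \<open>m\<close> and
  \<open>1 - q^m\<close> with \<open>m\<close> divisible by 4 remain, so that few factors have to be
  estimated individually.\<close>

lemma fG_eq: "norm q < 1 \<Longrightarrow> fG q = qpoch (- q) (q\<^sup>2) * qpoch (q ^ 4) (q ^ 4)"
proof -
  assume q: "norm q < 1"
  have q2: "norm (q\<^sup>2) < 1" using q by (simp add: norm_power power_less_one_iff)
  have A: "eA q = qpoch (- q) (q\<^sup>2) * qpoch (- (q\<^sup>2)) (q\<^sup>2)"
    unfolding eA_def using qpoch_even_odd[of "- q" q] q by (simp add: power2_eq_square)
  have Z: "eP (q\<^sup>2) * qpoch (- (q\<^sup>2)) (q\<^sup>2) = qpoch (q ^ 4) (q ^ 4)"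
    using eP_square[OF q2] by (simp add: eP_def eA_def flip: power_mult)
  have G: "fG q = eP (q\<^sup>2) * eA q"
    using eP_square[OF q] by (simp add: fG_def power2_eq_square)
  show ?thesis unfolding G A Z[symmetric] by (simp only: mult_ac)
qed

lemma norm_one_plus_bounds:
  fixes a :: complex
  shows "1 - norm a \<le> norm (1 - a)" "norm (1 - a) \<le> 1 + norm a"
  using norm_triangle_ineq2[of 1 a] norm_triangle_ineq4[of 1 a] by simp_all

text \<open>The factors with exponents 1, 3 and 4 are bounded exactly; the tails, which start at
  exponents 5 and 8, go into the exponential of \<open>e\<close>.\<close>

lemma norm_fG_bounds:
  assumes "norm q < 1"
  defines "r \<equiv> norm q"
  defines "e \<equiv> r ^ 5 / ((1 - r ^ 5) * (1 - r\<^sup>2)) + r ^ 8 / ((1 - r ^ 8) * (1 - r ^ 4))"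
  shows "(1 - r) * (1 - r ^ 3) * (1 - r ^ 4) * exp (- e) \<le> norm (fG q)"
    and "norm (fG q) \<le> (1 + r) * (1 + r ^ 3) * (1 + r ^ 4) * exp e"
proof -
  have r: "0 \<le> r" "r < 1" using assms by auto
  have lt: "norm (q ^ k) < 1" if "k > 0" for k
    using r that by (simp add: norm_power r_def[symmetric] power_less_one_iff)
  have 1: "qpoch (- q) (q\<^sup>2) = (1 - - q) * ((1 - - (q ^ 3)) * qpoch (- (q ^ 5)) (q\<^sup>2))"
  proof -
    have "- q * q\<^sup>2 = - (q ^ 3)" "- (q ^ 3) * q\<^sup>2 = - (q ^ 5)" by (simp_all add: eval_nat_numeral)
    then show ?thesis
      using qpoch_rec[of "- q" "q\<^sup>2"] qpoch_rec[of "- (q ^ 3)" "q\<^sup>2"] lt[of 1] lt[of 2] lt[of 3] by simp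
  qed
  have 2: "qpoch (q ^ 4) (q ^ 4) = (1 - q ^ 4) * qpoch (q ^ 8) (q ^ 4)"
    using qpoch_rec[of "q ^ 4" "q ^ 4"] lt[of 4] by (simp flip: power_add)
  have G: "fG q = (1 - - q) * (1 - - (q ^ 3)) * (1 - q ^ 4) * (qpoch (- (q ^ 5)) (q\<^sup>2) * qpoch (q ^ 8) (q ^ 4))"
    unfolding fG_eq[OF assms(1)] 1 2 by (simp only: mult_ac)
  have n: "norm (- q) = r" "norm (- (q ^ 3)) = r ^ 3" "norm (q ^ 4) = r ^ 4" "norm (q ^ 5) = r ^ 5"
    "norm (q\<^sup>2) = r\<^sup>2" "norm (q ^ 8) = r ^ 8"
    by (simp_all add: norm_power r_def)
  have b5: "exp (- (r ^ 5 / ((1 - r ^ 5) * (1 - r\<^sup>2)))) \<le> norm (qpoch (- (q ^ 5)) (q\<^sup>2))"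
    "norm (qpoch (- (q ^ 5)) (q\<^sup>2)) \<le> exp (r ^ 5 / ((1 - r ^ 5) * (1 - r\<^sup>2)))"
    using qpoch_bounds[of "- (q ^ 5)" "q\<^sup>2"] lt[of 5] lt[of 2] unfolding norm_minus_cancel n by auto
  have b8: "exp (- (r ^ 8 / ((1 - r ^ 8) * (1 - r ^ 4)))) \<le> norm (qpoch (q ^ 8) (q ^ 4))"
    "norm (qpoch (q ^ 8) (q ^ 4)) \<le> exp (r ^ 8 / ((1 - r ^ 8) * (1 - r ^ 4)))"
    using qpoch_bounds[of "q ^ 8" "q ^ 4"] lt[of 8] lt[of 4] unfolding n by auto
  have r1: "r ^ 3 \<le> 1" "r ^ 4 \<le> 1" using r by (auto intro: power_le_one)
  show "(1 - r) * (1 - r ^ 3) * (1 - r ^ 4) * exp (- e) \<le> norm (fG q)"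
    unfolding G norm_mult e_def minus_add_distrib exp_add
    using norm_one_plus_bounds[of "- q"] norm_one_plus_bounds[of "- (q ^ 3)"] norm_one_plus_bounds[of "q ^ 4"]
    unfolding n by (intro mult_mono b5 b8 mult_nonneg_nonneg) (use r r1 in auto)
  show "norm (fG q) \<le> (1 + r) * (1 + r ^ 3) * (1 + r ^ 4) * exp e"
    unfolding G norm_mult e_def exp_add
    using norm_one_plus_bounds[of "- q"] norm_one_plus_bounds[of "- (q ^ 3)"] norm_one_plus_bounds[of "q ^ 4"]
    unfolding n by (intro mult_mono b5 b8 mult_nonneg_nonneg) (use r in auto)
qed

section \<open>Uniqueness and structure of the basis forms\<close>

lemma uhp_iff: "z \<in> upper_half_plane \<longleftrightarrow> Im z > 0"
  by (simp add: upper_half_plane_def)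

lemma open_uhp: "open upper_half_plane"
  unfolding upper_half_plane_def by (rule open_halfspace_Im_gt)

lemma connected_halfspace_Im_gt: "connected {z. Im z > c}"
  using convex_halfspace_Im_gt[of c] by (rule convex_connected)

lemma connected_uhp: "connected upper_half_plane"
  unfolding upper_half_plane_def by (rule connected_halfspace_Im_gt)

lemma Im_neg_inverse: "Im (- 1 / z) = Im z / (norm z)\<^sup>2"
  by (simp add: Im_divide cmod_power2)

lemma Im_neg_inverse_pos: "Im z > 0 \<Longrightarrow> Im (- 1 / z) > 0"
  unfolding Im_neg_inverse by (intro divide_pos_pos) auto

lemma holomorphic_mult_eq_0:
  assumes "f holomorphic_on U" "g holomorphic_on U" "open U" "connected U"
    and "\<And>z. z \<in> U \<Longrightarrow> f z * g z = 0"
  shows "(\<forall>z\<in>U. f z = 0) \<or> (\<forall>z\<in>U. g z = 0)"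
proof (rule disjCI, rule ballI, rule ccontr)
  fix z0 assume ng: "\<not> (\<forall>z\<in>U. g z = 0)" and z0: "z0 \<in> U" "f z0 \<noteq> 0"
  define W where "W = {z \<in> U. f z \<in> - {0}}"
  have "open (- {0::complex})" by (simp add: open_Compl)
  from continuous_open_preimage[OF holomorphic_on_imp_continuous_on[OF assms(1)] assms(3) this]
  have "open W" unfolding W_def by (simp add: vimage_def Int_def)
  moreover have "g z = 0" if "z \<in> W" for z using assms(5)[of z] that by (auto simp: W_def)
  moreover have "z0 \<in> W" "W \<subseteq> U" using z0 by (auto simp: W_def)
  ultimately have "g z = 0" if "z \<in> U" for z
    using analytic_continuation_open[of W U g "\<lambda>_. 0" z] assms that by auto
  with ng show False by blast
qed

text \<open>The product over the three cosets of \<open>\<Gamma>\<^sub>0(2)\<close> in \<open>SL\<^sub>2(\<int>)\<close> is invariant under \<open>\<tau> \<mapsto> \<tau> + 1\<close> and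
  \<open>\<tau> \<mapsto> -1/\<tau>\<close> and tends to 0 at \<open>\<infinity>\<close>, so its modulus has an interior maximum on \<open>Im \<tau> \<ge> 4/5\<close>.\<close>
lemma invariant_function_eq_0:
  assumes hol: "h holomorphic_on upper_half_plane"
    and T: "\<And>z. Im z > 0 \<Longrightarrow> h (z + 1) = h z"
    and G: "\<And>z. Im z > 0 \<Longrightarrow> h (z / (2 * z + 1)) = h z"
    and inf: "\<And>z. Im z \<ge> 4/5 \<Longrightarrow> norm (h z) \<le> C * norm (ee z)"
    and zero: "\<And>z. Im z \<ge> 4/5 \<Longrightarrow> norm (h (- 1 / z)) \<le> C'"
    and "Im z > 0"
  shows "h z = 0"
proof -
  define N where "N t = h t * (h (- 1 / t) * h (- 1 / (t + 1)))" for t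
  have C: "C \<ge> 0"
  proof -
    have "0 \<le> C * norm (ee \<i>)" by (rule order_trans[OF norm_ge_zero inf]) simp
    then show ?thesis by (simp add: zero_le_mult_iff)
  qed
  have C': "C' \<ge> 0" by (rule order_trans[OF norm_ge_zero zero[of \<i>]]) simp
  have hi: "(\<lambda>t. h (- 1 / t)) holomorphic_on upper_half_plane"
  proof -
    have "(h \<circ> (\<lambda>t. - 1 / t)) holomorphic_on upper_half_plane"
      using Im_neg_inverse_pos
      by (intro holomorphic_on_compose_gen[OF _ hol] holomorphic_intros) (auto simp: uhp_iff)
    then show ?thesis by (simp add: o_def)
  qed
  have hi1: "(\<lambda>t. h (- 1 / (t + 1))) holomorphic_on upper_half_plane"
  proof -
    have "((\<lambda>t. h (- 1 / t)) \<circ> (\<lambda>t. t + 1)) holomorphic_on upper_half_plane"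
      by (intro holomorphic_on_compose_gen[OF _ hi] holomorphic_intros) (auto simp: uhp_iff)
    then show ?thesis by (simp add: o_def)
  qed
  have Nhol: "N holomorphic_on upper_half_plane"
    unfolding N_def[abs_def] by (intro holomorphic_intros hol hi hi1)
  have T2: "h (- 1 / (t + 2)) = h (- 1 / t)" if "Im t > 0" for t
  proof -
    have nz: "t \<noteq> 0" "t + 2 \<noteq> 0" using that by (auto simp: complex_eq_iff)
    define s where "s = - 1 / (t + 2)"
    have "2 * s + 1 = t / (t + 2)" using nz by (simp add: s_def field_simps)
    then have "s / (2 * s + 1) = - 1 / t" using nz by (simp add: s_def)
    moreover have "Im s > 0" unfolding s_def by (rule Im_neg_inverse_pos) (use that in simp)
    ultimately show ?thesis using G[of s] by (simp add: s_def)
  qed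
  have NT: "N (t + 1) = N t" if "Im t > 0" for t
    using T[OF that] T2[OF that] by (simp add: N_def add.commute add.left_commute)
  have NS: "N (- 1 / t) = N t" if t: "Im t > 0" for t
  proof -
    have t1: "Im (t - 1) > 0" using t by simp
    have nz: "t \<noteq> 0" "t - 1 \<noteq> 0" using t t1 by (auto simp del: minus_complex.sel)
    have "- 1 / (- 1 / t + 1) = - 1 / (t - 1) - 1"
      using nz by (simp add: field_simps)
    moreover have "h (- 1 / (t - 1) - 1) = h (- 1 / (t - 1))"
      using T[of "- 1 / (t - 1) - 1"] Im_neg_inverse_pos[OF t1] by simp
    moreover have "h (- 1 / (t - 1)) = h (- 1 / (t + 1))"
      using T2[OF t1] by (simp add: add.commute)
    ultimately show ?thesis using nz by (simp add: N_def)
  qed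
  have Nb: "norm (N t) \<le> C * C' * C' * norm (ee t)" if "Im t \<ge> 4/5" for t
  proof -
    have "norm (N t) \<le> (C * norm (ee t)) * (C' * C')"
      unfolding N_def norm_mult using that C C'
      by (intro mult_mono inf zero mult_nonneg_nonneg) auto
    then show ?thesis by (simp add: mult_ac)
  qed
  have N0: "N t1 = 0" if t1: "Im t1 \<ge> 4/5" for t1
  proof (rule ccontr)
    assume nz: "N t1 \<noteq> 0"
    have lim: "\<exists>Y>0. \<forall>t. Im t \<ge> Y \<longrightarrow> C * C' * C' * norm (ee t) < e" if "e > 0" for e
    proof -
      define D where "D = C * C' * C'"
      have D: "D \<ge> 0" using C C' by (simp add: D_def)
      define Y where "Y = max 1 (D / e)"
      have "D * norm (ee t) < e" if "Im t \<ge> Y" for t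
      proof -
        have "D / e \<le> Im t" "1 \<le> Im t" using that by (auto simp: Y_def)
        moreover have "Im t < exp (2 * pi * Im t)"
        proof -
          have "1 * Im t \<le> (2 * pi) * Im t" using calculation pi_gt3 by (intro mult_right_mono) auto
          moreover have "1 + 2 * pi * Im t \<le> exp (2 * pi * Im t)" by (rule exp_ge_add_one_self)
          ultimately show ?thesis by linarith
        qed
        ultimately have "D / e < exp (2 * pi * Im t)" by linarith
        then have "D < e * exp (2 * pi * Im t)"
          using \<open>e > 0\<close> by (simp add: divide_less_eq mult.commute)
        then show ?thesis by (simp add: norm_ee exp_minus divide_inverse[symmetric] divide_less_eq)
      qed
      then show ?thesis unfolding D_def by (intro exI[of _ Y]) (auto simp: Y_def)
    qed
    obtain Y where Y: "Y > 0" "\<And>t. Im t \<ge> Y \<Longrightarrow> C * C' * C' * norm (ee t) < norm (N t1)"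
      using lim[of "norm (N t1)"] nz by auto
    have NTi: "N (t + of_int m) = N t" if "Im t > 0" for t m
    proof -
      have up: "N (t + of_nat m) = N t" if "Im t > 0" for t m
        using that by (induction m) (use NT in \<open>auto simp: add.assoc[symmetric] add.commute[of 1]\<close>)
      show ?thesis
      proof (cases "m \<ge> 0")
        case True
        then show ?thesis using up[of t "nat m"] that by simp
      next
        case False
        then show ?thesis using up[of "t + of_int m" "nat (- m)"] that by simp
      qed
    qed
    \<comment> \<open>Above height \<open>Y\<close> the decay keeps \<open>N\<close> below its value
      at \<open>t1\<close>, and translations bring every remaining point into this rectangle. A
      maximum over \<open>K\<close> is therefore one over the half plane
      \<open>Im t \<ge> 4/5\<close>.\<close>
    define K where "K = cbox (Complex (-1/2) (4/5)) (Complex (1/2) Y)"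
    have Kiff: "t \<in> K \<longleftrightarrow> -1/2 \<le> Re t \<and> Re t \<le> 1/2 \<and> 4/5 \<le> Im t \<and> Im t \<le> Y" for t
      by (auto simp: K_def in_cbox_complex_iff)
    have "\<exists>s. - 1/2 \<le> Re s \<and> Re s \<le> 1/2 \<and> Im s = Im t \<and> N s = N t" if "Im t > 0" for t
    proof (intro exI[of _ "t + of_int (- round (Re t))"] conjI)
      show "N (t + of_int (- round (Re t))) = N t" using NTi[OF that] by blast
      have "\<bar>real_of_int (round (Re t)) - Re t\<bar> \<le> 1 / 2" by (rule of_int_round_abs_le)
      then show "- 1 / 2 \<le> Re (t + of_int (- round (Re t)))" "Re (t + of_int (- round (Re t))) \<le> 1 / 2"
        unfolding abs_le_iff by auto
    qed simp
    then obtain red where red: "\<And>t. Im t > 0 \<Longrightarrow> - 1/2 \<le> Re (red t) \<and> Re (red t) \<le> 1/2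
        \<and> Im (red t) = Im t \<and> N (red t) = N t" by metis
    have t1Y: "Im t1 \<le> Y" using Y(2)[of t1] Nb[OF t1] by force
    then have "red t1 \<in> K" using red[of t1] t1 by (auto simp: Kiff)
    moreover have "continuous_on K (\<lambda>t. norm (N t))"
      by (intro continuous_on_norm holomorphic_on_imp_continuous_on holomorphic_on_subset[OF Nhol])
        (auto simp: Kiff uhp_iff)
    ultimately obtain t0 where t0: "t0 \<in> K" "\<And>t. t \<in> K \<Longrightarrow> norm (N t) \<le> norm (N t0)"
      using continuous_attains_sup[of K "\<lambda>t. norm (N t)"] by (auto simp: K_def compact_cbox)
    have t0': "norm (N t1) \<le> norm (N t0)"
      using t0(2)[OF \<open>red t1 \<in> K\<close>] red[of t1] t1 by auto
    have max: "norm (N t) \<le> norm (N t0)" if "Im t \<ge> 4/5" for t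
    proof (cases "Im t \<le> Y")
      case True
      then have "red t \<in> K" using red[of t] that by (auto simp: Kiff)
      then show ?thesis using t0(2)[of "red t"] red[of t] that by auto
    next
      case False
      then show ?thesis using Nb[OF that] Y(2)[of t] t0' by auto
    qed
    \<comment> \<open>A maximum on the lower edge is moved into the interior by inversion: there the
      squared norm of \<open>t0\<close> is at most 1/4 + 16/25 < 1, so \<open>- 1 / t0\<close> lies
      higher. This is why the height is taken below half of \<open>sqrt 3\<close>.\<close>
    have "\<exists>s. Im s > 4/5 \<and> N s = N t0"
    proof (cases "Im t0 > 4/5")
      case False
      then have i: "Im t0 = 4/5" using t0(1) by (auto simp: Kiff)
      have "(Re t0)\<^sup>2 \<le> (1/2)\<^sup>2" using t0(1) by (intro power2_le_iff_abs_le[THEN iffD2]) (auto simp: Kiff abs_le_iff)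
      moreover have "(norm t0)\<^sup>2 = (Re t0)\<^sup>2 + (4/5)\<^sup>2" by (simp add: cmod_power2 i)
      ultimately have "(norm t0)\<^sup>2 \<le> (1/2)\<^sup>2 + (4/5)\<^sup>2" by linarith
      also have "\<dots> < 1" by (simp add: power2_eq_square)
      finally have "(norm t0)\<^sup>2 < 1" .
      moreover have "(norm t0)\<^sup>2 > 0" using i by auto
      ultimately have "Im (- 1 / t0) > 4/5"
        unfolding Im_neg_inverse i by (simp add: field_simps)
      then show ?thesis using NS[of t0] i by (intro exI[of _ "- 1 / t0"]) auto
    qed auto
    then obtain s where s: "Im s > 4/5" "N s = N t0" by blast
    have "N constant_on {z. Im z > 4/5}"
      by (rule maximum_modulus_principle[OF holomorphic_on_subset[OF Nhol]
            open_halfspace_Im_gt connected_halfspace_Im_gt open_halfspace_Im_gt order_refl, of _ s])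
        (use s max in \<open>auto simp: uhp_iff\<close>)
    then have const: "N t = N s" if "Im t > 4/5" for t
      using s(1) that unfolding constant_on_def by force
    define t2 where "t2 = of_real (max Y 1) * \<i>"
    have t2: "Im t2 \<ge> 1" "Im t2 \<ge> Y" by (simp_all add: t2_def)
    then have "norm (N t2) < norm (N t1)"
      using Nb[of t2] Y(2)[of t2] by linarith
    moreover have "N t2 = N s" using const[of t2] t2 by simp
    ultimately show False using s(2) t0' by simp
  qed
  let ?U = "{z. Im z > 4/5}"
  have sub: "?U \<subseteq> upper_half_plane" by (auto simp: uhp_iff)
  note U = open_halfspace_Im_gt[of "4/5"] connected_halfspace_Im_gt[of "4/5"]
  have ne: "?U \<noteq> {}" by (auto intro: exI[of _ "\<i>"])
  have hU: "h holomorphic_on ?U" "(\<lambda>t. h (- 1 / t)) holomorphic_on ?U" "(\<lambda>t. h (- 1 / (t + 1))) holomorphic_on ?U"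
    using hol hi hi1 sub holomorphic_on_subset by blast+
  have "(\<forall>t\<in>?U. h t = 0) \<or> (\<forall>t\<in>?U. h (- 1 / t) * h (- 1 / (t + 1)) = 0)"
    by (rule holomorphic_mult_eq_0[OF _ _ U]) (use N0 hU in \<open>auto simp: N_def intro!: holomorphic_intros\<close>)
  moreover have "(\<forall>t\<in>?U. h (- 1 / t) = 0) \<or> (\<forall>t\<in>?U. h (- 1 / (t + 1)) = 0)"
    if "\<forall>t\<in>?U. h (- 1 / t) * h (- 1 / (t + 1)) = 0"
    by (rule holomorphic_mult_eq_0[OF _ _ U]) (use that hU in auto)
  moreover have "\<forall>t\<in>?U. h (- 1 / t) = 0" if "\<forall>t\<in>?U. h (- 1 / (t + 1)) = 0"
  proof
    fix t assume "t \<in> ?U"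
    then show "h (- 1 / t) = 0" using bspec[OF that, of "t - 1"] by simp
  qed
  ultimately consider "\<forall>t\<in>?U. h t = 0" | "\<forall>t\<in>?U. h (- 1 / t) = 0" by blast
  then show ?thesis
  proof cases
    case 1
    then show ?thesis
      using analytic_continuation_open[OF U(1) open_uhp ne connected_uhp sub hol holomorphic_on_const[of 0], of z] \<open>Im z > 0\<close>
      by (simp add: uhp_iff)
  next
    case 2
    then have "h (- 1 / z) = 0" if "Im z > 0" for z
      using analytic_continuation_open[OF U(1) open_uhp ne connected_uhp sub hi holomorphic_on_const[of 0], of z] that
      by (simp add: uhp_iff)
    from this[of "- 1 / z"] Im_neg_inverse_pos[OF \<open>Im z > 0\<close>] show ?thesis by simp
  qed
qed

lemma bounded_on_cball:
  fixes g :: "complex \<Rightarrow> complex"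
  assumes "continuous_on (ball 0 1) g" "r < 1"
  shows "\<exists>B\<ge>0. \<forall>q. norm q \<le> r \<longrightarrow> norm (g q) \<le> B"
proof -
  have "compact (g ` cball 0 r)"
    by (intro compact_continuous_image continuous_on_subset[OF assms(1)] compact_cball)
      (use assms(2) in auto)
  then obtain B where "\<And>x. x \<in> g ` cball 0 r \<Longrightarrow> norm x \<le> B"
    using compact_imp_bounded bounded_iff by metis
  then show ?thesis by (intro exI[of _ "max B 0"]) (force simp: le_max_iff_disj)
qed

lemma norm_ee_le: "Im z \<ge> y \<Longrightarrow> norm (ee z) \<le> exp (- 2 * pi * y)"
  by (simp add: norm_ee)

lemma norm_power_int_ee: "norm (ee z) powi m = exp (- 2 * pi * of_int m * Im z)"
  by (simp add: norm_ee exp_power_int mult_ac)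

lemma power_int_square_quartic:
  fixes A :: complex
  assumes "A \<noteq> 0"
  shows "(A powi k)\<^sup>2 * (A ^ 4) powi m = A powi (2 * k + 4 * m)"
proof -
  have "A powi (2 * k + 4 * m) = A powi (k * 2) * A powi (4 * m)"
    using assms by (simp add: power_int_add mult.commute)
  moreover have "A powi (k * 2) = (A powi k)\<^sup>2" "A powi (4 * m) = (A ^ 4) powi m"
    by (simp_all only: power_int_mult power_int_numeral)
  ultimately show ?thesis by simp
qed

text \<open>Squaring makes the weight divisible by 4, so that a power of \<open>fS\<close> can
  divide it out. As \<open>fS\<close> has a simple zero at \<infinity> and no other, the quotient
  vanishes there to order at least \<open>2 * (l + 1) - m\<close>, which is positive, and it stays
  bounded at the cusp 0; \<open>invariant_function_eq_0\<close> applies.\<close>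

lemma form_unique:
  fixes k m l :: int
  assumes km: "k = 2 * m" and ml: "m \<le> 2 * l + 1"
    and hol: "d holomorphic_on upper_half_plane"
    and T: "\<And>z. Im z > 0 \<Longrightarrow> d (z + 1) = d z"
    and G: "\<And>z. Im z > 0 \<Longrightarrow> d (z / (2 * z + 1)) = (2 * z + 1) powi k * d z"
    and inf: "\<And>z. Im z \<ge> 4/5 \<Longrightarrow> norm (d z) \<le> C * norm (ee z) powi (l + 1)"
    and zero: "\<And>z. Im z \<ge> 4/5 \<Longrightarrow> norm (z powi (- k) * d (- 1 / z)) \<le> C'"
    and z: "Im z > 0"
  shows "d z = 0"
proof -
  define h where "h z = (d z)\<^sup>2 * fS (ee z) powi (- m)" for z
  have ball: "ee z \<in> ball 0 1" if "Im z > 0" for z using norm_ee_less_1[OF that] by simp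
  have S: "(\<lambda>z. fS (ee z)) holomorphic_on upper_half_plane"
  proof -
    have "(fS \<circ> ee) holomorphic_on upper_half_plane"
      by (intro holomorphic_on_compose_gen[OF _ fS_holomorphic] holomorphic_intros)
        (use ball in \<open>auto simp: uhp_iff\<close>)
    then show ?thesis by (simp add: o_def)
  qed
  \<comment> \<open>The height 2/5 is half of 4/5 because the expansion at the cusp 0 is evaluated
    at \<open>ee (z / 2)\<close>. The same disc serves for both cusps.\<close>
  have r: "exp (- 2 * pi * (2/5)) < 1" by simp
  have "continuous_on (ball 0 1) (\<lambda>q. (fG q ^ 8) powi (- m))"
    by (intro continuous_intros holomorphic_on_imp_continuous_on[OF fG_holomorphic]) auto
  from bounded_on_cball[OF this r] obtain B
    where B: "B \<ge> 0" "\<And>q. norm q \<le> exp (- 2 * pi * (2/5)) \<Longrightarrow> norm ((fG q ^ 8) powi (- m)) \<le> B" by auto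
  have "continuous_on (ball 0 1) (\<lambda>q. (fT q / 256) powi (- m))"
    by (intro continuous_intros holomorphic_on_imp_continuous_on[OF fT_holomorphic]) auto
  from bounded_on_cball[OF this r] obtain B'
    where B': "B' \<ge> 0" "\<And>q. norm q \<le> exp (- 2 * pi * (2/5)) \<Longrightarrow> norm ((fT q / 256) powi (- m)) \<le> B'" by auto
  have "h z = 0"
  proof (rule invariant_function_eq_0[of h "C\<^sup>2 * B" "C'\<^sup>2 * B'"])
    show "h holomorphic_on upper_half_plane"
      unfolding h_def[abs_def] by (intro holomorphic_intros hol S) auto
    show "h (z + 1) = h z" if "Im z > 0" for z using T[OF that] by (simp add: h_def ee_add)
    show "h (z / (2 * z + 1)) = h z" if "Im z > 0" for z
    proof -
      have nz: "2 * z + 1 \<noteq> 0" using that by (auto simp: complex_eq_iff)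
      have "((2 * z + 1) powi k)\<^sup>2 * ((2 * z + 1) ^ 4) powi (- m) = 1"
        using power_int_square_quartic[OF nz, of k "- m"] km by simp
      moreover have "h (z / (2 * z + 1)) = ((2 * z + 1) powi k)\<^sup>2 * ((2 * z + 1) ^ 4) powi (- m) * h z"
        unfolding h_def G[OF that] gamma_fS[OF that] power_int_mult_distrib power_mult_distrib
        by (simp only: mult_ac)
      ultimately show ?thesis by simp
    qed
    show "norm (h z) \<le> C\<^sup>2 * B * norm (ee z)" if "Im z \<ge> 4/5" for z
    proof -
      let ?r = "norm (ee z)"
      have r1: "0 < ?r" "?r < 1" using that by (auto intro: norm_ee_less_1)
      have r2: "?r \<le> exp (- 2 * pi * (2/5))" using that by (intro norm_ee_le) auto
      have "norm (h z) = (norm (d z))\<^sup>2 * (?r powi (- m) * norm ((fG (ee z) ^ 8) powi (- m)))"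
        by (simp add: h_def fS_def norm_mult norm_power norm_power_int power_int_mult_distrib)
      also have "\<dots> \<le> (C * ?r powi (l + 1))\<^sup>2 * (?r powi (- m) * B)"
        using r1 by (intro mult_mono power_mono inf that B r2) (auto intro!: mult_nonneg_nonneg zero_le_power_int)
      also have "\<dots> = C\<^sup>2 * B * (?r powi ((l + 1) * 2 + (- m)))"
      proof -
        have "?r powi ((l + 1) * 2 + (- m)) = ?r powi ((l + 1) * 2) * ?r powi (- m)"
          using r1 by (intro power_int_add) auto
        also have "?r powi ((l + 1) * 2) = (?r powi (l + 1))\<^sup>2" by (simp only: power_int_mult power_int_numeral)
        finally show ?thesis by (simp only: power_mult_distrib mult_ac)
      qed
      also have "\<dots> \<le> C\<^sup>2 * B * (?r powi 1)"
        using r1 B ml by (intro mult_left_mono power_int_decreasing) auto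
      finally show ?thesis by simp
    qed
    show "norm (h (- 1 / z)) \<le> C'\<^sup>2 * B'" if "Im z \<ge> 4/5" for z
    proof -
      have z2: "Im (z / 2) > 0" and nz: "z \<noteq> 0" using that by auto
      have "fS (ee (- 1 / z)) = z ^ 4 * (fT (ee (z / 2)) / 256)"
        using fricke_fS[OF z2] by (simp add: power_divide)
      moreover have "(z powi (- k))\<^sup>2 = (z ^ 4) powi (- m)"
      proof -
        have "(z powi (- k))\<^sup>2 = z powi ((- k) * 2)" by (simp only: power_int_mult power_int_numeral)
        also have "\<dots> = z powi (4 * (- m))" using km by simp
        finally show ?thesis by (simp only: power_int_mult power_int_numeral)
      qed
      ultimately have "h (- 1 / z) = (z powi (- k) * d (- 1 / z))\<^sup>2 * (fT (ee (z / 2)) / 256) powi (- m)"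
        by (simp only: h_def power_mult_distrib power_int_mult_distrib mult_ac)
      then have "norm (h (- 1 / z)) = (norm (z powi (- k) * d (- 1 / z)))\<^sup>2 * norm ((fT (ee (z / 2)) / 256) powi (- m))"
        by (simp only: norm_mult norm_power)
      also have "\<dots> \<le> C'\<^sup>2 * B'"
        using that by (intro mult_mono power_mono zero B' norm_ee_le) auto
      finally show ?thesis .
    qed
  qed (rule z)
  then show ?thesis by (simp add: h_def)
qed

section \<open>Elimination of the polar part by powers of the Hauptmodul\<close>

lemma division_by_q:
  assumes "h holomorphic_on ball 0 1" "h 0 = 0" and c: "\<And>q. norm q < 1 \<Longrightarrow> h (cnj q) = cnj (h q)"
  shows "\<exists>w. w holomorphic_on ball 0 1 \<and> (\<forall>q. norm q < 1 \<longrightarrow> h q = q * w q) \<and>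
             (\<forall>q. norm q < 1 \<longrightarrow> w (cnj q) = cnj (w q))"
proof (intro exI conjI)
  let ?w = "\<lambda>z. if z = 0 then deriv h 0 else (h z - h 0) / (z - 0)"
  show "?w holomorphic_on ball 0 1" by (rule pole_lemma_open[OF assms(1)]) auto
  show "\<forall>q. norm q < 1 \<longrightarrow> h q = q * ?w q" using assms(2) by auto
  have d: "(h has_field_derivative deriv h 0) (at 0)"
    using holomorphic_derivI[OF assms(1)] by simp
  then have "((cnj \<circ> h \<circ> cnj) has_field_derivative cnj (deriv h 0)) (at 0)"
    using has_field_derivative_cnj_cnj[of h "deriv h 0" 0] by simp
  then have "(h has_field_derivative cnj (deriv h 0)) (at 0)"
    by (rule has_field_derivative_transform_within_open[where S = "ball 0 1"]) (use c in auto)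
  then have "cnj (deriv h 0) = deriv h 0" using d by (rule DERIV_unique)
  then show "\<forall>q. norm q < 1 \<longrightarrow> ?w (cnj q) = cnj (?w q)" using c assms(2) by auto
qed

text \<open>Since \<open>1 / fv q\<close> is \<open>1 / q\<close> times a function with value 1 at
  0, one monomial removes the leading polar coefficient \<open>u 0\<close>, and the rest is
  divisible by \<open>q\<close>. The symmetry under conjugation is carried through the induction to
  make the coefficients real.\<close>

lemma hauptmodul_elimination:
  assumes "u holomorphic_on ball 0 1" and "\<And>q. norm q < 1 \<Longrightarrow> u (cnj q) = cnj (u q)"
  shows "\<exists>(c :: nat \<Rightarrow> real) w. w holomorphic_on ball 0 1 \<and>
    (\<forall>q. norm q < 1 \<longrightarrow> q \<noteq> 0 \<longrightarrow>
       fF q ^ e * (\<Sum>j\<le>N. of_real (c j) * (1 / fv q) ^ j) = u q / q ^ N + q * w q)"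
  using assms
proof (induction N arbitrary: u)
  case (0 u)
  have "cnj (u 0) = u 0" using 0(2)[of 0] by simp
  then have u0: "of_real (Re (u 0)) = u 0" by (simp add: complex_eq_iff)
  define h where "h q = fF q ^ e * u 0 - u q" for q
  have "\<exists>w. w holomorphic_on ball 0 1 \<and> (\<forall>q. norm q < 1 \<longrightarrow> h q = q * w q) \<and>
             (\<forall>q. norm q < 1 \<longrightarrow> w (cnj q) = cnj (w q))"
    by (rule division_by_q)
      (use 0 \<open>cnj (u 0) = u 0\<close> in \<open>auto simp: h_def[abs_def] fF_cnj intro!: holomorphic_intros fF_holomorphic\<close>)
  then obtain w where "w holomorphic_on ball 0 1" "\<And>q. norm q < 1 \<Longrightarrow> h q = q * w q" by blast
  then show ?case
    by (intro exI[of _ "\<lambda>_. Re (u 0)"] exI[of _ w]) (auto simp: h_def u0 algebra_simps)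
next
  case (Suc N u)
  have cu: "cnj (u 0) = u 0" using Suc(3)[of 0] by simp
  then have u0: "of_real (Re (u 0)) = u 0" by (simp add: complex_eq_iff)
  define h where "h q = u q - u 0 * fF q ^ e * (1 / eA q ^ 24) ^ Suc N" for q
  have "\<exists>w. w holomorphic_on ball 0 1 \<and> (\<forall>q. norm q < 1 \<longrightarrow> h q = q * w q) \<and>
             (\<forall>q. norm q < 1 \<longrightarrow> w (cnj q) = cnj (w q))"
    by (rule division_by_q)
      (use Suc cu in \<open>auto simp: h_def[abs_def] fF_cnj eA_cnj intro!: holomorphic_intros fF_holomorphic eA_holomorphic\<close>)
  then obtain u1 where u1: "u1 holomorphic_on ball 0 1" "\<And>q. norm q < 1 \<Longrightarrow> h q = q * u1 q"
    "\<And>q. norm q < 1 \<Longrightarrow> u1 (cnj q) = cnj (u1 q)" by blast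
  from Suc.IH[OF u1(1,3)] obtain c w where w: "w holomorphic_on ball 0 1"
    and cw: "\<And>q. norm q < 1 \<Longrightarrow> q \<noteq> 0 \<Longrightarrow>
       fF q ^ e * (\<Sum>j\<le>N. of_real (c j) * (1 / fv q) ^ j) = u1 q / q ^ N + q * w q" by blast
  define c' where "c' = c(Suc N := Re (u 0))"
  have "fF q ^ e * (\<Sum>j\<le>Suc N. of_real (c' j) * (1 / fv q) ^ j) = u q / q ^ Suc N + q * w q"
    if q: "norm q < 1" "q \<noteq> 0" for q
  proof -
    have s: "(\<Sum>j\<le>Suc N. of_real (c' j) * (1 / fv q) ^ j) =
        (\<Sum>j\<le>N. of_real (c j) * (1 / fv q) ^ j) + u 0 * (1 / fv q) ^ Suc N"
      by (simp add: c'_def u0)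
    have e: "(1 / fv q) ^ Suc N = (1 / eA q ^ 24) ^ Suc N / q ^ Suc N"
      by (simp add: fv_def power_divide power_mult_distrib)
    have "fF q ^ e * (\<Sum>j\<le>Suc N. of_real (c' j) * (1 / fv q) ^ j) =
       u1 q / q ^ N + q * w q + (u 0 * fF q ^ e * (1 / eA q ^ 24) ^ Suc N) / q ^ Suc N"
      unfolding s e cw[OF q, symmetric] distrib_left by (simp only: times_divide_eq_right mult_ac)
    also have "u 0 * fF q ^ e * (1 / eA q ^ 24) ^ Suc N = u q - q * u1 q"
      using u1(2)[OF q(1)] unfolding h_def by (simp add: algebra_simps)
    also have "u1 q / q ^ N + q * w q + (u q - q * u1 q) / q ^ Suc N = u q / q ^ Suc N + q * w q"
      using q by (simp add: diff_divide_distrib)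
    finally show ?thesis .
  qed
  then show ?case using w by blast
qed

text \<open>Absolute convergence at height \<open>y\<close> controls everything above: from height
  \<open>y\<close> to \<open>Im z\<close> every term with \<open>m \<ge> m0\<close> decays at least
  as fast as the one with index \<open>m0\<close>.\<close>

lemma fourier_bound:
  assumes "has_fourier_expansion h g a" "h > 0" "\<And>m. m < m0 \<Longrightarrow> a m = 0" "y > 0"
  shows "\<exists>C. \<forall>z. Im z \<ge> y \<longrightarrow> norm (g z) \<le> C * exp (- 2 * pi * of_int m0 * Im z / of_nat h)"
proof -
  have nt: "norm (a m * exp (2 * of_real pi * \<i> * of_int m * z / of_nat h)) =
     norm (a m) * exp (- 2 * pi * of_int m * Im z / real h)" for m z
  proof -
    have "Re (2 * of_real pi * \<i> * of_int m * z / of_nat h) = - 2 * pi * of_int m * Im z / real h"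
      using \<open>h > 0\<close> by (simp add: Re_divide power2_eq_square)
    then show ?thesis by (simp add: norm_mult)
  qed
  let ?z0 = "of_real y * \<i>"
  have "?z0 \<in> upper_half_plane" using \<open>y > 0\<close> by (simp add: uhp_iff)
  then have "(\<lambda>m. a m * exp (2 * of_real pi * \<i> * of_int m * ?z0 / of_nat h)) summable_on UNIV"
    using assms(1) unfolding has_fourier_expansion_def summable_on_def by blast
  then have "(\<lambda>m. norm (a m * exp (2 * of_real pi * \<i> * of_int m * ?z0 / of_nat h))) summable_on UNIV"
    by (simp only: summable_on_iff_abs_summable_on_complex)
  then obtain S where S: "((\<lambda>m. norm (a m) * exp (- 2 * pi * of_int m * y / real h)) has_sum S) UNIV"
    unfolding nt summable_on_def by auto
  have "norm (g z) \<le> (S * exp (2 * pi * of_int m0 * y / real h)) * exp (- 2 * pi * of_int m0 * Im z / real h)"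
    if z: "Im z \<ge> y" for z
  proof -
    define E where "E = exp (- 2 * pi * of_int m0 * (Im z - y) / real h)"
    have g: "((\<lambda>m. a m * exp (2 * of_real pi * \<i> * of_int m * z / of_nat h)) has_sum g z) UNIV"
      using assms(1) z \<open>y > 0\<close> by (auto simp: has_fourier_expansion_def uhp_iff)
    have "norm (g z) \<le> S * E"
    proof (rule norm_infsum_le[OF g has_sum_cmult_left[OF S]])
      fix m
      show "norm (a m * exp (2 * of_real pi * \<i> * of_int m * z / of_nat h)) \<le>
          norm (a m) * exp (- 2 * pi * of_int m * y / real h) * E"
      proof (cases "m < m0")
        case False
        have "of_int m0 * (Im z - y) \<le> of_int m * (Im z - y)"
          using False z by (intro mult_right_mono) auto
        then have "2 * pi * (of_int m0 * (Im z - y)) \<le> 2 * pi * (of_int m * (Im z - y))"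
          by (intro mult_left_mono) auto
        then have "(2 * pi * (of_int m0 * (Im z - y))) / real h \<le> (2 * pi * (of_int m * (Im z - y))) / real h"
          by (intro divide_right_mono) auto
        then have "- 2 * pi * of_int m * Im z / real h \<le> - 2 * pi * of_int m * y / real h + - 2 * pi * of_int m0 * (Im z - y) / real h"
          by (simp add: right_diff_distrib diff_divide_distrib mult_ac)
        then have "norm (a m) * exp (- 2 * pi * of_int m * Im z / real h) \<le> norm (a m) *
            exp (- 2 * pi * of_int m * y / real h + - 2 * pi * of_int m0 * (Im z - y) / real h)"
          by (intro mult_left_mono) auto
        then show ?thesis unfolding nt by (simp only: E_def exp_add mult.assoc)
      qed (use assms(3) in simp)
    qed
    also have "E = exp (2 * pi * of_int m0 * y / real h) * exp (- 2 * pi * of_int m0 * Im z / real h)"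
      unfolding E_def exp_add[symmetric] by (simp add: right_diff_distrib diff_divide_distrib mult_ac)
    finally show ?thesis by (simp add: mult.assoc)
  qed
  then show ?thesis by blast
qed


text \<open>The definition is evaluated at three matrices: the translation, the lower triangular
  generator, and the inversion, which carries \<infinity> to the cusp 0.\<close>

lemma M_sharpD:
  assumes "f \<in> M_sharp k"
  shows "f holomorphic_on upper_half_plane"
    and "Im z > 0 \<Longrightarrow> f (z + 1) = f z"
    and "Im z > 0 \<Longrightarrow> f (z / (2 * z + 1)) = (2 * z + 1) powi k * f z"
    and "\<exists>C. \<forall>z. Im z \<ge> 4/5 \<longrightarrow> norm (z powi (- k) * f (- 1 / z)) \<le> C"
proof -
  have f: "f holomorphic_on upper_half_plane"
    "\<And>A z. A \<in> Gamma0_2 \<Longrightarrow> z \<in> upper_half_plane \<Longrightarrow> slash k f A z = f z"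
    "\<And>A. A \<in> SL2Z - Gamma0_2 \<Longrightarrow> holomorphic_at_cusp k f A"
    using assms by (auto simp: M_sharp_def weakly_holomorphic_forms_def)
  show "f holomorphic_on upper_half_plane" by (rule f)
  show "f (z + 1) = f z" if "Im z > 0"
  proof -
    have "(vector [vector [1, 1], vector [0, 1]] :: int^2^2) \<in> Gamma0_2"
      by (simp add: Gamma0_2_def SL2Z_def det_2)
    from f(2)[OF this, of z] show ?thesis using that by (simp add: slash_def uhp_iff)
  qed
  show "f (z / (2 * z + 1)) = (2 * z + 1) powi k * f z" if "Im z > 0"
  proof -
    have nz: "2 * z + 1 \<noteq> 0" using that by (auto simp: complex_eq_iff)
    have "(vector [vector [1, 0], vector [2, 1]] :: int^2^2) \<in> Gamma0_2"
      by (simp add: Gamma0_2_def SL2Z_def det_2 cong_def)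
    from f(2)[OF this, of z] have "(2 * z + 1) powi (- k) * f (z / (2 * z + 1)) = f z"
      using that by (simp add: slash_def uhp_iff)
    then show ?thesis using nz by (simp add: power_int_minus field_simps)
  qed
  have "(vector [vector [0, - 1], vector [1, 0]] :: int^2^2) \<in> SL2Z - Gamma0_2"
    by (simp add: Gamma0_2_def SL2Z_def det_2 cong_def)
  from f(3)[OF this] obtain a where
    "has_fourier_expansion 2 (slash k f (vector [vector [0, - 1], vector [1, 0]])) a" "\<forall>m<0. a m = 0"
    by (auto simp: holomorphic_at_cusp_def)
  from fourier_bound[OF this(1), of 0 "4/5"] this(2)
  show "\<exists>C. \<forall>z. Im z \<ge> 4/5 \<longrightarrow> norm (z powi (- k) * f (- 1 / z)) \<le> C"
    by (simp add: slash_def)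
qed

lemma has_leading_formD:
  assumes "has_leading_form f n l"
  shows "\<exists>C. \<forall>z. Im z \<ge> 4/5 \<longrightarrow> norm (f z - ee z powi (- n)) \<le> C * norm (ee z) powi (l + 1)"
proof -
  from assms obtain a where a: "has_fourier_expansion 1 f a" "a (- n) = 1" "\<And>m. m \<le> l \<Longrightarrow> m \<noteq> - n \<Longrightarrow> a m = 0"
    by (auto simp: has_leading_form_def)
  have eq: "exp (2 * of_real pi * \<i> * of_int m * z / of_nat 1) = ee z powi m" for m z
    by (simp add: ee_def exp_power_int mult_ac)
  \<comment> \<open>Subtracting the leading term changes just the coefficient at \<open>- n\<close>.
    All coefficients up to \<open>l\<close> then vanish, and \<open>fourier_bound\<close> gives the
    order \<open>l + 1\<close>.\<close>
  have F: "has_fourier_expansion 1 (\<lambda>z. f z - ee z powi (- n)) (a(- n := 0))"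
    unfolding has_fourier_expansion_def
  proof
    fix z assume "z \<in> upper_half_plane"
    then have "((\<lambda>m. a m * ee z powi m) has_sum f z) UNIV"
      using a(1) unfolding has_fourier_expansion_def eq by blast
    moreover have "((\<lambda>m. a m * ee z powi m) has_sum (\<Sum>m\<in>{- n}. a m * ee z powi m)) {- n}"
      by (rule has_sum_finite) simp
    ultimately have "((\<lambda>m. a m * ee z powi m) has_sum (f z - (\<Sum>m\<in>{- n}. a m * ee z powi m))) (UNIV - {- n})"
      by (rule has_sum_Diff) simp
    then have "((\<lambda>m. a m * ee z powi m) has_sum (f z - ee z powi (- n))) (UNIV - {- n})"
      using a(2) by simp
    also have "?this \<longleftrightarrow> ((\<lambda>m. (a(- n := 0)) m * ee z powi m) has_sum (f z - ee z powi (- n))) UNIV"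
      by (rule has_sum_cong_neutral) auto
    finally show "((\<lambda>m. (a(- n := 0)) m * exp (2 * of_real pi * \<i> * of_int m * z / of_nat 1)) has_sum
        (f z - ee z powi (- n))) UNIV" unfolding eq .
  qed
  have Z: "(a(- n := 0)) m = 0" if "m < l + 1" for m using a(3)[of m] that by auto
  have "\<exists>C. \<forall>z. Im z \<ge> 4/5 \<longrightarrow> norm (f z - ee z powi (- n)) \<le>
      C * exp (- 2 * pi * of_int (l + 1) * Im z / of_nat 1)"
    by (rule fourier_bound[OF F _ Z]) simp_all
  then show ?thesis unfolding norm_power_int_ee by simp
qed

section \<open>Construction of the basis forms\<close>

lemma compose_ee_holomorphic:
  assumes "g holomorphic_on ball 0 1"
  shows "(\<lambda>z. g (ee z)) holomorphic_on upper_half_plane"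
proof -
  have "(g \<circ> ee) holomorphic_on upper_half_plane"
    by (intro holomorphic_on_compose_gen[OF _ assms] holomorphic_intros)
      (use norm_ee_less_1 in \<open>auto simp: uhp_iff\<close>)
  then show ?thesis by (simp add: o_def)
qed

definition hpoly :: "(nat \<Rightarrow> real) \<Rightarrow> nat \<Rightarrow> complex \<Rightarrow> complex" where
  "hpoly c N x = (\<Sum>j\<le>N. of_real (c j) * x ^ j)"

definition form_of :: "int \<Rightarrow> nat \<Rightarrow> (nat \<Rightarrow> real) \<Rightarrow> nat \<Rightarrow> complex \<Rightarrow> complex" where
  "form_of l e c N z = fS (ee z) powi l * fF (ee z) ^ e * hpoly c N (1 / fv (ee z))"

lemma hpoly_holomorphic [holomorphic_intros]:
  "g holomorphic_on S \<Longrightarrow> (\<lambda>z. hpoly c N (g z)) holomorphic_on S"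
  unfolding hpoly_def by (intro holomorphic_intros)

lemma form_of_holomorphic: "form_of l e c N holomorphic_on upper_half_plane"
  unfolding form_of_def[abs_def]
  by (intro holomorphic_intros compose_ee_holomorphic f_holomorphic fF_holomorphic) auto

lemma form_of_gamma:
  assumes "Im z > 0"
  shows "form_of l e c N (z / (2 * z + 1)) = (2 * z + 1) powi (4 * l + 2 * int e) * form_of l e c N z"
proof -
  define A where "A = 2 * z + 1"
  have nz: "A \<noteq> 0" using assms by (auto simp: A_def complex_eq_iff)
  have "A powi (4 * l + 2 * int e) = A powi (4 * l) * A powi (2 * int e)"
    using nz by (simp add: power_int_add)
  also have "\<dots> = (A ^ 4) powi l * (A\<^sup>2) ^ e"
    by (simp only: power_int_mult power_int_numeral power_int_of_nat)
  finally show ?thesis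
    unfolding form_of_def gamma_transform[OF assms] unfolding A_def[symmetric]
    by (simp only: power_int_mult_distrib power_mult_distrib mult_ac)
qed

text \<open>Writing \<open>- 1 / z\<close> as the Fricke image of \<open>z / 2\<close> turns the
  pole of \<open>1 / fv\<close> at \<infinity> into \<open>4096 * fv\<close>, which vanishes at the
  cusp 0. The polynomial in the Hauptmodul hence stays bounded there.\<close>

lemma form_of_cusp_0:
  assumes "Im z > 0"
  shows "z powi (- (4 * l + 2 * int e)) * form_of l e c N (- 1 / z) =
    (fT (ee (z / 2)) / 256) powi l * (- fF (ee (z / 2)) / 2) ^ e * hpoly c N (4096 * fv (ee (z / 2)))"
proof -
  have z2: "Im (z / 2) > 0" and nz: "z \<noteq> 0" using assms by auto
  have S: "fS (ee (- 1 / z)) = z ^ 4 * (fT (ee (z / 2)) / 256)"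
    using fricke_fS[OF z2] by (simp add: power_divide)
  have F: "fF (ee (- 1 / z)) = z\<^sup>2 * (- fF (ee (z / 2)) / 2)"
    using fricke_fF[OF z2] by (simp add: power_divide)
  have v: "1 / fv (ee (- 1 / z)) = 4096 * fv (ee (z / 2))"
    using fricke_fv'[OF z2] by simp
  have "z powi (4 * l + 2 * int e) = z powi (4 * l) * z powi (2 * int e)"
    using nz by (simp add: power_int_add)
  also have "\<dots> = (z ^ 4) powi l * (z\<^sup>2) ^ e"
    by (simp only: power_int_mult power_int_numeral power_int_of_nat)
  finally have "form_of l e c N (- 1 / z) = z powi (4 * l + 2 * int e) *
    ((fT (ee (z / 2)) / 256) powi l * (- fF (ee (z / 2)) / 2) ^ e * hpoly c N (4096 * fv (ee (z / 2))))"
    unfolding form_of_def S F v by (simp only: power_int_mult_distrib power_mult_distrib mult_ac)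
  moreover have "z powi (- j) * (z powi j * a) = a" for j a using nz by (simp add: power_int_minus)
  ultimately show ?thesis by (simp only:)
qed

text \<open>The form is constructed and then identified. As \<open>fS q powi l\<close> contributes
  \<open>q powi l\<close> and a power of \<open>fG\<close>, eliminating the polar part of
  \<open>(fG q ^ 8) powi (- l) / q ^ nat (n + l)\<close> yields a form with the prescribed expansion
  up to order \<open>l\<close>; its difference from \<open>f\<close> vanishes by
  \<open>form_unique\<close>.\<close>

theorem form_structure:
  assumes k: "k = 4 * l + 2 * int e" "e \<le> 1" and n: "n \<ge> - l"
    and f: "f \<in> M_sharp k" "has_leading_form f n l"
  shows "\<exists>c w. (\<forall>z. Im z > 0 \<longrightarrow> f z = form_of l e c (nat (n + l)) z) \<and> w holomorphic_on ball 0 1 \<and>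
    (\<forall>q. norm q < 1 \<longrightarrow> q \<noteq> 0 \<longrightarrow>
       fF q ^ e * hpoly c (nat (n + l)) (1 / fv q) = (fG q ^ 8) powi (- l) / q ^ nat (n + l) + q * w q)"
proof -
  define N where "N = nat (n + l)"
  have "(\<lambda>q. (fG q ^ 8) powi (- l)) holomorphic_on ball 0 1"
    by (intro holomorphic_intros fG_holomorphic) auto
  moreover have "(fG (cnj q) ^ 8) powi (- l) = cnj ((fG q ^ 8) powi (- l))" if "norm q < 1" for q
    using that by (simp add: fG_cnj)
  ultimately obtain c w
    where w: "w holomorphic_on ball 0 1"
      and cw: "\<And>q. norm q < 1 \<Longrightarrow> q \<noteq> 0 \<Longrightarrow>
       fF q ^ e * hpoly c N (1 / fv q) = (fG q ^ 8) powi (- l) / q ^ N + q * w q"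
    using hauptmodul_elimination[of "\<lambda>q. (fG q ^ 8) powi (- l)" e N] unfolding hpoly_def by blast
  obtain C1 where C1: "\<And>z. Im z \<ge> 4/5 \<Longrightarrow> norm (z powi (- k) * f (- 1 / z)) \<le> C1"
    using M_sharpD(4)[OF f(1)] by auto
  obtain C2 where C2: "\<And>z. Im z \<ge> 4/5 \<Longrightarrow> norm (f z - ee z powi (- n)) \<le> C2 * norm (ee z) powi (l + 1)"
    using has_leading_formD[OF f(2)] by auto
  have r: "exp (- 2 * pi * (2/5)) < 1" by simp
  have "continuous_on (ball 0 1) (\<lambda>q. (fT q / 256) powi l * (- fF q / 2) ^ e * hpoly c N (4096 * fv q))"
    by (intro holomorphic_on_imp_continuous_on holomorphic_intros f_holomorphic fF_holomorphic) auto
  from bounded_on_cball[OF this r] obtain C3 where C3: "\<And>q. norm q \<le> exp (- 2 * pi * (2/5)) \<Longrightarrow>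
     norm ((fT q / 256) powi l * (- fF q / 2) ^ e * hpoly c N (4096 * fv q)) \<le> C3" by auto
  have "continuous_on (ball 0 1) (\<lambda>q. (fG q ^ 8) powi l * w q)"
    by (intro holomorphic_on_imp_continuous_on holomorphic_intros f_holomorphic w) auto
  from bounded_on_cball[OF this r] obtain C4 where C4: "\<And>q. norm q \<le> exp (- 2 * pi * (2/5)) \<Longrightarrow>
     norm ((fG q ^ 8) powi l * w q) \<le> C4" by auto
  have lead: "form_of l e c N z = ee z powi (- n) + ee z powi (l + 1) * ((fG (ee z) ^ 8) powi l * w (ee z))"
    if "Im z > 0" for z
  proof -
    define q where "q = ee z"
    have q: "norm q < 1" "q \<noteq> 0" using norm_ee_less_1[OF that] by (auto simp: q_def)
    have N: "q ^ N = q powi n * q powi l"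
      using n q by (simp add: N_def power_int_add[symmetric]) (simp add: power_int_def)
    have G: "(fG q ^ 8) powi l * (fG q ^ 8) powi (- l) = 1" by (simp add: power_int_minus)
    have "form_of l e c N z = (q * fG q ^ 8) powi l * (fF q ^ e * hpoly c N (1 / fv q))"
      by (simp add: form_of_def q_def fS_def)
    also have "\<dots> = q powi l * (fG q ^ 8) powi l * ((fG q ^ 8) powi (- l) / q ^ N + q * w q)"
      by (simp only: cw[OF q] power_int_mult_distrib)
    also have "\<dots> = (q powi l / q ^ N) * ((fG q ^ 8) powi l * (fG q ^ 8) powi (- l))
        + (q powi l * q) * ((fG q ^ 8) powi l * w q)"
      by (simp only: distrib_left times_divide_eq_right times_divide_eq_left mult_ac)
    also have "q powi l / q ^ N = q powi (- n)" unfolding N using q by (simp add: power_int_minus field_simps)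
    also have "q powi l * q = q powi (l + 1)" using q by (simp add: power_int_add)
    finally show ?thesis unfolding G by (simp add: q_def)
  qed
  have "f z = form_of l e c N z" if z: "Im z > 0" for z
  proof -
    have "f z - form_of l e c N z = 0"
    proof (rule form_unique[where k = k and m = "2 * l + int e" and l = l and d = "\<lambda>z. f z - form_of l e c N z"
          and C = "C2 + C4" and C' = "C1 + C3"])
      show "(\<lambda>z. f z - form_of l e c N z) holomorphic_on upper_half_plane"
        by (intro holomorphic_intros M_sharpD(1)[OF f(1)] form_of_holomorphic)
      show "f (z + 1) - form_of l e c N (z + 1) = f z - form_of l e c N z" if "Im z > 0" for z
        using M_sharpD(2)[OF f(1) that] by (simp add: form_of_def ee_add)
      show "f (z / (2 * z + 1)) - form_of l e c N (z / (2 * z + 1)) =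
          (2 * z + 1) powi k * (f z - form_of l e c N z)" if "Im z > 0" for z
        unfolding M_sharpD(3)[OF f(1) that] form_of_gamma[OF that] by (simp add: k right_diff_distrib)
      show "norm (f z - form_of l e c N z) \<le> (C2 + C4) * norm (ee z) powi (l + 1)" if y: "Im z \<ge> 4/5" for z
      proof -
        have "norm (f z - form_of l e c N z) \<le> norm (f z - ee z powi (- n)) +
            norm (ee z powi (l + 1) * ((fG (ee z) ^ 8) powi l * w (ee z)))"
          using norm_triangle_ineq4[of "f z - ee z powi (- n)" "ee z powi (l + 1) * ((fG (ee z) ^ 8) powi l * w (ee z))"]
            lead[of z] y by (simp add: algebra_simps)
        also have "norm (ee z powi (l + 1) * ((fG (ee z) ^ 8) powi l * w (ee z))) \<le> norm (ee z) powi (l + 1) * C4"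
          unfolding norm_mult[of "ee z powi (l + 1)"] norm_power_int
          using y by (intro mult_left_mono C4 norm_ee_le) (auto intro: zero_le_power_int)
        finally show ?thesis using C2[OF y] by (simp add: distrib_right mult.commute)
      qed
      show "norm (z powi (- k) * (f (- 1 / z) - form_of l e c N (- 1 / z))) \<le> C1 + C3" if y: "Im z \<ge> 4/5" for z
      proof -
        have "norm (z powi (- k) * (f (- 1 / z) - form_of l e c N (- 1 / z))) \<le>
            norm (z powi (- k) * f (- 1 / z)) + norm (z powi (- k) * form_of l e c N (- 1 / z))"
          unfolding right_diff_distrib by (rule norm_triangle_ineq4)
        also have "norm (z powi (- k) * form_of l e c N (- 1 / z)) \<le> C3"
          unfolding k form_of_cusp_0[of z, OF less_le_trans[OF _ y, of 0, simplified]]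
          using y by (intro C3 norm_ee_le) auto
        finally show ?thesis using C1[OF y] by simp
      qed
    qed (use k z in auto)
    then show ?thesis by simp
  qed
  then show ?thesis using w cw unfolding N_def by blast
qed

section \<open>The generating function as a contour integral\<close>

lemma fv_0 [simp]: "fv 0 = 0"
  by (simp add: fv_def)

lemma fv_deriv_eq: "q \<noteq> 0 \<Longrightarrow> eA q ^ 24 * fF q = fF q * fv q / q"
  by (simp add: fv_def)

text \<open>Because \<open>fF q / q\<close> is the logarithmic derivative of \<open>fv\<close>, the
  term \<open>fF q * (1 / fv q) ^ Suc j / q\<close> has a primitive and integrates to 0. The
  identity \<open>1 / (v (1 - x v)) = 1 / v + x / (1 - x v)\<close> then shows that raising
  \<open>j\<close> by one multiplies the integral by \<open>x\<close>.\<close>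

lemma hauptmodul_residue_power:
  assumes r: "0 < r" "r < 1" and nz: "\<And>q. norm q \<le> r \<Longrightarrow> x * fv q \<noteq> 1"
  shows "((\<lambda>q. fF q * (1 / fv q) ^ j / (q * (1 - x * fv q))) has_contour_integral 2 * of_real pi * \<i> * x ^ j)
           (circlepath 0 r)"
proof (induction j)
  case 0
  have "((\<lambda>q. (fF q / (1 - x * fv q)) / (q - 0)) has_contour_integral
      (2 * of_real pi * \<i> * (fF 0 / (1 - x * fv 0)))) (circlepath 0 r)"
  proof (rule Cauchy_integral_circlepath_simple)
    show "(\<lambda>q. fF q / (1 - x * fv q)) holomorphic_on cball 0 r"
      using r nz by (intro holomorphic_intros holomorphic_on_subset[OF fF_holomorphic]
          holomorphic_on_subset[OF fv_holomorphic]) force+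
  qed (use r in auto)
  then show ?case by (simp add: mult.commute)
next
  case (Suc j)
  define P where "P q = - (1 / of_nat (Suc j)) * (1 / fv q) ^ Suc j" for q
  have "((\<lambda>q. fF q * (1 / fv q) ^ Suc j / q) has_contour_integral
      (P (pathfinish (circlepath 0 r)) - P (pathstart (circlepath 0 r)))) (circlepath 0 r)"
  proof (rule contour_integral_primitive[where S = "ball 0 1 - {0}"])
    fix q :: complex assume q: "q \<in> ball 0 1 - {0}"
    then have vn: "fv q \<noteq> 0" by simp
    have "((\<lambda>q. 1 / fv q) has_field_derivative - (fF q * fv q / q) / (fv q)\<^sup>2) (at q)"
      using fv_has_field_derivative[of q] q fv_deriv_eq[of q]
      by (auto intro!: derivative_eq_intros simp: power2_eq_square)
    from DERIV_cmult[OF DERIV_power[OF this, of "Suc j"], of "- (1 / of_nat (Suc j))"]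
    have "(P has_field_derivative - (1 / of_nat (Suc j)) * (of_nat (Suc j) * (- (fF q * fv q / q) / (fv q)\<^sup>2 * (1 / fv q) ^ j))) (at q)"
      by (simp add: P_def[abs_def] del: of_nat_Suc)
    moreover have "- (1 / of_nat (Suc j)) * (of_nat (Suc j) * (- (fF q * fv q / q) / (fv q)\<^sup>2 * (1 / fv q) ^ j))
        = fF q * (1 / fv q) ^ Suc j / q"
      using vn by (simp add: power2_eq_square del: of_nat_Suc)
    ultimately show "(P has_field_derivative fF q * (1 / fv q) ^ Suc j / q) (at q within ball 0 1 - {0})"
      by (auto intro: has_field_derivative_at_within)
  qed (use r in \<open>auto simp: path_image_circlepath\<close>)
  then have 0: "((\<lambda>q. fF q * (1 / fv q) ^ Suc j / q) has_contour_integral 0) (circlepath 0 r)" by simp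
  have "((\<lambda>q. fF q * (1 / fv q) ^ Suc j / q + x * (fF q * (1 / fv q) ^ j / (q * (1 - x * fv q))))
      has_contour_integral (0 + x * (2 * of_real pi * \<i> * x ^ j))) (circlepath 0 r)"
    by (rule has_contour_integral_add[OF 0 has_contour_integral_lmul[OF Suc.IH]])
  then have "((\<lambda>q. fF q * (1 / fv q) ^ Suc j / (q * (1 - x * fv q)))
      has_contour_integral (0 + x * (2 * of_real pi * \<i> * x ^ j))) (circlepath 0 r)"
  proof (rule has_contour_integral_eq)
    fix q assume "q \<in> path_image (circlepath 0 r)"
    then have q: "norm q = r" "q \<noteq> 0" using r by (auto simp: path_image_circlepath)
    then have *: "fv q \<noteq> 0" "1 - x * fv q \<noteq> 0" using nz[of q] by auto
    have "a * (1 / v) ^ Suc j / q + x * (a * (1 / v) ^ j / (q * (1 - x * v))) = a * (1 / v) ^ Suc j / (q * (1 - x * v))"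
      if "v \<noteq> 0" "1 - x * v \<noteq> 0" for a v
    proof -
      have "a * (1 / v) ^ Suc j / q + x * (a * (1 / v) ^ j / (q * (1 - x * v)))
          = (a * (1 / v) ^ j / q) * (1 / v + x / (1 - x * v))"
        by (simp add: ring_distribs mult_ac)
      also have "1 / v + x / (1 - x * v) = 1 / (v * (1 - x * v))"
        using that by (simp add: field_simps)
      finally show ?thesis by simp
    qed
    from this[OF *] show "fF q * (1 / fv q) ^ Suc j / q + x * (fF q * (1 / fv q) ^ j / (q * (1 - x * fv q))) =
        fF q * (1 / fv q) ^ Suc j / (q * (1 - x * fv q))" .
  qed
  then show ?case by (simp add: mult_ac)
qed

text \<open>Its residue at 0 as a function of \<open>q\<close> is the value at \<open>x\<close> of the Hauptmodul polynomial of the form; the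
  other poles are the solutions of \<open>1 / fv q = x\<close>.\<close>
definition form_kernel :: "int \<Rightarrow> int \<Rightarrow> nat \<Rightarrow> complex \<Rightarrow> complex \<Rightarrow> complex" where
  "form_kernel l n e x q = (fG q ^ 8) powi (- l) * fF q ^ (1 - e) / q ^ Suc (nat (n + l)) / (1 - x * fv q)"

context
  fixes l n :: int and e :: nat and c :: "nat \<Rightarrow> real" and w :: "complex \<Rightarrow> complex"
  assumes e: "e \<le> 1" and n: "n \<ge> - l" and w: "w holomorphic_on ball 0 1"
    and cw: "\<And>q. norm q < 1 \<Longrightarrow> q \<noteq> 0 \<Longrightarrow>
       fF q ^ e * hpoly c (nat (n + l)) (1 / fv q) = (fG q ^ 8) powi (- l) / q ^ nat (n + l) + q * w q"
begin

text \<open>Summing the previous integrals with the coefficients \<open>c\<close> produces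
  \<open>hpoly\<close>. Inserting the known expansion of \<open>fF q ^ e * hpoly\<close> removes
  these coefficients from the integrand; the holomorphic remainder \<open>w\<close> contributes 0 by
  Cauchy's theorem.\<close>

lemma kernel_residue_0:
  assumes r: "0 < r" "r < 1" and nz: "\<And>q. norm q \<le> r \<Longrightarrow> x * fv q \<noteq> 1"
  shows "(form_kernel l n e x has_contour_integral 2 * of_real pi * \<i> * hpoly c (nat (n + l)) x) (circlepath 0 r)"
proof -
  let ?N = "nat (n + l)"
  have 1: "((\<lambda>q. \<Sum>j\<le>?N. of_real (c j) * (fF q * (1 / fv q) ^ j / (q * (1 - x * fv q)))) has_contour_integral
       (\<Sum>j\<le>?N. of_real (c j) * (2 * of_real pi * \<i> * x ^ j))) (circlepath 0 r)"
    by (intro has_contour_integral_sum has_contour_integral_lmul hauptmodul_residue_power assms) auto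
  have 2: "((\<lambda>q. fF q ^ (1 - e) * w q / (1 - x * fv q)) has_contour_integral 0) (circlepath 0 r)"
  proof (rule Cauchy_theorem_convex_simple[where S = "cball 0 r"])
    show "(\<lambda>q. fF q ^ (1 - e) * w q / (1 - x * fv q)) holomorphic_on cball 0 r"
      using r nz by (intro holomorphic_intros holomorphic_on_subset[OF fF_holomorphic]
          holomorphic_on_subset[OF fv_holomorphic] holomorphic_on_subset[OF w]) force+
  qed (use r in \<open>auto simp: path_image_circlepath\<close>)
  have "(form_kernel l n e x has_contour_integral
      ((\<Sum>j\<le>?N. of_real (c j) * (2 * of_real pi * \<i> * x ^ j)) - 0)) (circlepath 0 r)"
  proof (rule has_contour_integral_eq[OF has_contour_integral_diff[OF 1 2]])
    fix q assume "q \<in> path_image (circlepath 0 r)"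
    then have q: "norm q < 1" "q \<noteq> 0" using r by (auto simp: path_image_circlepath)
    define D where "D = 1 - x * fv q"
    have "(\<Sum>j\<le>?N. of_real (c j) * (fF q * (1 / fv q) ^ j / (q * (1 - x * fv q)))) =
        fF q * hpoly c ?N (1 / fv q) / (q * D)"
      unfolding hpoly_def D_def sum_distrib_left sum_divide_distrib by (simp only: times_divide_eq_right mult_ac)
    also have "fF q * hpoly c ?N (1 / fv q) = fF q ^ (1 - e) * (fF q ^ e * hpoly c ?N (1 / fv q))"
    proof -
      have "fF q ^ (1 - e) * fF q ^ e = fF q" using e by (simp flip: power_add)
      then show ?thesis by (simp only: mult.assoc[symmetric])
    qed
    also have "\<dots> = fF q ^ (1 - e) * ((fG q ^ 8) powi (- l) / q ^ ?N + q * w q)"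
      by (simp only: cw[OF q])
    also have "\<dots> / (q * D) = (fG q ^ 8) powi (- l) * fF q ^ (1 - e) / q ^ Suc ?N / D + fF q ^ (1 - e) * w q / D"
      using q by (simp add: add_divide_distrib distrib_left mult_ac)
    finally show "(\<Sum>j\<le>?N. of_real (c j) * (fF q * (1 / fv q) ^ j / (q * (1 - x * fv q)))) -
        fF q ^ (1 - e) * w q / (1 - x * fv q) = form_kernel l n e x q"
      by (simp add: form_kernel_def D_def)
  qed
  also have "(\<Sum>j\<le>?N. of_real (c j) * (2 * of_real pi * \<i> * x ^ j)) - 0 = 2 * of_real pi * \<i> * hpoly c ?N x"
    unfolding hpoly_def sum_distrib_left by (simp add: mult_ac)
  finally show ?thesis .
qed

text \<open>At a solution of \<open>x * fv q = 1\<close> the derivative of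
  \<open>1 - x * fv q\<close> is \<open>- fF q / q\<close>. So \<open>fF q \<noteq> 0\<close> makes
  the denominator's zero simple, and the powers of \<open>fF\<close> combine to
  \<open>1 / fF q ^ e\<close>.\<close>

lemma kernel_residue_pole:
  assumes q: "norm q < 1" "x * fv q = 1" "fF q \<noteq> 0"
  shows "residue (form_kernel l n e x) q = - (fS q powi (- l) * q powi (- n) / fF q ^ e)"
proof -
  let ?N = "nat (n + l)"
  have q0: "q \<noteq> 0" using q by auto
  have "residue (\<lambda>q. ((fG q ^ 8) powi (- l) * fF q ^ (1 - e) / q ^ Suc ?N) / (1 - x * fv q)) q =
      ((fG q ^ 8) powi (- l) * fF q ^ (1 - e) / q ^ Suc ?N) / (- (x * (eA q ^ 24 * fF q)))"
  proof (rule residue_simple_pole_deriv[where s = "ball 0 1 - {0}"])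
    show "(\<lambda>q. (fG q ^ 8) powi (- l) * fF q ^ (1 - e) / q ^ Suc ?N) holomorphic_on ball 0 1 - {0}"
      "(\<lambda>q. 1 - x * fv q) holomorphic_on ball 0 1 - {0}"
      by (intro holomorphic_intros holomorphic_on_subset[OF fF_holomorphic] holomorphic_on_subset[OF fG_holomorphic]
          holomorphic_on_subset[OF fv_holomorphic]; force)+
    show "connected (ball (0::complex) 1 - {0})" by (rule connected_punctured_ball) auto
    show "((\<lambda>q. 1 - x * fv q) has_field_derivative - (x * (eA q ^ 24 * fF q))) (at q)"
      using fv_has_field_derivative[OF q(1)] by (auto intro!: derivative_eq_intros)
  qed (use q q0 in auto)
  also have "x * (eA q ^ 24 * fF q) = fF q / q"
    using q(2) unfolding fv_deriv_eq[OF q0] by (simp add: field_simps)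
  also have "((fG q ^ 8) powi (- l) * fF q ^ (1 - e) / q ^ Suc ?N) / (- (fF q / q)) =
      - ((fG q ^ 8) powi (- l) / q ^ ?N * (fF q ^ (1 - e) / fF q))"
    using q0 q(3) by simp
  also have "fF q ^ (1 - e) / fF q = 1 / fF q ^ e"
    using e q(3) by (cases e) auto
  also have "(fG q ^ 8) powi (- l) / q ^ ?N = fS q powi (- l) * q powi (- n)"
  proof -
    have "q ^ ?N = q powi (n + l)" using n by (simp add: power_int_def)
    then show ?thesis using q0
      by (simp add: fS_def power_int_mult_distrib power_int_minus power_int_add field_simps)
  qed
  finally show ?thesis by (simp add: form_kernel_def[abs_def])
qed

theorem kernel_formula:
  assumes \<rho>: "0 < \<rho>" "\<rho> < 1" and Z: "Z = {q. norm q < \<rho> \<and> x * fv q = 1}" "finite Z"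
    and F: "\<And>q. q \<in> Z \<Longrightarrow> fF q \<noteq> 0"
    and circ: "\<And>q. norm q = \<rho> \<Longrightarrow> x * fv q \<noteq> 1"
    and bound: "\<And>q. norm q = \<rho> \<Longrightarrow> norm (form_kernel l n e x q) \<le> B" "B \<ge> 0"
  shows "norm (hpoly c (nat (n + l)) x - (\<Sum>q\<in>Z. fS q powi (- l) * q powi (- n) / fF q ^ e)) \<le> B * \<rho>"
proof -
  let ?N = "nat (n + l)"
  have Z0: "0 \<notin> Z" by (auto simp: Z(1))
  \<comment> \<open>The residue theorem needs holomorphy beyond the circle. The solutions of
    \<open>x * fv q = 1\<close> in a closed annulus form a compact set that misses the circle, so
    the one nearest to it leaves a gap.\<close>
  obtain R where R: "\<rho> < R" "R < 1" "\<And>q. \<rho> \<le> norm q \<Longrightarrow> norm q < R \<Longrightarrow> x * fv q \<noteq> 1"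
  proof -
    define K where "K = cball (0::complex) ((1 + \<rho>) / 2) - ball 0 \<rho>"
    define Y where "Y = {q \<in> K. x * fv q = 1}"
    have "closed Y"
    proof -
      have "closed {q \<in> K. x * fv q = 1}"
        unfolding K_def
        by (intro continuous_closed_preimage_constant continuous_intros
            continuous_on_subset[OF holomorphic_on_imp_continuous_on[OF fv_holomorphic]] closed_Diff)
          (use \<rho> in \<open>auto simp: field_simps\<close>)
      then show ?thesis by (simp add: Y_def)
    qed
    then have cY: "compact Y"
      using compact_Int_closed[of "cball 0 ((1 + \<rho>) / 2)" Y] by (simp add: Y_def K_def Int_absorb1 subset_iff Int_def conj_ac cong: conj_cong)
    show ?thesis
    proof (cases "Y = {}")
      case True
      show ?thesis
      proof (rule that[of "(1 + \<rho>) / 2"])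
        fix q :: complex assume "\<rho> \<le> norm q" "norm q < (1 + \<rho>) / 2"
        then have "q \<in> K" by (auto simp: K_def)
        then show "x * fv q \<noteq> 1" using True by (auto simp: Y_def)
      qed (use \<rho> in auto)
    next
      case False
      have "continuous_on Y (norm :: complex \<Rightarrow> real)" by (intro continuous_intros)
      then obtain q0 where q0: "q0 \<in> Y" "\<And>q. q \<in> Y \<Longrightarrow> norm q0 \<le> norm q"
        using continuous_attains_inf[OF cY False, of norm] by auto
      show ?thesis
      proof (rule that[of "norm q0"])
        show "\<rho> < norm q0" using q0(1) circ[of q0] by (force simp: Y_def K_def)
        show "norm q0 < 1" using q0(1) \<rho> by (auto simp: Y_def K_def)
        fix q :: complex assume q: "\<rho> \<le> norm q" "norm q < norm q0"
        have "norm q0 \<le> (1 + \<rho>) / 2" using q0(1) by (auto simp: Y_def K_def)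
        then have "q \<in> K" using q by (auto simp: K_def)
        then show "x * fv q \<noteq> 1" using q0(2)[of q] q by (auto simp: Y_def)
      qed
    qed
  qed
  have hol: "form_kernel l n e x holomorphic_on ball 0 R - insert 0 Z"
  proof -
    have "1 - x * fv q \<noteq> 0" if "q \<in> ball 0 R - insert 0 Z" for q
      using that R(3)[of q] by (cases "norm q < \<rho>") (auto simp: Z(1))
    then show ?thesis
      unfolding form_kernel_def[abs_def] using R
      by (intro holomorphic_intros holomorphic_on_subset[OF fF_holomorphic] holomorphic_on_subset[OF fG_holomorphic]
          holomorphic_on_subset[OF fv_holomorphic]; force)
  qed
  have wn: "winding_number (circlepath 0 \<rho>) q = 1" if "q \<in> insert 0 Z" for q
    using that \<rho> by (intro winding_number_circlepath) (auto simp: Z(1))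
  have "contour_integral (circlepath 0 \<rho>) (form_kernel l n e x) =
      2 * pi * \<i> * (\<Sum>q\<in>insert 0 Z. winding_number (circlepath 0 \<rho>) q * residue (form_kernel l n e x) q)"
  proof (rule Residue_theorem[of "ball 0 R"])
    show "path_image (circlepath 0 \<rho>) \<subseteq> ball 0 R - insert 0 Z"
      using \<rho> R by (auto simp: path_image_circlepath Z(1))
    show "\<forall>z. z \<notin> ball 0 R \<longrightarrow> winding_number (circlepath 0 \<rho>) z = 0"
      using \<rho> R by (auto intro!: winding_number_zero_outside[of _ "cball 0 \<rho>"] simp: path_image_circlepath)
  qed (use hol Z(2) in auto)
  also have "(\<Sum>q\<in>insert 0 Z. winding_number (circlepath 0 \<rho>) q * residue (form_kernel l n e x) q) =
      residue (form_kernel l n e x) 0 + (\<Sum>q\<in>Z. residue (form_kernel l n e x) q)"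
    using Z0 Z(2) wn by (simp add: wn)
  also have "(\<Sum>q\<in>Z. residue (form_kernel l n e x) q) = - (\<Sum>q\<in>Z. fS q powi (- l) * q powi (- n) / fF q ^ e)"
    unfolding sum_negf[symmetric] using \<rho> F by (intro sum.cong refl kernel_residue_pole) (auto simp: Z(1))
  also have "residue (form_kernel l n e x) 0 = hpoly c ?N x"
  proof -
    \<comment> \<open>On a small circle around 0 no solution of \<open>x * fv q = 1\<close>
      interferes, and \<open>kernel_residue_0\<close> identifies the residue.\<close>
    have "isCont (\<lambda>q. x * fv q) 0"
      using fv_has_field_derivative[of 0] by (intro continuous_intros DERIV_isCont) auto
    then have "((\<lambda>q. x * fv q) \<longlongrightarrow> 0) (at 0)" by (simp add: isCont_def fv_def)
    then have "eventually (\<lambda>q. norm (x * fv q) < 1) (at 0)"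
      using tendstoD[of "\<lambda>q. x * fv q" 0 "at 0" 1] by simp
    then obtain d where d: "d > 0" "\<And>q. q \<noteq> 0 \<Longrightarrow> norm q < d \<Longrightarrow> norm (x * fv q) < 1"
      by (auto simp: eventually_at)
    define r where "r = min d \<rho> / 2"
    have r: "0 < r" "r < d" "r < \<rho>" using d(1) \<rho> by (auto simp: r_def min_def)
    have nz: "x * fv q \<noteq> 1" if "norm q \<le> r" for q
      using d(2)[of q] that r by (cases "q = 0") auto
    have "(form_kernel l n e x has_contour_integral 2 * pi * \<i> * residue (form_kernel l n e x) 0) (circlepath 0 r)"
    proof (rule base_residue)
      show "form_kernel l n e x holomorphic_on ball 0 R - Z - {0}" using hol by (rule holomorphic_on_subset) auto
      show "cball 0 r \<subseteq> ball 0 R - Z" using nz r R by (auto simp: Z(1))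
      show "open (ball 0 R - Z)" using Z(2) by (intro open_Diff finite_imp_closed) auto
    qed (use r \<rho> R Z0 in auto)
    moreover have "(form_kernel l n e x has_contour_integral 2 * of_real pi * \<i> * hpoly c ?N x) (circlepath 0 r)"
      using r \<rho> nz by (intro kernel_residue_0) auto
    ultimately show ?thesis using has_contour_integral_unique by fastforce
  qed
  finally have I: "contour_integral (circlepath 0 \<rho>) (form_kernel l n e x) =
     2 * pi * \<i> * (hpoly c ?N x - (\<Sum>q\<in>Z. fS q powi (- l) * q powi (- n) / fF q ^ e))" by simp
  have "form_kernel l n e x contour_integrable_on circlepath 0 \<rho>"
  proof (rule contour_integrable_continuous_circlepath)
    show "continuous_on (path_image (circlepath 0 \<rho>)) (form_kernel l n e x)"
      by (rule holomorphic_on_imp_continuous_on, rule holomorphic_on_subset[OF hol])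
        (use \<rho> R in \<open>auto simp: path_image_circlepath Z(1)\<close>)
  qed
  then have "(form_kernel l n e x has_contour_integral contour_integral (circlepath 0 \<rho>) (form_kernel l n e x)) (circlepath 0 \<rho>)"
    by (rule has_contour_integral_integral)
  then have "norm (contour_integral (circlepath 0 \<rho>) (form_kernel l n e x)) \<le> B * (2 * pi * \<rho>)"
    by (rule has_contour_integral_bound_circlepath) (use bound \<rho> in auto)
  then show ?thesis unfolding I by (simp add: norm_mult)
qed

end

section \<open>Poles of the kernel inside the circle\<close>

text \<open>A holomorphic logarithm of \<open>fv (ee \<tau>)\<close> on the whole upper half plane,
  whose imaginary part records the winding that the principal branch loses.\<close>

definition logv :: "complex \<Rightarrow> complex" where
  "logv \<tau> = 2 * of_real pi * \<i> * \<tau> + 24 * qlog (- ee \<tau>) (ee \<tau>)"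

lemma exp_logv: "exp (logv \<tau>) = fv (ee \<tau>)"
proof -
  have "exp (24 * qlog (- ee \<tau>) (ee \<tau>)) = exp (of_nat 24 * qlog (- ee \<tau>) (ee \<tau>))" by simp
  then show ?thesis
    unfolding logv_def exp_add exp_of_nat_mult by (simp add: fv_def ee_def eA_def qpoch_def exp_of_nat_mult[symmetric])
qed

lemma logv_has_field_derivative:
  assumes "Im \<tau> > 0"
  shows "(logv has_field_derivative 2 * of_real pi * \<i> * fF (ee \<tau>)) (at \<tau>)"
proof -
  define q where "q = ee \<tau>"
  have q: "norm q < 1" unfolding q_def by (rule norm_ee_less_1[OF assms])
  have "(\<lambda>q. qlog (- q) q) holomorphic_on ball 0 1"
    by (intro qlog_holomorphic holomorphic_intros) auto
  from holomorphic_derivI[OF this open_ball, of q]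
  obtain D where D: "((\<lambda>q. qlog (- q) q) has_field_derivative D) (at q)"
    using q by auto
  have "(eA has_field_derivative eA q * D) (at q)"
    unfolding eA_def[abs_def] qpoch_def using D by (auto intro!: derivative_eq_intros)
  then have F: "fF q = 1 + 24 * q * D" by (simp add: fF_def DERIV_imp_deriv)
  have "(ee has_field_derivative q * (2 * of_real pi * \<i>)) (at \<tau>)"
    unfolding ee_def[abs_def] q_def by (rule derivative_eq_intros refl | simp)+
  then have "((\<lambda>\<tau>. qlog (- ee \<tau>) (ee \<tau>)) has_field_derivative D * (q * (2 * of_real pi * \<i>))) (at \<tau>)"
    using DERIV_chain2[of "\<lambda>q. qlog (- q) q" D ee \<tau>] D by (simp add: q_def)
  then have "(logv has_field_derivative 2 * of_real pi * \<i> * 1 + 24 * (D * (q * (2 * of_real pi * \<i>)))) (at \<tau>)"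
    unfolding logv_def[abs_def] by (intro DERIV_add DERIV_cmult DERIV_ident)
  moreover have "2 * of_real pi * \<i> * 1 + 24 * (D * (q * (2 * of_real pi * \<i>))) = 2 * of_real pi * \<i> * fF q"
    unfolding F by (simp add: algebra_simps)
  ultimately show ?thesis by (simp only: q_def)
qed

lemma logv_cnj: "Im \<tau> > 0 \<Longrightarrow> logv (- cnj \<tau>) = cnj (logv \<tau>)"
  using qlog_cnj[of "- ee \<tau>" "ee \<tau>"] norm_ee_less_1[of \<tau>] by (simp add: logv_def ee_cnj)

text \<open>The derivative of the sum vanishes by \<open>fricke_fF\<close>. The constant is read off
  at the fixed point of the involution, where the reflection symmetry makes \<open>logv\<close> real
  and excludes an additional multiple of 2\<pi>i.\<close>

lemma logv_fricke:
  assumes "Im \<tau> > 0"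
  shows "logv \<tau> + logv (- 1 / (2 * \<tau>)) = - of_real (ln 4096)"
proof -
  define D where "D \<tau> = logv \<tau> + logv (- 1 / (2 * \<tau>))" for \<tau>
  have d: "(D has_field_derivative 0) (at \<tau> within upper_half_plane)" if "\<tau> \<in> upper_half_plane" for \<tau>
  proof -
    have t: "Im \<tau> > 0" "\<tau> \<noteq> 0" using that by (auto simp: uhp_iff)
    have dw: "((\<lambda>\<tau>. - 1 / (2 * \<tau>)) has_field_derivative 1 / (2 * \<tau>\<^sup>2)) (at \<tau>)"
      using t by (auto intro!: derivative_eq_intros simp: power2_eq_square field_simps)
    have "(D has_field_derivative 2 * of_real pi * \<i> * fF (ee \<tau>) +
        2 * of_real pi * \<i> * fF (ee (- 1 / (2 * \<tau>))) * (1 / (2 * \<tau>\<^sup>2))) (at \<tau>)"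
      unfolding D_def[abs_def]
      by (intro DERIV_add logv_has_field_derivative t DERIV_chain2[OF logv_has_field_derivative dw] Im_fricke_pos)
    moreover have "2 * of_real pi * \<i> * fF (ee \<tau>) +
        2 * of_real pi * \<i> * fF (ee (- 1 / (2 * \<tau>))) * (1 / (2 * \<tau>\<^sup>2)) = 0"
      unfolding fricke_fF[OF t(1)] using t(2) by simp
    ultimately show ?thesis by (simp add: has_field_derivative_at_within)
  qed
  have "convex upper_half_plane" unfolding upper_half_plane_def by (rule convex_halfspace_Im_gt)
  from has_field_derivative_zero_constant[OF this d]
  obtain k where k: "\<And>\<tau>. Im \<tau> > 0 \<Longrightarrow> D \<tau> = k" by (auto simp: uhp_iff)
  define t0 where "t0 = of_real (1 / sqrt 2) * \<i>"
  have t0: "Im t0 > 0" "- 1 / (2 * t0) = t0" "- cnj t0 = t0"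
    by (simp_all add: t0_def complex_eq_iff Re_divide Im_divide power2_eq_square)
  have D0: "D t0 = 2 * logv t0" unfolding D_def t0(2) by simp
  have "logv t0 \<in> \<real>" using logv_cnj[OF t0(1)] by (simp add: t0(3) Reals_cnj_iff)
  then obtain y where y: "logv t0 = of_real y" by (auto elim: Reals_cases)
  have "fv (ee t0) * fv (ee t0) = 1 / 4096"
    using fricke_fv[OF t0(1)] unfolding t0(2) by (simp add: mult_ac)
  moreover have "exp (2 * logv t0) = fv (ee t0) * fv (ee t0)"
    unfolding mult_2 exp_add exp_logv ..
  moreover have "exp (2 * logv t0) = complex_of_real (exp (2 * y))"
    by (simp add: y flip: exp_of_real)
  ultimately have "complex_of_real (exp (2 * y)) = complex_of_real (1 / 4096)" by simp
  then have "exp (2 * y) = 1 / 4096" by (simp only: of_real_eq_iff)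
  then have "2 * y = ln (1 / 4096)" by (metis ln_exp)
  then have "2 * y = - ln 4096" by (simp add: ln_div)
  moreover have "D t0 = of_real (2 * y)" unfolding D0 y by simp
  ultimately have "D t0 = - of_real (ln 4096)" by simp
  then show ?thesis using k[OF assms] k[OF t0(1)] by (simp add: D_def)
qed

text \<open>The product is evaluated at the Fricke image, whose imaginary part is larger as soon as
  the squared norm of \<tau> is below 1/2. The linear term of \<open>logv\<close> there gives the
  main term, the q-product the error.\<close>

lemma Im_logv_bound:
  assumes "Im \<tau> > 0"
  defines "s \<equiv> exp (- pi * Im \<tau> / (norm \<tau>)\<^sup>2)"
  shows "\<bar>Im (logv \<tau>) - pi * Re \<tau> / (norm \<tau>)\<^sup>2\<bar> \<le> 24 * (s / (1 - s)\<^sup>2)"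
proof -
  define u where "u = - 1 / (2 * \<tau>)"
  have u: "Im u > 0" unfolding u_def by (rule Im_fricke_pos[OF assms(1)])
  have ur: "Re u = - Re \<tau> / (2 * (norm \<tau>)\<^sup>2)" and ui: "Im u = Im \<tau> / (2 * (norm \<tau>)\<^sup>2)"
    unfolding u_def by (rule Re_fricke, rule Im_fricke)
  have s: "norm (ee u) = s" by (simp add: norm_ee ui s_def)
  have "logv \<tau> = - of_real (ln 4096) - logv u" using logv_fricke[OF assms(1)] by (simp add: u_def algebra_simps)
  then have "Im (logv \<tau>) = - Im (logv u)" by simp
  also have "\<dots> = - 2 * pi * Re u - 24 * Im (qlog (- ee u) (ee u))" by (simp add: logv_def)
  also have "- 2 * pi * Re u = pi * Re \<tau> / (norm \<tau>)\<^sup>2" by (simp add: ur)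
  finally have "\<bar>Im (logv \<tau>) - pi * Re \<tau> / (norm \<tau>)\<^sup>2\<bar> = 24 * \<bar>Im (qlog (- ee u) (ee u))\<bar>" by simp
  also have "\<bar>Im (qlog (- ee u) (ee u))\<bar> \<le> norm (qlog (- ee u) (ee u))" by (rule abs_Im_le_cmod)
  also have "\<dots> \<le> s / ((1 - s) * (1 - s))"
    using norm_qlog_le[of "- ee u" "ee u"] norm_ee_less_1[OF u] by (simp add: s)
  finally show ?thesis by (simp add: power2_eq_square)
qed

text \<open>The argument principle. The argument of \<open>1 - x * fv\<close> on the circle is followed through \<open>logv\<close> near the
  positive real axis and through the principal logarithm elsewhere; \<open>Im_d\<close> leaves a winding number of at most 2.\<close>
lemma zero_count:
  fixes x h d :: real and q1 q2 :: complex
  assumes x: "x < 0" and h: "h > 0" and d: "0 < d" "d < 1/2"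
    and \<rho>: "\<rho> = exp (- 2 * pi * h)"
    and small: "\<And>t. \<bar>t\<bar> \<le> d \<Longrightarrow> norm (of_real x * fv (ee (of_real t + of_real h * \<i>))) > 1"
    and slit: "\<And>t. d \<le> t \<Longrightarrow> t \<le> 1 - d \<Longrightarrow> 1 - of_real x * fv (ee (of_real t + of_real h * \<i>)) \<notin> \<real>\<^sub>\<le>\<^sub>0"
    and Re_d: "Re (1 - of_real x * fv (ee (of_real d + of_real h * \<i>))) > 0"
    and Im_d: "Im (logv (of_real d + of_real h * \<i>)) +
       Im (Ln (1 - 1 / (of_real x * fv (ee (of_real d + of_real h * \<i>))))) < 5/2 * pi"
    and q: "q1 \<noteq> q2" "norm q1 < \<rho>" "norm q2 < \<rho>" "of_real x * fv q1 = 1" "of_real x * fv q2 = 1"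
  shows "{q. norm q < \<rho> \<and> of_real x * fv q = 1} = {q1, q2}" "fF q1 \<noteq> 0" "fF q2 \<noteq> 0"
proof -
  define V where "V s = fv (ee (s + of_real h * \<i>))" for s
  define g where "g q = 1 - of_real x * fv q" for q
  define D where "D s = - (of_real x * (2 * of_real pi * \<i> * V s * fF (ee (s + of_real h * \<i>)))) / (1 - of_real x * V s)" for s
  have \<rho>01: "0 < \<rho>" "\<rho> < 1" using h by (auto simp: \<rho>)
  have Vper: "V (s + 1) = V s" for s by (simp add: V_def ee_add)
  have Vnz: "V s \<noteq> 0" for s by (simp add: V_def)
  have Vcnj: "V (of_real (- t)) = cnj (V (of_real t))" for t
  proof -
    have "ee (of_real (- t) + of_real h * \<i>) = cnj (ee (of_real t + of_real h * \<i>))"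
      unfolding ee_cnj[symmetric] by simp
    moreover have "norm (ee (of_real t + of_real h * \<i>)) < 1" using h by (intro norm_ee_less_1) simp
    ultimately show ?thesis unfolding V_def by (simp add: fv_cnj)
  qed
  have dV: "(V has_field_derivative 2 * of_real pi * \<i> * V s * fF (ee (s + of_real h * \<i>))) (at s)" if "Im s = 0" for s
    unfolding V_def[abs_def]
    using fv_ee_has_field_derivative[of "s + of_real h * \<i>"] that h by (simp add: DERIV_shift)
  \<comment> \<open>Up to the constant \<open>Ln (- x)\<close>, \<open>A1\<close> and
    \<open>A2\<close> are two logarithms of \<open>1 - x * V s\<close>: the first factors out the
    dominating \<open>x * V s\<close> near the positive real axis. Both are primitives of the same
    integrand \<open>D\<close>.\<close>
  define A1 where "A1 s = logv (s + of_real h * \<i>) + Ln (1 - 1 / (of_real x * V s))" for s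
  define A2 where "A2 s = Ln (1 - of_real x * V s)" for s
  have A1: "(A1 has_field_derivative D (of_real t)) (at (of_real t))" if "norm (of_real x * V (of_real t)) > 1" for t :: real
  proof -
    let ?v = "V (of_real t)"
    let ?F = "fF (ee (of_real t + of_real h * \<i>))"
    have xv: "of_real x * ?v \<noteq> 0" "of_real x * ?v \<noteq> 1" using that by auto
    have "norm (1 / (of_real x * ?v)) < 1" using that unfolding norm_divide by (subst divide_less_eq_1_pos) auto
    then have "Re (1 - 1 / (of_real x * ?v)) > 0"
      using complex_Re_le_cmod[of "1 / (of_real x * ?v)"] by (simp only: minus_complex.sel one_complex.sel)
    then have sl: "1 - 1 / (of_real x * ?v) \<notin> \<real>\<^sub>\<le>\<^sub>0" by (auto simp: complex_nonpos_Reals_iff simp del: minus_complex.sel)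
    have 1: "((\<lambda>s. logv (s + of_real h * \<i>)) has_field_derivative 2 * of_real pi * \<i> * ?F) (at (of_real t))"
      using logv_has_field_derivative[of "of_real t + of_real h * \<i>"] h by (simp add: DERIV_shift)
    have 2: "((\<lambda>s. 1 - 1 / (of_real x * V s)) has_field_derivative
        (of_real x * (2 * of_real pi * \<i> * ?v * ?F)) / (of_real x * ?v)\<^sup>2) (at (of_real t))"
      using dV[of "of_real t"] x Vnz by (auto intro!: derivative_eq_intros simp: power2_eq_square)
    have "(A1 has_field_derivative 2 * of_real pi * \<i> * ?F +
        1 / (1 - 1 / (of_real x * ?v)) * ((of_real x * (2 * of_real pi * \<i> * ?v * ?F)) / (of_real x * ?v)\<^sup>2)) (at (of_real t))"
      unfolding A1_def[abs_def]
      using DERIV_add[OF 1 DERIV_chain2[OF has_field_derivative_Ln[OF sl] 2]] by (simp add: inverse_eq_divide)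
    moreover have "a + 1 / (1 - 1 / (X * v)) * ((X * (a * v)) / (X * v)\<^sup>2) = - (X * (a * v)) / (1 - X * v)"
      if "X * v \<noteq> 0" "X * v \<noteq> 1" for a X v :: complex
    proof -
      have n: "X * v - 1 \<noteq> 0" "1 - X * v \<noteq> 0" using that by auto
      have "1 - 1 / (X * v) = (X * v - 1) / (X * v)" using that by (simp add: field_simps)
      then have "1 / (1 - 1 / (X * v)) * ((X * (a * v)) / (X * v)\<^sup>2) = a / (X * v - 1)"
        using that n by (simp add: power2_eq_square field_simps)
      moreover have "a + a / (X * v - 1) = - (X * (a * v)) / (1 - X * v)" using n by (simp add: field_simps)
      ultimately show ?thesis by simp
    qed
    from this[OF xv, of "2 * of_real pi * \<i> * ?F"]
    have "2 * of_real pi * \<i> * ?F + 1 / (1 - 1 / (of_real x * ?v)) * ((of_real x * (2 * of_real pi * \<i> * ?v * ?F)) / (of_real x * ?v)\<^sup>2)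
        = D (of_real t)" by (simp add: D_def mult_ac)
    ultimately show ?thesis by simp
  qed
  have A2: "(A2 has_field_derivative D (of_real t)) (at (of_real t))" if "1 - of_real x * V (of_real t) \<notin> \<real>\<^sub>\<le>\<^sub>0" for t :: real
  proof -
    have "((\<lambda>s. 1 - of_real x * V s) has_field_derivative
       - (of_real x * (2 * of_real pi * \<i> * V (of_real t) * fF (ee (of_real t + of_real h * \<i>))))) (at (of_real t))"
      using dV[of "of_real t"] by (auto intro!: derivative_eq_intros)
    from DERIV_chain2[OF has_field_derivative_Ln[OF that] this]
    show ?thesis by (simp add: A2_def[abs_def] D_def divide_inverse mult.commute)
  qed
  have small1: "norm (of_real x * V (of_real t)) > 1" if "t \<in> {0..d} \<or> t \<in> {1 - d..1}" for t
    using that small[of t] small[of "t - 1"] Vper[of "of_real (t - 1)"] by (auto simp: V_def)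
  have i1: "((\<lambda>t. D (of_real t)) has_integral (A1 (of_real d) - A1 (of_real 0))) {0..d}"
    by (intro fundamental_theorem_of_calculus has_vector_derivative_real_field A1 small1) (use d in auto)
  have i2: "((\<lambda>t. D (of_real t)) has_integral (A2 (of_real (1 - d)) - A2 (of_real d))) {d..1 - d}"
    by (intro fundamental_theorem_of_calculus has_vector_derivative_real_field A2) (use d slit in \<open>auto simp: V_def\<close>)
  have i3: "((\<lambda>t. D (of_real t)) has_integral (A1 (of_real 1) - A1 (of_real (1 - d)))) {1 - d..1}"
    by (intro fundamental_theorem_of_calculus has_vector_derivative_real_field A1 small1) (use d in auto)
  define J where "J = (A1 (of_real d) - A1 (of_real 0)) + ((A2 (of_real (1 - d)) - A2 (of_real d)) + (A1 (of_real 1) - A1 (of_real (1 - d))))"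
  have "((\<lambda>t. D (of_real t)) has_integral ((A2 (of_real (1 - d)) - A2 (of_real d)) + (A1 (of_real 1) - A1 (of_real (1 - d))))) {d..1}"
    using d by (intro has_integral_combine[OF _ _ i2 i3]) auto
  then have DJ: "((\<lambda>t. D (of_real t)) has_integral J) {0..1}"
    unfolding J_def using d by (intro has_integral_combine[OF _ _ i1]) auto
  have g': "(g has_field_derivative - (of_real x * (eA q ^ 24 * fF q))) (at q)" if "norm q < 1" for q
    unfolding g_def[abs_def] using fv_has_field_derivative[OF that] by (auto intro!: derivative_eq_intros)
  have circ: "circlepath 0 \<rho> t = ee (of_real t + of_real h * \<i>)" for t
  proof -
    have "2 * complex_of_real pi * \<i> * (of_real t + of_real h * \<i>) = of_real (- 2 * pi * h) + 2 * of_real pi * \<i> * of_real t"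
      by (simp add: algebra_simps)
    moreover have "circlepath 0 \<rho> t = exp (of_real (- 2 * pi * h)) * exp (2 * of_real pi * \<i> * of_real t)"
      by (simp add: circlepath \<rho> flip: exp_of_real)
    ultimately show ?thesis by (simp only: ee_def exp_add)
  qed
  have gJ: "((\<lambda>q. deriv g q / g q) has_contour_integral J) (circlepath 0 \<rho>)"
    unfolding has_contour_integral_def
  proof (rule has_integral_eq[OF _ DJ])
    fix t :: real assume t: "t \<in> {0..1}"
    let ?q = "ee (of_real t + of_real h * \<i>)"
    have nq: "norm ?q < 1" using h by (intro norm_ee_less_1) simp
    have vd: "vector_derivative (circlepath 0 \<rho>) (at t within {0..1}) = 2 * pi * \<i> * ?q"
      using t unfolding circ[symmetric] by (subst vector_derivative_circlepath01) (auto simp: circlepath)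
    have "deriv g ?q = - (of_real x * (eA ?q ^ 24 * fF ?q))" using g'[OF nq] by (rule DERIV_imp_deriv)
    then show "D (of_real t) = deriv g (circlepath 0 \<rho> t) / g (circlepath 0 \<rho> t) * vector_derivative (circlepath 0 \<rho>) (at t within {0..1})"
      unfolding circ vd D_def g_def V_def by (simp add: fv_def mult_ac)
  qed
  have ghol: "g holomorphic_on ball 0 1"
    unfolding g_def[abs_def] by (intro holomorphic_intros fv_holomorphic)
  define S where "S = ball (0::complex) ((1 + \<rho>) / 2)"
  have S1: "S \<subseteq> ball 0 1" "cball 0 ((1 + \<rho>) / 2) \<subseteq> ball (0::complex) 1" using \<rho>01 by (auto simp: S_def)
  have nc: "\<not> g constant_on ball 0 1"
  proof
    assume "g constant_on ball 0 1"
    moreover have "0 \<in> ball (0::complex) 1" "q1 \<in> ball 0 1" using q \<rho>01 by auto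
    ultimately have "g 0 = g q1" by (metis constant_on_def)
    then show False using q by (simp add: g_def)
  qed
  have fin: "finite {w \<in> S. g w = 0 \<or> w \<in> {}}"
    by (rule finite_subset[OF _ holomorphic_compact_finite_zeros[OF ghol _ _ compact_cball S1(2) nc]])
      (auto simp: S_def)
  have circnz: "g w \<noteq> 0" if w: "norm w = \<rho>" for w
  proof -
    have "w \<in> path_image (circlepath 0 \<rho>)" using w \<rho>01 by (simp add: path_image_circlepath)
    then obtain t where t: "t \<in> {0..1}" "w = ee (of_real t + of_real h * \<i>)" by (auto simp: path_image_def circ)
    consider "t \<in> {0..d} \<or> t \<in> {1 - d..1}" | "d \<le> t" "t \<le> 1 - d" using t(1) by fastforce
    then show ?thesis
    proof cases
      case 1
      then show ?thesis using small1[of t] t(2) by (auto simp: g_def V_def)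
    next
      case 2
      then have "1 - of_real x * fv w \<notin> \<real>\<^sub>\<le>\<^sub>0" using slit[of t] t(2) by simp
      then show ?thesis by (auto simp: g_def)
    qed
  qed
  define Z where "Z = {q. norm q < \<rho> \<and> of_real x * fv q = 1}"
  have ZS: "Z \<subseteq> {w \<in> S. g w = 0 \<or> w \<in> {}}" using \<rho>01 by (auto simp: Z_def S_def g_def)
  have "contour_integral (circlepath 0 \<rho>) (\<lambda>q. deriv g q * 1 / g q) =
     2 * pi * \<i> * (\<Sum>p\<in>{w \<in> S. g w = 0 \<or> w \<in> {}}. winding_number (circlepath 0 \<rho>) p * 1 * zorder g p)"
  proof (rule argument_principle)
    show "g holomorphic_on S - {}" using holomorphic_on_subset[OF ghol S1(1)] by simp
    show "path_image (circlepath 0 \<rho>) \<subseteq> S - {w \<in> S. g w = 0 \<or> w \<in> {}}"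
      using \<rho>01 circnz by (auto simp: path_image_circlepath S_def)
    show "\<forall>z. z \<notin> S \<longrightarrow> winding_number (circlepath 0 \<rho>) z = 0"
      using \<rho>01 by (auto intro!: winding_number_zero_outside[of _ "cball 0 \<rho>"] simp: path_image_circlepath S_def)
  qed (use fin in \<open>auto simp: S_def\<close>)
  also have "(\<Sum>p\<in>{w \<in> S. g w = 0 \<or> w \<in> {}}. winding_number (circlepath 0 \<rho>) p * 1 * zorder g p) =
      (\<Sum>p\<in>Z. of_int (zorder g p))"
  proof (rule sum.mono_neutral_cong_right[OF fin ZS])
    show "\<forall>i\<in>{w \<in> S. g w = 0 \<or> w \<in> {}} - Z. winding_number (circlepath 0 \<rho>) i * 1 * zorder g i = 0"
    proof
      fix i assume i: "i \<in> {w \<in> S. g w = 0 \<or> w \<in> {}} - Z"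
      then have "norm i > \<rho>" using circnz[of i] by (force simp: Z_def g_def)
      then have "winding_number (circlepath 0 \<rho>) i = 0"
        using \<rho>01 by (intro winding_number_zero_outside[of _ "cball 0 \<rho>"]) (auto simp: path_image_circlepath)
      then show "winding_number (circlepath 0 \<rho>) i * 1 * zorder g i = 0" by simp
    qed
    show "winding_number (circlepath 0 \<rho>) i * 1 * zorder g i = of_int (zorder g i)" if "i \<in> Z" for i
      using that by (subst winding_number_circlepath) (auto simp: Z_def)
  qed
  finally have J: "J = 2 * pi * \<i> * of_int (\<Sum>p\<in>Z. zorder g p)"
    using contour_integral_unique[OF gJ] by simp
  have zpos: "zorder g p \<ge> 1 \<and> (zorder g p = 1 \<longrightarrow> fF p \<noteq> 0)" if "p \<in> Z" for p
  proof -
    have p: "p \<in> ball 0 1" "g p = 0" using that \<rho>01 by (auto simp: Z_def g_def)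
    have "(if g p = 0 then zorder g p > 0 else zorder g p = 0) \<and>
       (\<exists>r. r > 0 \<and> cball p r \<subseteq> ball 0 1 \<and> zor_poly g p holomorphic_on cball p r
        \<and> (\<forall>w\<in>cball p r. g w = zor_poly g p w * (w - p) ^ nat (zorder g p) \<and> zor_poly g p w \<noteq> 0))"
      by (rule zorder_exist_zero[OF ghol _ _ p(1)]) (auto simp: g_def intro!: bexI[of _ 0])
    then obtain r where r: "zorder g p > 0" "r > 0" "cball p r \<subseteq> ball 0 1" "zor_poly g p holomorphic_on cball p r"
      "\<And>w. w \<in> cball p r \<Longrightarrow> g w = zor_poly g p w * (w - p) ^ nat (zorder g p) \<and> zor_poly g p w \<noteq> 0"
      using p(2) by auto
    have "fF p \<noteq> 0" if z1: "zorder g p = 1"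
    proof
      assume F0: "fF p = 0"
      have "zor_poly g p holomorphic_on ball p r" using r(4) by (rule holomorphic_on_subset) auto
      from holomorphic_derivI[OF this open_ball, of p]
      obtain E where E: "(zor_poly g p has_field_derivative E) (at p)"
        using r(2) by auto
      have "((\<lambda>w. zor_poly g p w * (w - p)) has_field_derivative zor_poly g p p) (at p)"
        using E by (auto intro!: derivative_eq_intros)
      then have "(g has_field_derivative zor_poly g p p) (at p)"
        by (rule has_field_derivative_transform_within_open[where S = "ball p r"]) (use r z1 in auto)
      moreover have "(g has_field_derivative 0) (at p)" using g'[of p] p(1) F0 by simp
      ultimately have "zor_poly g p p = 0" by (rule DERIV_unique)
      then show False using r(5)[of p] r(2) by simp
    qed
    then show ?thesis using r(1) by auto
  qed
  have finZ: "finite Z" by (rule finite_subset[OF ZS fin])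
  \<comment> \<open>By reflection, half of \<open>Im J\<close> is the sum of the three arguments at
    \<open>d\<close>, which \<open>Im_d\<close> and \<open>Re_d\<close> keep below
    \<open>5/2 * pi + pi / 2\<close>. Two distinct zeros have total order at least 2, so they are
    simple and there is no other.\<close>
  have "(\<Sum>p\<in>Z. zorder g p) < 3"
  proof -
    let ?t = "of_real d + of_real h * \<i>"
    have V1d: "V (of_real (1 - d)) = cnj (V (of_real d))"
      using Vper[of "of_real (- d)"] Vcnj[of d] by (simp add: add.commute)
    have ldd: "logv (of_real (1 - d) + of_real h * \<i>) = 2 * of_real pi * \<i> + cnj (logv ?t)"
    proof -
      have "logv (s + 1) = logv s + 2 * of_real pi * \<i>" for s by (simp add: logv_def ee_add algebra_simps)
      from this[of "- cnj ?t"] show ?thesis using logv_cnj[of ?t] h by (simp add: algebra_simps)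
    qed
    have l01: "A1 (of_real 1) - A1 (of_real 0) = 2 * of_real pi * \<i>"
    proof -
      have "logv (s + 1) = logv s + 2 * of_real pi * \<i>" for s by (simp add: logv_def ee_add algebra_simps)
      from this[of "of_real h * \<i>"] show ?thesis using Vper[of 0] by (simp add: A1_def add.commute)
    qed
    let ?L = "Ln (1 - 1 / (of_real x * V (of_real d)))"
    let ?M = "Ln (1 - of_real x * V (of_real d))"
    have L: "Ln (1 - 1 / (of_real x * V (of_real (1 - d)))) = cnj ?L"
    proof -
      have "norm (1 / (of_real x * V (of_real d))) < 1" using small1[of d] d unfolding norm_divide by (subst divide_less_eq_1_pos) auto
      then have "Re (1 - 1 / (of_real x * V (of_real d))) > 0"
        using complex_Re_le_cmod[of "1 / (of_real x * V (of_real d))"] by (simp only: minus_complex.sel one_complex.sel)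
      then have "1 - 1 / (of_real x * V (of_real d)) \<notin> \<real>\<^sub>\<le>\<^sub>0" by (auto simp: complex_nonpos_Reals_iff simp del: minus_complex.sel)
      then show ?thesis unfolding V1d by (subst cnj_Ln) simp_all
    qed
    have M: "Ln (1 - of_real x * V (of_real (1 - d))) = cnj ?M"
      using slit[of d] d unfolding V1d by (subst cnj_Ln) (simp_all add: V_def)
    have "J = (A1 (of_real d) - A1 (of_real (1 - d))) + (A2 (of_real (1 - d)) - A2 (of_real d)) + (A1 (of_real 1) - A1 (of_real 0))"
      by (simp add: J_def)
    also have "\<dots> = (logv ?t - cnj (logv ?t)) + (?L - cnj ?L) - (?M - cnj ?M)"
      unfolding l01 unfolding A1_def A2_def L M ldd by simp
    finally have 1: "Im J = 2 * (Im (logv ?t) + Im ?L - Im ?M)" by simp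
    define K where "K = pi * of_int (\<Sum>p\<in>Z. zorder g p)"
    have 2: "Im J = 2 * K" unfolding J K_def by simp
    have 3: "- Im ?M < pi / 2"
    proof -
      have "0 < Re (1 - of_real x * V (of_real d))" using Re_d by (simp add: V_def)
      moreover from this have "1 - of_real x * V (of_real d) \<noteq> 0" by (metis less_irrefl zero_complex.sel(1))
      ultimately have "\<bar>Im ?M\<bar> < pi / 2" using Re_Ln_pos_lt by blast
      then show ?thesis by (simp add: abs_less_iff)
    qed
    have 4: "Im (logv ?t) + Im ?L < 5/2 * pi" using Im_d by (simp add: V_def)
    have "k < pi * 3" if "j = 2 * (a + b - m)" "j = 2 * k" "- m < pi / 2" "a + b < 5/2 * pi" for a b m j k
    proof -
      have "k = a + b - m" using that(1,2) by simp
      then show ?thesis using that(3,4) by (simp add: field_simps)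
    qed
    from this[OF 1 2 3 4] have "K < pi * 3" .
    then have "pi * of_int (\<Sum>p\<in>Z. zorder g p) < pi * 3" by (simp only: K_def)
    then have "real_of_int (\<Sum>p\<in>Z. zorder g p) < 3" using pi_gt_zero mult_less_cancel_left_pos by blast
    then show ?thesis by linarith
  qed
  moreover have qZ: "q1 \<in> Z" "q2 \<in> Z" using q by (auto simp: Z_def)
  moreover have "(\<Sum>p\<in>Z. zorder g p) = (\<Sum>p\<in>Z - {q1, q2}. zorder g p) + (zorder g q1 + zorder g q2)"
    using sum.subset_diff[of "{q1, q2}" Z "zorder g"] finZ qZ q(1) by auto
  moreover have "(\<Sum>p\<in>Z - {q1, q2}. zorder g p) \<ge> int (card (Z - {q1, q2}))"
    using sum_bounded_below[of "Z - {q1, q2}" 1 "zorder g"] zpos by auto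
  ultimately have c: "card (Z - {q1, q2}) = 0" and z12: "zorder g q1 = 1" "zorder g q2 = 1"
    using zpos[of q1] zpos[of q2] by linarith+
  have "Z = {q1, q2}" using c finZ qZ by auto
  then show "{q. norm q < \<rho> \<and> of_real x * fv q = 1} = {q1, q2}" by (simp add: Z_def)
  show "fF q1 \<noteq> 0" "fF q2 \<noteq> 0" using zpos[OF qZ(1)] zpos[OF qZ(2)] z12 by auto
qed

section \<open>Numerical bounds for exp and pi\<close>

lemma exp_ge_Taylor:
  fixes x :: real
  assumes "x \<ge> 0"
  shows "(\<Sum>k<n. x ^ k / fact k) \<le> exp x"
proof -
  have "summable (\<lambda>k. x ^ k / fact k)"
    using summable_exp[of x] by (simp add: field_simps)
  moreover have "exp x = (\<Sum>k. x ^ k / fact k)"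
    by (simp add: exp_def scaleR_conv_of_real field_simps)
  ultimately show ?thesis
    using sum_le_suminf[of "\<lambda>k. x ^ k / fact k" "{..<n}"] assms by simp
qed

text \<open>The Lagrange remainder is at most \<open>exp x\<close> times
  \<open>x ^ n / fact n\<close> and can be absorbed on the left.\<close>

lemma exp_le_Taylor:
  fixes x :: real
  assumes "x \<ge> 0" "x ^ n / fact n < 1"
  shows "exp x \<le> (\<Sum>k<n. x ^ k / fact k) / (1 - x ^ n / fact n)"
proof -
  obtain t where t: "\<bar>t\<bar> \<le> \<bar>x\<bar>" "exp x = (\<Sum>m<n. x ^ m / fact m) + exp t / fact n * x ^ n"
    using Maclaurin_exp_le[of x n] by blast
  have "exp t \<le> exp x" using t(1) assms(1) by simp
  then have "exp t * (x ^ n / fact n) \<le> exp x * (x ^ n / fact n)"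
    using assms(1) by (intro mult_right_mono) auto
  moreover have "exp x * (1 - x ^ n / fact n) = exp x - exp x * (x ^ n / fact n)"
    by (simp add: right_diff_distrib)
  moreover have "exp x = (\<Sum>m<n. x ^ m / fact m) + exp t * (x ^ n / fact n)" using t(2) by simp
  ultimately have "exp x * (1 - x ^ n / fact n) \<le> (\<Sum>m<n. x ^ m / fact m)" by linarith
  then show ?thesis using assms(2) by (simp add: pos_le_divide_eq)
qed

text \<open>The Taylor polynomial of the sine is evaluated at a sixth of each decimal and compared
  with \<open>sin (pi / 6) = 1/2\<close>.\<close>

lemma pi_bounds: "(31415 / 10000) < pi" "pi < (31416 / 10000)"
proof -
  have b: "\<bar>sin x - (\<Sum>m<8. sin_coeff m * x ^ m)\<bar> \<le> inverse (fact 8) * \<bar>x\<bar> ^ 8" for x :: real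
    by (rule Maclaurin_sin_bound)
  have s: "(\<Sum>m<8. sin_coeff m * x ^ m) = x - x ^ 3 / 6 + x ^ 5 / 120 - x ^ 7 / 5040" for x :: real
  proof -
    have "{..<8} = {0, 1, 2, 3, 4, 5, 6, 7 :: nat}" by auto
    then show ?thesis by (simp add: sin_coeff_def fact_numeral)
  qed
  have 1: "sin ((31415 / 10000) / 6) < (1 / 2 :: real)"
    using b[of "(31415 / 10000) / 6"] unfolding s abs_le_iff by (simp add: fact_numeral power_divide)
  have 2: "sin ((31416 / 10000) / 6) > (1 / 2 :: real)"
    using b[of "(31416 / 10000) / 6"] unfolding s abs_le_iff by (simp add: fact_numeral power_divide)
  show "(31415 / 10000) < pi"
  proof (rule ccontr)
    assume "\<not> (31415 / 10000) < pi"
    then have "sin (pi / 6) \<le> sin ((31415 / 10000) / 6)"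
      using pi_gt3 by (intro sin_monotone_2pi_le) auto
    then show False using 1 by (simp add: sin_30)
  qed
  show "pi < (31416 / 10000)"
  proof (rule ccontr)
    assume "\<not> pi < (31416 / 10000)"
    then have "sin ((31416 / 10000) / 6) \<le> sin (pi / 6)"
      by (intro sin_monotone_2pi_le) auto
    then show False using 2 by (simp add: sin_30)
  qed
qed

lemma exp_1_ge: "exp (1 :: real) \<ge> (27 / 10)"
  using exp_ge_Taylor[of 1 6] by (simp add: eval_nat_numeral)

lemma exp_minus_le: "0 < b \<Longrightarrow> b \<le> exp a \<Longrightarrow> a \<le> y \<Longrightarrow> exp (- y) \<le> 1 / (b :: real)"
proof -
  assume b: "0 < b" "b \<le> exp a" "a \<le> y"
  then have "b \<le> exp y" using exp_le_cancel_iff[of a y] by linarith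
  then show ?thesis using b by (simp add: exp_minus divide_inverse)
qed

section \<open>The Hauptmodul on the circle of integration\<close>

text \<open>\<open>ee (low t)\<close> runs through the circle of radius \<open>8/25\<close> around 0, the contour of integration.\<close>
definition hh :: real where "hh = ln (25 / 8) / (2 * pi)"

lemma exp_hh: "exp (- 2 * pi * hh) = 8 / 25"
proof -
  have "- 2 * pi * hh = - ln (25 / 8)" by (simp add: hh_def)
  then show ?thesis by (simp only: exp_minus) simp
qed

lemma hh_bounds: "(181 / 1000) \<le> hh" "hh \<le> (1816 / 10000)"
proof -
  have "exp (2 * pi * (181 / 1000)) \<le> exp ((11373 / 10000) :: real)" using pi_bounds by simp
  also have "\<dots> \<le> 25 / 8"
    by (rule order_trans[OF exp_le_Taylor[where n = 9]]) (simp_all add: eval_nat_numeral)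
  finally have "2 * pi * (181 / 1000) \<le> ln (25 / 8)" by (subst ln_ge_iff) auto
  then show "(181 / 1000) \<le> hh" by (simp add: hh_def field_simps)
  have "25 / 8 \<le> exp ((11405 / 10000) :: real)"
    by (rule order_trans[OF _ exp_ge_Taylor[where n = 9]]) (simp_all add: eval_nat_numeral)
  also have "\<dots> \<le> exp (2 * pi * (1816 / 10000))" using pi_bounds by simp
  finally have "ln (25 / 8) \<le> 2 * pi * (1816 / 10000)" by (metis exp_gt_zero ln_exp ln_le_cancel_iff zero_less_divide_iff zero_less_numeral)
  then show "hh \<le> (1816 / 10000)" by (simp add: hh_def field_simps)
qed

lemma hh_pos: "hh > 0" using hh_bounds by simp

lemma hh2: "(3276 / 100000) \<le> hh\<^sup>2" "hh\<^sup>2 \<le> (3298 / 100000)"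
proof -
  have "(181 / 1000)\<^sup>2 \<le> hh\<^sup>2" using hh_bounds by (intro power_mono) auto
  then show "(3276 / 100000) \<le> hh\<^sup>2" by (simp add: power2_eq_square)
  have "hh\<^sup>2 \<le> (1816 / 10000)\<^sup>2" using hh_bounds by (intro power_mono) auto
  then show "hh\<^sup>2 \<le> (3298 / 100000)" by (simp add: power2_eq_square)
qed

definition low :: "real \<Rightarrow> complex" where "low t = of_real t + of_real hh * \<i>"

lemma low_simps [simp]: "Re (low t) = t" "Im (low t) = hh"
  by (simp_all add: low_def)

lemma norm_low: "(norm (low t))\<^sup>2 = t\<^sup>2 + hh\<^sup>2"
  by (simp add: cmod_power2)

lemma norm_ee_low: "norm (ee (low t)) = 8 / 25"
  using exp_hh by (simp add: norm_ee)

lemma ee_low_minus: "ee (low (- t)) = cnj (ee (low t))"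
  unfolding ee_cnj[symmetric] by (simp add: low_def)

lemma ee_low_plus_1: "ee (low (t + 1)) = ee (low t)"
  using ee_add[of "low t" 1] by (simp add: low_def add_ac)

lemma frac_hh_lower:
  assumes "0 \<le> a" "\<bar>t\<bar> \<le> a"
  shows "(181 / 1000) / (a\<^sup>2 + (3298 / 100000)) \<le> hh / (t\<^sup>2 + hh\<^sup>2)"
proof -
  have "t\<^sup>2 \<le> a\<^sup>2" using assms by (metis abs_le_square_iff abs_of_nonneg)
  moreover have "t\<^sup>2 + hh\<^sup>2 > 0" using hh_pos by (simp add: sum_power2_gt_zero_iff)
  ultimately show ?thesis using hh_bounds hh2 by (intro frac_le) auto
qed

text \<open>Near the positive real axis the Fricke image has a tiny nome, so
  \<open>fricke_fv\<close> makes \<open>fv\<close> large there. The bound assumed for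
  \<open>x\<close> is the one supplied by \<open>arc_hauptmodul\<close>.\<close>

lemma fv_small_region:
  assumes "\<bar>t\<bar> \<le> (8 / 100)" "x \<le> - (4096 * exp (- (134 / 10)))"
  shows "norm (of_real x * fv (ee (low t))) \<ge> 2"
proof -
  define u where "u = - 1 / (2 * low t)"
  define s where "s = norm (ee u)"
  have u: "Im u > 0" unfolding u_def by (rule Im_fricke_pos) (use hh_pos in simp)
  have "2 * (a / (2 * b)) = a / b" for a b :: real by simp
  then have iu: "2 * Im u = hh / (t\<^sup>2 + hh\<^sup>2)" unfolding u_def Im_fricke norm_low low_simps .
  have "(459 / 100) \<le> (181 / 1000) / ((8 / 100)\<^sup>2 + (3298 / 100000) :: real)" by (simp add: power2_eq_square)
  also have "\<dots> \<le> hh / (t\<^sup>2 + hh\<^sup>2)" by (rule frac_hh_lower) (use assms in auto)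
  finally have "(459 / 100) \<le> 2 * Im u" by (simp add: iu)
  then have "pi * (459 / 100) \<le> pi * (2 * Im u)" by (intro mult_left_mono) auto
  moreover have "(1441 / 100) \<le> pi * (459 / 100)" using pi_bounds by simp
  ultimately have "1441 / 100 \<le> pi * (2 * Im u)" by (rule order_trans[rotated])
  then have s1: "s \<le> exp (- (1441 / 100))" by (simp add: s_def norm_ee mult_ac)
  have "exp (- (1441 / 100) :: real) \<le> 1 / 128"
  proof -
    have "128 \<le> ((27 / 10) :: real) ^ 5" by (simp add: eval_nat_numeral)
    also have "\<dots> \<le> exp 1 ^ 5" using exp_1_ge by (intro power_mono) auto
    also have "\<dots> = exp 5" by (simp flip: exp_of_nat_mult)
    finally show ?thesis by (intro exp_minus_le[where a = 5]) auto
  qed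
  with s1 have s2: "s \<le> 1 / 128" by simp
  have s0: "0 \<le> s" by (simp add: s_def)
  have "24 * (s / ((1 - s) * (1 - s))) \<le> 24 * ((1/128) / ((1 - 1/128) * (1 - 1/128)))"
    using s0 s2 by (intro mult_left_mono frac_le mult_mono) auto
  also have "\<dots> \<le> (2 / 10)" by simp
  finally have e24: "24 * (s / ((1 - s) * (1 - s))) \<le> (2 / 10)" .
  have "norm (eA (ee u)) \<le> exp (s / ((1 - s) * (1 - s)))"
    unfolding eA_def using qpoch_bounds(2)[of "- ee u" "ee u"] norm_ee_less_1[OF u] by (simp add: s_def)
  then have "norm (eA (ee u)) ^ 24 \<le> exp (s / ((1 - s) * (1 - s))) ^ 24" by (intro power_mono) auto
  also have "\<dots> = exp (24 * (s / ((1 - s) * (1 - s))))" by (simp flip: exp_of_nat_mult)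
  also have "\<dots> \<le> exp (2 / 10)" using e24 by simp
  finally have "norm (fv (ee u)) \<le> exp (- (1441 / 100)) * exp (2 / 10)"
    unfolding fv_def norm_mult norm_power s_def[symmetric] using s1 by (intro mult_mono) auto
  also have "\<dots> = exp (- (1421 / 100))" by (simp flip: exp_add)
  finally have v: "norm (fv (ee u)) \<le> exp (- (1421 / 100))" .
  have vp: "norm (fv (ee u)) > 0" by simp
  have "4096 * fv (ee (low t)) * fv (ee u) = 1"
    unfolding u_def by (rule fricke_fv) (use hh_pos in simp)
  then have "norm (4096 * fv (ee (low t)) * fv (ee u)) = 1" by simp
  then have e: "4096 * norm (fv (ee (low t))) = 1 / norm (fv (ee u))"
    using vp by (simp add: norm_mult field_simps)
  \<comment> \<open>The exponents 14.21 (from the nome after the product correction) and 13.4 (from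
    the bound on \<open>x\<close>) differ by more than 0.75, which exceeds
    \<open>ln 2\<close>.\<close>
  have "2 \<le> exp ((75 / 100) :: real)"
    by (rule order_trans[OF _ exp_ge_Taylor[where n = 3]]) (simp_all add: eval_nat_numeral)
  also have "\<dots> \<le> exp ((1421 / 100) - (134 / 10))" by simp
  also have "\<dots> = exp (- (134 / 10)) * (1 / exp (- (1421 / 100)))" 
    using exp_diff[of "- (134 / 10)" "- (1421 / 100) :: real"] by simp
  also have "\<dots> \<le> exp (- (134 / 10)) * (1 / norm (fv (ee u)))"
    using v vp by (intro mult_left_mono divide_left_mono) auto
  also have "\<dots> = (4096 * exp (- (134 / 10))) * norm (fv (ee (low t)))" unfolding e[symmetric] by simp
  also have "\<dots> \<le> (- x) * norm (fv (ee (low t)))" using assms(2) by (intro mult_right_mono) auto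
  also have "\<dots> = norm (of_real x * fv (ee (low t)))"
  proof -
    have "x < 0" using assms(2) exp_gt_zero[of "- (134 / 10) :: real"] by linarith
    then show ?thesis by (simp add: norm_mult)
  qed
  finally show ?thesis .
qed

lemma logv_low_bounds:
  assumes "0 \<le> t" "t \<le> a" "exp (- pi * ((181 / 1000) / (a\<^sup>2 + (3298 / 100000)))) \<le> S" "S < 1"
  shows "\<bar>Im (logv (low t)) - pi * (t / (t\<^sup>2 + hh\<^sup>2))\<bar> \<le> 24 * (S / (1 - S)\<^sup>2)"
proof -
  define s where "s = exp (- pi * hh / (t\<^sup>2 + hh\<^sup>2))"
  have "pi * ((181 / 1000) / (a\<^sup>2 + (3298 / 100000))) \<le> pi * (hh / (t\<^sup>2 + hh\<^sup>2))"
    using assms by (intro mult_left_mono frac_hh_lower) auto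
  then have "s \<le> exp (- pi * ((181 / 1000) / (a\<^sup>2 + (3298 / 100000))))" by (simp add: s_def)
  then have s: "0 < s" "s \<le> S" using order_trans[OF _ assms(3)] by (auto simp: s_def)
  have "\<bar>Im (logv (low t)) - pi * t / (t\<^sup>2 + hh\<^sup>2)\<bar> \<le> 24 * (s / (1 - s)\<^sup>2)"
    using Im_logv_bound[of "low t"] hh_pos by (simp add: norm_low s_def)
  also have "\<dots> \<le> 24 * (S / (1 - S)\<^sup>2)"
    using s assms by (intro mult_left_mono frac_le power_mono) auto
  finally show ?thesis by simp
qed

text \<open>The argument of \<open>fv\<close> stays away from odd multiples of \<pi>, so for
  negative \<open>x\<close> the number \<open>1 - x * fv\<close> avoids the negative real axis. The
  main term lies between 2\<pi> and 3\<pi>; the range is split at 28/100 because the error grows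
  with \<open>t\<close> while the main term comes down from its maximum.\<close>

lemma logv_low_region:
  assumes "(8 / 100) \<le> t" "t \<le> 3/8"
  shows "\<bar>Im (logv (low t)) - 2 * pi\<bar> \<le> pi - (42 / 100)"
    and "t \<le> (28 / 100) \<Longrightarrow> \<bar>Im (logv (low t)) - pi * (t / (t\<^sup>2 + hh\<^sup>2))\<bar> \<le> (18 / 100)"
proof -
  have d: "t\<^sup>2 + hh\<^sup>2 > 0" using hh_pos by (simp add: sum_power2_gt_zero_iff)
  have "2 * (t\<^sup>2 + hh\<^sup>2) \<le> t"
  proof -
    \<comment> \<open>On the interval the convex function \<open>t\<^sup>2\<close> lies below its
      chord.\<close>
    have "(t - (8 / 100)) * (3/8 - t) \<ge> 0" using assms by (intro mult_nonneg_nonneg) auto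
    then have "t\<^sup>2 \<le> (455 / 1000) * t - (3 / 100)" by (simp add: algebra_simps power2_eq_square)
    then show ?thesis using hh2 assms by argo
  qed
  then have lo: "2 * pi \<le> pi * (t / (t\<^sup>2 + hh\<^sup>2))"
  proof -
    assume "2 * (t\<^sup>2 + hh\<^sup>2) \<le> t"
    then have "2 \<le> t / (t\<^sup>2 + hh\<^sup>2)" using d by (simp add: pos_le_divide_eq)
    then have "pi * 2 \<le> pi * (t / (t\<^sup>2 + hh\<^sup>2))" by (rule mult_left_mono) simp
    then show ?thesis by (simp add: mult.commute)
  qed
  have e28: "\<bar>Im (logv (low t)) - pi * (t / (t\<^sup>2 + hh\<^sup>2))\<bar> \<le> (18 / 100)" if "t \<le> (28 / 100)"
  proof -
    have "exp (- (pi * ((181 / 1000) / ((28 / 100)\<^sup>2 + (3298 / 100000))))) \<le> 1 / 143"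
    proof (rule exp_minus_le[where a = 5])
      have "143 \<le> ((27 / 10) :: real) ^ 5" by (simp add: eval_nat_numeral)
      also have "\<dots> \<le> exp 1 ^ 5" using exp_1_ge by (intro power_mono) auto
      also have "\<dots> = exp 5" by (simp flip: exp_of_nat_mult)
      finally show "143 \<le> exp (5 :: real)" .
      show "5 \<le> pi * ((181 / 1000) / ((28 / 100)\<^sup>2 + (3298 / 100000)))" using pi_bounds by (simp add: power2_eq_square)
    qed simp
    then have "\<bar>Im (logv (low t)) - pi * (t / (t\<^sup>2 + hh\<^sup>2))\<bar> \<le> 24 * ((1/143) / (1 - 1/143)\<^sup>2)"
      using assms that by (intro logv_low_bounds[where a = "(28 / 100)"]) auto
    also have "\<dots> \<le> (18 / 100)" by (simp add: power2_eq_square)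
    finally show ?thesis .
  qed
  then show "t \<le> (28 / 100) \<Longrightarrow> \<bar>Im (logv (low t)) - pi * (t / (t\<^sup>2 + hh\<^sup>2))\<bar> \<le> (18 / 100)" .
  show "\<bar>Im (logv (low t)) - 2 * pi\<bar> \<le> pi - (42 / 100)"
  proof (cases "t \<le> (28 / 100)")
    case True
    have "t / (t\<^sup>2 + hh\<^sup>2) \<le> 1 / (2 * hh)"
    proof -
      have "2 * hh * t \<le> t\<^sup>2 + hh\<^sup>2" using sum_squares_bound[of t hh] by (simp add: mult_ac)
      then show ?thesis using d hh_pos by (simp add: field_simps)
    qed
    also have "\<dots> \<le> 1 / (2 * (181 / 1000))" using hh_bounds by (intro divide_left_mono) auto
    finally have "pi * (t / (t\<^sup>2 + hh\<^sup>2)) \<le> pi * (1 / (2 * (181 / 1000)))" by (intro mult_left_mono) auto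
    also have "\<dots> \<le> 3 * pi - (7 / 10)" using pi_bounds by simp
    finally show ?thesis using e28[OF True] lo pi_bounds unfolding abs_le_iff by argo
  next
    case False
    have "exp (- (pi * ((181 / 1000) / ((3/8)\<^sup>2 + (3298 / 100000))))) \<le> 1 / 25"
    proof (rule exp_minus_le[where a = "(327 / 100)"])
      have "25 \<le> ((27 / 10) :: real) ^ 3 * (13 / 10)" by (simp add: eval_nat_numeral)
      also have "\<dots> \<le> exp 1 ^ 3 * exp (27 / 100)"
      proof (intro mult_mono power_mono exp_1_ge)
        show "(13 / 10) \<le> exp ((27 / 100) :: real)"
          by (rule order_trans[OF _ exp_ge_Taylor[where n = 3]]) (simp_all add: eval_nat_numeral)
      qed auto
      also have "\<dots> = exp (327 / 100)" by (simp flip: exp_of_nat_mult exp_add)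
      finally show "25 \<le> exp ((327 / 100) :: real)" .
      show "(327 / 100) \<le> pi * ((181 / 1000) / ((3/8)\<^sup>2 + (3298 / 100000)))" using pi_bounds by (simp add: power2_eq_square)
    qed simp
    then have "\<bar>Im (logv (low t)) - pi * (t / (t\<^sup>2 + hh\<^sup>2))\<bar> \<le> 24 * ((1/25) / (1 - 1/25)\<^sup>2)"
      using assms by (intro logv_low_bounds[where a = "3/8"]) auto
    also have "\<dots> \<le> (105 / 100)" by (simp add: power2_eq_square)
    finally have err: "\<bar>Im (logv (low t)) - pi * (t / (t\<^sup>2 + hh\<^sup>2))\<bar> \<le> (105 / 100)" .
    have "t / (t\<^sup>2 + hh\<^sup>2) \<le> (252 / 100)"
    proof -
      \<comment> \<open>The two numbers are close to the roots of
        \<open>t = (252 / 100) * (t\<^sup>2 + hh\<^sup>2)\<close>, rounded so that the bounds on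
        \<open>hh\<^sup>2\<close> suffice.\<close>
      have "(t - 28/100) * (t - 263/2250) \<ge> 0" using False by (intro mult_nonneg_nonneg) auto
      moreover have "(t - a) * (t - b) = t\<^sup>2 - (a + b) * t + a * b" for a b :: real
        by (simp add: algebra_simps power2_eq_square)
      ultimately have "t\<^sup>2 - (28/100 + 263/2250) * t + 28/100 * (263/2250) \<ge> 0" by (simp only:)
      then have "t \<le> (252 / 100) * (t\<^sup>2 + hh\<^sup>2)" using hh2 assms by argo
      then show ?thesis using d by (simp add: field_simps)
    qed
    then have "pi * (t / (t\<^sup>2 + hh\<^sup>2)) \<le> pi * (252 / 100)" by (intro mult_left_mono) auto
    then show ?thesis using err lo pi_bounds unfolding abs_le_iff by argo
  qed
qed

text \<open>A ray whose angle to the negative real axis is at least 0.42 stays at distance at least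
  \<open>sin (42/100)\<close> from -1, and this exceeds 2/5.\<close>

lemma one_plus_exp_sector:
  fixes L :: complex and x :: real
  assumes "x < 0" "\<bar>Im L - 2 * pi\<bar> \<le> pi - 42/100"
  shows "norm (1 - of_real x * exp L) \<ge> 2/5" and "1 - of_real x * exp L \<notin> \<real>\<^sub>\<le>\<^sub>0"
    and "\<bar>Im L - 2 * pi\<bar> < pi / 2 \<Longrightarrow> Re (1 - of_real x * exp L) > 0"
proof -
  define R b where "R = - x * exp (Re L)" and "b = Im L - 2 * pi"
  have R: "R > 0" using assms by (simp add: R_def mult_neg_pos)
  have cs: "cos (Im L) = cos b" "sin (Im L) = sin b"
    using cos_periodic[of b] sin_periodic[of b] by (simp_all add: b_def)
  have re: "Re (1 - of_real x * exp L) = 1 + R * cos b" and im: "Im (1 - of_real x * exp L) = R * sin b"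
    by (simp_all add: Re_exp Im_exp R_def cs mult_ac)
  have b: "\<bar>b\<bar> \<le> pi - 42/100" using assms(2) by (simp add: b_def)
  have cb: "cos b \<ge> - cos (42/100)"
  proof -
    have "cos (pi - 42/100) \<le> cos \<bar>b\<bar>" using b by (intro cos_monotone_0_pi_le) auto
    then show ?thesis by simp
  qed
  have s: "sin (42/100) \<ge> (2/5 :: real)"
  proof -
    have "{..<4} = {0, 1, 2, 3 :: nat}" by auto
    with abs_le_D2[OF Maclaurin_sin_bound[of "42/100" 4]]
    show ?thesis by (simp add: sin_coeff_def fact_numeral power_divide)
  qed
  have "(2/5)\<^sup>2 \<le> (sin (42/100 :: real))\<^sup>2" using s by (intro power_mono) auto
  also have "\<dots> \<le> (R - cos (42/100))\<^sup>2 + (sin (42/100))\<^sup>2" by simp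
  also have "\<dots> = R\<^sup>2 - 2 * R * cos (42/100) + 1"
    using sin_cos_squared_add[of "42/100"] by (simp add: power2_diff)
  also have "\<dots> \<le> R\<^sup>2 + 2 * R * cos b + 1"
    using mult_left_mono[OF cb, of "2 * R"] R by simp
  also have "\<dots> = (norm (1 - of_real x * exp L))\<^sup>2"
  proof -
    have "(1 + R * c)\<^sup>2 + (R * s)\<^sup>2 = R\<^sup>2 * (s\<^sup>2 + c\<^sup>2) + 2 * R * c + 1" for c s
      by (simp add: power2_eq_square algebra_simps)
    then show ?thesis unfolding cmod_power2 re im using sin_cos_squared_add[of b] by simp
  qed
  finally show "norm (1 - of_real x * exp L) \<ge> 2/5"
    by (rule power2_le_imp_le) simp
  show "1 - of_real x * exp L \<notin> \<real>\<^sub>\<le>\<^sub>0"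
  proof
    assume "1 - of_real x * exp L \<in> \<real>\<^sub>\<le>\<^sub>0"
    then have *: "R * sin b = 0" "1 + R * cos b \<le> 0" by (auto simp only: complex_nonpos_Reals_iff re im)
    have "sin b = 0" using *(1) R by simp
    moreover have "- pi < b" "b < pi" using b by (auto simp: abs_le_iff)
    ultimately have "b = 0" using sin_eq_0_pi by blast
    then have "cos b = 1" by (simp only: cos_zero)
    then show False using *(2) R by simp
  qed
  show "Re (1 - of_real x * exp L) > 0" if "\<bar>Im L - 2 * pi\<bar> < pi / 2"
  proof -
    have "b < pi / 2 \<and> - b < pi / 2" using that unfolding b_def abs_less_iff .
    then have "cos b > 0" by (intro cos_gt_zero_pi) auto
    then show ?thesis unfolding re using R by (simp add: add_pos_pos)
  qed
qed

text \<open>Near the negative real axis \<open>fv\<close> is small, and the estimate of the argument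
  is replaced by one of the modulus. The factors \<open>1 + q\<close> and
  \<open>1 + q\<^sup>2\<close> are computed exactly in terms of \<open>Re q\<close>; the rest of the
  product is bounded by its logarithm.\<close>

lemma fv_left_region:
  assumes q: "norm q = 8/25" "Re q \<le> - 28/125"
  shows "norm (fv q) \<le> 3/400"
proof -
  define y where "y = Re q"
  have iy: "(Im q)\<^sup>2 = 64/625 - y\<^sup>2"
    using cmod_power2[of q] q(1) by (simp add: y_def power_divide)
  have n1: "(norm (1 + q))\<^sup>2 = 689/625 + 2 * y"
    unfolding cmod_power2 using iy by (simp add: power2_sum y_def)
  have n2: "(norm (1 + q\<^sup>2))\<^sup>2 = (561/625)\<^sup>2 + 4 * y\<^sup>2"
  proof -
    have "Re (q\<^sup>2) = 2 * y\<^sup>2 - 64/625" using iy by (simp add: Re_power2 y_def)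
    moreover have "(norm (q\<^sup>2))\<^sup>2 = (64/625)\<^sup>2" unfolding norm_power q(1) by (simp add: power_divide)
    moreover have "(norm (1 + w))\<^sup>2 = 1 + 2 * Re w + (norm w)\<^sup>2" for w
      by (simp add: cmod_power2 power2_sum)
    ultimately show ?thesis by (simp add: power2_eq_square)
  qed
  \<comment> \<open>In terms of the distance \<open>b\<close> beyond -28/125 the cubic has
    nonpositive coefficients except for the constant one, so its maximum is at
    \<open>b = 0\<close>.\<close>
  define b where "b = - 28/125 - y"
  have b: "b \<ge> 0" using q(2) by (simp add: b_def y_def)
  have y: "y = - 28/125 - b" by (simp add: b_def)
  have "(norm ((1 + q) * (1 + q\<^sup>2)))\<^sup>2 = (689/625 + 2 * y) * ((561/625)\<^sup>2 + 4 * y\<^sup>2)"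
    by (simp add: norm_mult power_mult_distrib n1 n2)
  also have "\<dots> = (409/625 - 2 * b) * ((561/625)\<^sup>2 + 4 * (28/125)\<^sup>2 + 8 * 28/125 * b + 4 * b\<^sup>2)"
    unfolding y by (simp add: power2_eq_square algebra_simps)
  also have "\<dots> \<le> 33/50"
  proof -
    have "(A - 2 * b) * (C + D * b + 4 * b\<^sup>2) = A * C - (2 * C - A * D) * b - (2 * D - 4 * A) * b\<^sup>2 - 8 * b ^ 3"
      for A C D :: real by (simp add: algebra_simps power2_eq_square power3_eq_cube)
    note this[of "409/625" "(561/625)\<^sup>2 + 4 * (28/125)\<^sup>2" "8 * 28/125"]
    moreover have "(2 * ((561/625)\<^sup>2 + 4 * (28/125)\<^sup>2) - 409/625 * (8 * 28/125)) * b \<ge> 0"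
      "(2 * (8 * 28/125) - 4 * (409/625)) * b\<^sup>2 \<ge> 0" "8 * b ^ 3 \<ge> 0"
      using b by (intro mult_nonneg_nonneg; simp add: power2_eq_square)+
    moreover have "409/625 * ((561/625)\<^sup>2 + 4 * (28/125)\<^sup>2) \<le> (33/50 :: real)" by (simp add: power2_eq_square)
    ultimately show ?thesis by linarith
  qed
  finally have p: "(norm ((1 + q) * (1 + q\<^sup>2)))\<^sup>2 \<le> 33/50" .
  have q1: "norm q < 1" using q by simp
  have "eA q = (1 + q) * ((1 + q\<^sup>2) * qpoch (- (q ^ 3)) q)"
  proof -
    have "- q * q = - (q\<^sup>2)" "- (q\<^sup>2) * q = - (q ^ 3)" by (simp_all add: power2_eq_square power3_eq_cube)
    moreover have "norm (- (q\<^sup>2)) < 1" unfolding norm_minus_cancel norm_power q(1) by (simp add: power_divide)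
    ultimately show ?thesis unfolding eA_def
      using qpoch_rec[of "- q" q] qpoch_rec[of "- (q\<^sup>2)" q] q1 by simp
  qed
  then have "norm (eA q) ^ 24 = ((norm ((1 + q) * (1 + q\<^sup>2)))\<^sup>2) ^ 12 * norm (qpoch (- (q ^ 3)) q) ^ 24"
    by (simp add: norm_mult power_mult_distrib flip: power_mult)
  also have "\<dots> \<le> (33/50) ^ 12 * (17/5)"
  proof (intro mult_mono power_mono p)
    have n3: "norm (- (q ^ 3)) = 512/15625"
      unfolding norm_minus_cancel norm_power q(1) by (simp add: power_divide)
    have "norm (qpoch (- (q ^ 3)) q) \<le> exp (norm (- (q ^ 3)) / ((1 - norm (- (q ^ 3))) * (1 - norm q)))"
      by (rule qpoch_bounds(2)[OF _ q1], subst n3) simp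
    also have "\<dots> \<le> exp (1/20)" unfolding n3 q(1) by simp
    finally have "norm (qpoch (- (q ^ 3)) q) ^ 24 \<le> exp (1/20) ^ 24" by (intro power_mono) auto
    also have "\<dots> = exp (6/5)" by (simp flip: exp_of_nat_mult)
    also have "\<dots> \<le> 17/5"
      by (rule order_trans[OF exp_le_Taylor[where n = 8]]) (simp_all add: eval_nat_numeral)
    finally show "norm (qpoch (- (q ^ 3)) q) ^ 24 \<le> 17/5" .
  qed auto
  finally have "norm (fv q) \<le> 8/25 * ((33/50) ^ 12 * (17/5))"
    unfolding fv_def norm_mult norm_power q(1) by (intro mult_left_mono) auto
  also have "\<dots> \<le> 3/400" by (simp add: power_divide)
  finally show ?thesis .
qed

lemma Re_ee_low: "Re (ee (low t)) = 8/25 * cos (2 * pi * t)"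
  using exp_hh by (simp add: ee_def Re_exp)

lemma left_region_low:
  assumes "3/8 \<le> t" "t \<le> 5/8"
  shows "norm (fv (ee (low t))) \<le> 3/400"
proof (rule fv_left_region[OF norm_ee_low])
  have "cos (pi - y) = - cos y" for y by (simp add: cos_diff)
  from this[of "pi/4"] have c45: "cos (pi - pi/4) = - (sqrt 2 / 2)" by (simp only: cos_45)
  have "cos (2 * pi * t) \<le> - (sqrt 2 / 2)"
  proof (cases "t \<le> 1/2")
    case True
    have "cos (2 * pi * t) \<le> cos (pi - pi/4)" using assms True by (intro cos_monotone_0_pi_le) auto
    then show ?thesis unfolding c45 .
  next
    case False
    have "cos (2 * pi * t) = cos (2 * pi * (1 - t))"
      using cos_periodic[of "2 * pi * (t - 1)"] by (simp add: algebra_simps) (metis cos_minus minus_diff_eq)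
    also have "\<dots> \<le> cos (pi - pi/4)" using assms False by (intro cos_monotone_0_pi_le) auto
    finally show ?thesis unfolding c45 .
  qed
  moreover have "7/5 \<le> sqrt 2" by (rule real_le_rsqrt) (simp add: power2_eq_square)
  ultimately have "cos (2 * pi * t) \<le> - 7/10" by simp
  then show "Re (ee (low t)) \<le> - 28/125" by (simp add: Re_ee_low)
qed

lemma circle_param:
  assumes "norm q = 8/25"
  obtains t where "0 \<le> t" "t \<le> 1" "q = ee (low t)"
proof -
  have "q \<in> path_image (circlepath 0 (8/25))" using assms by (simp add: path_image_circlepath)
  then obtain t where t: "t \<in> {0..1}" "q = circlepath 0 (8/25) t" by (auto simp: path_image_def)
  have "2 * complex_of_real pi * \<i> * low t = of_real (- 2 * pi * hh) + 2 * of_real pi * \<i> * of_real t"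
    by (simp add: low_def algebra_simps)
  then have "ee (low t) = of_real (exp (- 2 * pi * hh)) * exp (2 * of_real pi * \<i> * of_real t)"
    unfolding ee_def by (simp only: exp_add exp_of_real)
  then have "ee (low t) = circlepath 0 (8/25) t" unfolding exp_hh circlepath by simp
  with t(2) have "ee (low t) = q" by simp
  with t(1) that show ?thesis by auto
qed

text \<open>The bounds contain the values of the Hauptmodul on the part of the arc with \<open>cos \<theta> \<le> 7/8\<close>.\<close>
context
  fixes x :: real
  assumes x1: "- 68 \<le> x" and x2: "x \<le> - (4096 * exp (- (134/10)))"
begin

private lemma x_neg: "x < 0"
proof -
  have "0 < 4096 * exp (- (134/10) :: real)" by simp
  with x2 show ?thesis by linarith
qed

lemma left_slit:
  assumes "norm (fv q) \<le> 3/400"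
  shows "norm (1 - of_real x * fv q) \<ge> 2/5" "1 - of_real x * fv q \<notin> \<real>\<^sub>\<le>\<^sub>0"
proof -
  have "norm (of_real x * fv q) \<le> 68 * (3/400)"
    unfolding norm_mult using x1 x_neg assms by (intro mult_mono) auto
  then have n: "norm (of_real x * fv q) \<le> 3/5" by simp
  then show "norm (1 - of_real x * fv q) \<ge> 2/5"
    using norm_one_plus_bounds(1)[of "of_real x * fv q"] by linarith
  have "Re (1 - of_real x * fv q) > 0"
    using complex_Re_le_cmod[of "of_real x * fv q"] n unfolding minus_complex.sel one_complex.sel by linarith
  then show "1 - of_real x * fv q \<notin> \<real>\<^sub>\<le>\<^sub>0" by (auto simp: complex_nonpos_Reals_iff simp del: minus_complex.sel)
qed

text \<open>Up to 3/8 the argument of \<open>fv\<close> is controlled, around 1/2 its modulus; the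
  remaining part of the circle follows by conjugation, which exchanges \<open>t\<close> and
  \<open>1 - t\<close>.\<close>

lemma slit_low:
  assumes "8/100 \<le> t" "t \<le> 1 - 8/100"
  shows "norm (1 - of_real x * fv (ee (low t))) \<ge> 2/5" "1 - of_real x * fv (ee (low t)) \<notin> \<real>\<^sub>\<le>\<^sub>0"
proof -
  have mid: "norm (1 - of_real x * fv (ee (low t))) \<ge> 2/5 \<and> 1 - of_real x * fv (ee (low t)) \<notin> \<real>\<^sub>\<le>\<^sub>0"
    if "8/100 \<le> t" "t \<le> 3/8" for t
    using one_plus_exp_sector(1,2)[OF x_neg, of "logv (low t)"] logv_low_region(1)[of t] that
    unfolding exp_logv by auto
  consider "t \<le> 3/8" | "3/8 \<le> t" "t \<le> 5/8" | "5/8 \<le> t" by linarith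
  then have "norm (1 - of_real x * fv (ee (low t))) \<ge> 2/5 \<and> 1 - of_real x * fv (ee (low t)) \<notin> \<real>\<^sub>\<le>\<^sub>0"
  proof cases
    case 1
    then show ?thesis using mid assms by blast
  next
    case 2
    then show ?thesis using left_slit[OF left_region_low[OF 2]] by blast
  next
    case 3
    have "ee (low t) = cnj (ee (low (1 - t)))"
      using ee_low_minus[of "1 - t"] ee_low_plus_1[of "t - 1"] by simp
    then have "fv (ee (low t)) = cnj (fv (ee (low (1 - t))))"
      using fv_cnj[of "ee (low (1 - t))"] norm_ee_low[of "1 - t"] by simp
    then have e: "1 - of_real x * fv (ee (low t)) = cnj (1 - of_real x * fv (ee (low (1 - t))))" by simp
    show ?thesis unfolding e using mid[of "1 - t"] assms 3 by (simp add: complex_nonpos_Reals_iff complex_mod_cnj del: complex_cnj_diff complex_cnj_mult)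
  qed
  then show "norm (1 - of_real x * fv (ee (low t))) \<ge> 2/5" "1 - of_real x * fv (ee (low t)) \<notin> \<real>\<^sub>\<le>\<^sub>0" by auto
qed

lemma circle_lower:
  assumes "norm q = 8/25"
  shows "norm (1 - of_real x * fv q) \<ge> 2/5"
proof -
  obtain t where t: "0 \<le> t" "t \<le> 1" "q = ee (low t)" using circle_param[OF assms] .
  have big: "norm (1 - of_real x * fv (ee (low t))) \<ge> 2/5" if "\<bar>t\<bar> \<le> 8/100" for t
  proof -
    have "norm (of_real x * fv (ee (low t))) \<ge> 2" using that x2 by (intro fv_small_region) auto
    then show ?thesis using norm_triangle_ineq2[of "of_real x * fv (ee (low t))" 1] by (simp add: norm_minus_commute)
  qed
  consider "t \<le> 8/100" | "8/100 \<le> t" "t \<le> 1 - 8/100" | "1 - 8/100 \<le> t" by linarith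
  then show ?thesis
  proof cases
    case 1
    then show ?thesis using big[of t] t by auto
  next
    case 2
    then show ?thesis using slit_low(1)[of t] t by auto
  next
    case 3
    then show ?thesis using big[of "t - 1"] t ee_low_plus_1[of "t - 1"] by auto
  qed
qed

text \<open>The angle 8/100 is small enough for \<open>x * fv\<close> to have modulus at least 2 up
  to there, and large enough for the argument of \<open>fv\<close> to have come close to 2\<pi>.
  With error 18/100 and a logarithm of modulus at most 1, the total stays below
  \<open>5/2 * pi\<close>.\<close>

lemma two_zeros:
  assumes q: "q1 \<noteq> q2" "norm q1 < 8/25" "norm q2 < 8/25" "of_real x * fv q1 = 1" "of_real x * fv q2 = 1"
  shows "{q. norm q < 8/25 \<and> of_real x * fv q = 1} = {q1, q2}" "fF q1 \<noteq> 0" "fF q2 \<noteq> 0"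
proof -
  have d2: "(8/100)\<^sup>2 + hh\<^sup>2 > 0" using hh_pos by (intro add_pos_pos) auto
  have lo: "2 * pi \<le> pi * ((8/100) / ((8/100)\<^sup>2 + hh\<^sup>2))" and hi: "pi * ((8/100) / ((8/100)\<^sup>2 + hh\<^sup>2)) \<le> pi * (205/100)"
  proof -
    have "2 \<le> (8/100) / ((8/100)\<^sup>2 + hh\<^sup>2)" "(8/100) / ((8/100)\<^sup>2 + hh\<^sup>2) \<le> 205/100"
      using d2 hh2 by (simp_all add: pos_le_divide_eq pos_divide_le_eq power2_eq_square)
    then show "2 * pi \<le> pi * ((8/100) / ((8/100)\<^sup>2 + hh\<^sup>2))" "pi * ((8/100) / ((8/100)\<^sup>2 + hh\<^sup>2)) \<le> pi * (205/100)"
      by (simp_all only: mult.commute[of 2 pi] mult_le_cancel_left_pos pi_gt_zero)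
  qed
  have er: "\<bar>Im (logv (low (8/100))) - pi * ((8/100) / ((8/100)\<^sup>2 + hh\<^sup>2))\<bar> \<le> 18/100"
    by (rule logv_low_region(2)) auto
  have a1: "\<bar>Im (logv (low (8/100))) - 2 * pi\<bar> < pi / 2"
    using lo hi er pi_bounds unfolding abs_le_iff abs_less_iff by argo
  have big: "norm (of_real x * fv (ee (low t))) \<ge> 2" if "\<bar>t\<bar> \<le> 8/100" for t
    using that x2 by (intro fv_small_region) auto
  have L: "\<bar>Im (Ln (1 - 1 / (of_real x * fv (ee (low (8/100))))))\<bar> \<le> 1"
  proof -
    define w where "w = 1 / (of_real x * fv (ee (low (8/100))))"
    have w: "norm w \<le> 1/2" using big[of "8/100"] unfolding w_def norm_divide by (simp add: divide_le_eq)
    have "norm (Ln (1 - w)) \<le> norm w / (1 - norm w)" by (rule norm_Ln_one_minus_le) (use w in auto)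
    also have "\<dots> \<le> (1/2) / (1 - 1/2)" using w by (intro frac_le) auto
    finally show ?thesis using abs_Im_le_cmod[of "Ln (1 - w)"] by (simp add: w_def)
  qed
  have Id: "Im (logv (low (8/100))) + Im (Ln (1 - 1 / (of_real x * fv (ee (low (8/100)))))) < 5/2 * pi"
    using hi er L pi_bounds unfolding abs_le_iff by argo
  note zc = zero_count[where h = hh and d = "8/100" and \<rho> = "8/25", folded low_def, OF x_neg hh_pos]
  have 1: "1 < norm (of_real x * fv (ee (low t)))" if "\<bar>t\<bar> \<le> 8/100" for t using big[OF that] by simp
  have 2: "Re (1 - of_real x * fv (ee (low (8/100)))) > 0"
    using one_plus_exp_sector(3)[OF x_neg, of "logv (low (8/100))"] logv_low_region(1)[of "8/100"] a1
    unfolding exp_logv by auto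
  show "{q. norm q < 8/25 \<and> of_real x * fv q = 1} = {q1, q2}" "fF q1 \<noteq> 0" "fF q2 \<noteq> 0"
    using zc[OF _ _ _ 1 slit_low(2) 2 Id q] exp_hh by simp_all
qed

end

section \<open>Approximation on the lower boundary\<close>

definition arc_point :: "real \<Rightarrow> complex" where
  "arc_point \<theta> = - 1/2 + 1/2 * exp (\<i> * of_real \<theta>)"

lemma arc_simps: "Re (arc_point \<theta>) = (cos \<theta> - 1) / 2" "Im (arc_point \<theta>) = sin \<theta> / 2"
  by (simp_all add: arc_point_def Re_exp Im_exp)

lemma arc_gamma: "2 * arc_point \<theta> + 1 = exp (\<i> * of_real \<theta>)" "arc_point \<theta> / (2 * arc_point \<theta> + 1) = - cnj (arc_point \<theta>)"
proof -
  show 1: "2 * arc_point \<theta> + 1 = exp (\<i> * of_real \<theta>)" by (simp add: arc_point_def)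
  show "arc_point \<theta> / (2 * arc_point \<theta> + 1) = - cnj (arc_point \<theta>)"
    unfolding 1 by (simp add: arc_point_def exp_cnj exp_minus field_simps)
qed

lemma norm_arc: "(norm (arc_point \<theta>))\<^sup>2 = (1 - cos \<theta>) / 2"
proof -
  have "((c - 1) / 2)\<^sup>2 + (s / 2)\<^sup>2 = (s\<^sup>2 + c\<^sup>2 + 1 - 2 * c) / 4" for c s :: real
    by (simp add: power2_eq_square field_simps)
  from this[of "cos \<theta>" "sin \<theta>"] show ?thesis
    unfolding cmod_power2 arc_simps using sin_cos_squared_add[of \<theta>] by simp
qed

lemma norm_ee_arc: "norm (ee (arc_point \<theta>)) = exp (- pi * sin \<theta>)"
  by (simp add: norm_ee arc_simps)

text \<open>The involution maps the arc into the line \<open>Re = 1/2\<close>, so the nome there is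
  real and negative. Hence the Hauptmodul takes real values on the arc.\<close>

lemma arc_fricke:
  assumes "0 < \<theta>" "\<theta> < pi"
  shows "ee (- 1 / (2 * arc_point \<theta>)) = of_real (- exp (- pi * (sin \<theta> / (1 - cos \<theta>))))"
proof -
  have c: "cos \<theta> < 1" using assms cos_monotone_0_pi[of 0 \<theta>] by simp
  have "Re (- 1 / (2 * arc_point \<theta>)) = 1/2" "Im (- 1 / (2 * arc_point \<theta>)) = (sin \<theta> / (1 - cos \<theta>)) / 2"
    unfolding Re_fricke Im_fricke norm_arc arc_simps using c by (simp_all add: field_simps)
  then have "- 1 / (2 * arc_point \<theta>) = 1/2 + of_real ((sin \<theta> / (1 - cos \<theta>)) / 2) * \<i>"
    by (simp only: complex_eq_iff) simp
  moreover have "ee (of_real (y / 2) * \<i>) = of_real (exp (- pi * y))" for y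
  proof -
    have "2 * of_real pi * \<i> * (of_real (y / 2) * \<i>) = complex_of_real (- pi * y)"
      by (simp add: complex_eq_iff)
    then show ?thesis unfolding ee_def by (simp only: exp_of_real)
  qed
  ultimately show ?thesis by (simp only: ee_add ee_half) simp
qed

text \<open>The quotient is the cotangent of \<theta>/2, with square
  \<open>(1 + cos \<theta>) / (1 - cos \<theta>)\<close>. At \<open>cos \<theta> = 7/8\<close> this
  square is 15, and 3873/1000 rounds its root up.\<close>

lemma sin_div_bounds:
  assumes "0 < \<theta>" "\<theta> \<le> pi / 2"
  shows "1 \<le> sin \<theta> / (1 - cos \<theta>)" and "cos \<theta> \<le> 7/8 \<Longrightarrow> sin \<theta> / (1 - cos \<theta>) \<le> 3873/1000"
proof -
  have c: "cos \<theta> < 1" using assms cos_monotone_0_pi[of 0 \<theta>] by simp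
  have s0: "0 \<le> sin \<theta>" "0 \<le> cos \<theta>" using assms by (auto intro: sin_ge_zero cos_ge_zero)
  have "(1 - cos \<theta>) \<le> sin \<theta>"
  proof -
    have "sin \<theta> * sin \<theta> \<le> sin \<theta> * 1" "cos \<theta> * cos \<theta> \<le> cos \<theta> * 1"
      by (intro mult_left_mono sin_le_one cos_le_one s0)+
    then show ?thesis using sin_cos_squared_add[of \<theta>] unfolding power2_eq_square by linarith
  qed
  then show "1 \<le> sin \<theta> / (1 - cos \<theta>)" using c by simp
  assume c7: "cos \<theta> \<le> 7/8"
  have "(sin \<theta>)\<^sup>2 = (1 - cos \<theta>) * (1 + cos \<theta>)"
    using sin_cos_squared_add[of \<theta>] by (simp add: power2_eq_square algebra_simps)
  also have "\<dots> \<le> (1 - cos \<theta>) * (15 * (1 - cos \<theta>))" using c c7 by (intro mult_left_mono) auto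
  also have "\<dots> = 15 * (1 - cos \<theta>)\<^sup>2" by (simp only: power2_eq_square mult_ac)
  also have "\<dots> \<le> (3873/1000)\<^sup>2 * (1 - cos \<theta>)\<^sup>2"
    by (intro mult_right_mono) (simp_all add: power2_eq_square)
  also have "\<dots> = (3873/1000 * (1 - cos \<theta>))\<^sup>2" by (simp only: power_mult_distrib)
  finally have "sin \<theta> \<le> 3873/1000 * (1 - cos \<theta>)"
    by (rule power2_le_imp_le) (use c in simp)
  then show "sin \<theta> / (1 - cos \<theta>) \<le> 3873/1000" using c by (simp add: divide_le_eq)
qed

text \<open>At the Fricke image the value is 4096 times \<open>fv (- s)\<close>, with
  \<open>s\<close> at most about \<open>exp (- pi)\<close>. The lower bound -68 uses that
  \<open>y * exp (- y)\<close> never exceeds \<open>1 / exp 1\<close>, here for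
  \<open>y = 24 * s\<close>; the upper bound comes from the smallest \<open>s\<close>, with exponent
  at most 12.17, plus 1.17 for the product.\<close>

lemma arc_hauptmodul:
  assumes "0 < \<theta>" "\<theta> \<le> pi / 2" "cos \<theta> \<le> 7/8"
  shows "\<exists>x. - 68 \<le> x \<and> x \<le> - (4096 * exp (- (134/10))) \<and> 1 / fv (ee (arc_point \<theta>)) = of_real x"
proof -
  define y where "y = sin \<theta> / (1 - cos \<theta>)"
  have y: "1 \<le> y" "y \<le> 3873/1000" using sin_div_bounds[OF assms(1,2)] assms(3) by (auto simp: y_def)
  define s where "s = exp (- pi * y)"
  have "\<theta> < pi" using assms by linarith
  note fr = arc_fricke[OF assms(1) \<open>\<theta> < pi\<close>, folded y_def, folded s_def]
  have s0: "0 < s" by (simp add: s_def)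
  have s1: "s \<le> 10/226"
  proof -
    have "226/10 \<le> (27/10 :: real) ^ 3 * (1149/1000)" by (simp add: eval_nat_numeral)
    also have "\<dots> \<le> exp 1 ^ 3 * exp (14/100)"
    proof (intro mult_mono power_mono exp_1_ge)
      show "1149/1000 \<le> exp (14/100 :: real)"
        by (rule order_trans[OF _ exp_ge_Taylor[where n = 3]]) (simp_all add: eval_nat_numeral)
    qed auto
    also have "\<dots> = exp (314/100)" by (simp flip: exp_of_nat_mult exp_add)
    finally have "exp (- (pi * y)) \<le> 1 / (226/10)"
    proof (rule exp_minus_le[rotated])
      have "314/100 \<le> pi * 1" using pi_bounds by simp
      also have "\<dots> \<le> pi * y" using y by (intro mult_left_mono) auto
      finally show "314/100 \<le> pi * y" .
    qed simp
    then show ?thesis by (simp add: s_def)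
  qed
  have s1': "s < 1" using s1 by simp
  define a where "a = eA (of_real (- s))"
  have "cnj a = a" unfolding a_def using eA_cnj[of "of_real (- s)"] s0 s1' by simp
  then obtain b where b: "a = of_real b" by (metis Reals_cases Reals_cnj_iff)
  have "Im (arc_point \<theta>) > 0" using sin_gt_zero[OF assms(1) \<open>\<theta> < pi\<close>] by (simp add: arc_simps)
  from fricke_fv[OF this] have "1 / fv (ee (arc_point \<theta>)) = 4096 * fv (of_real (- s))"
    unfolding fr by (simp add: divide_eq_eq mult_ac)
  also have "\<dots> = of_real (- (4096 * (s * b ^ 24)))" unfolding fv_def a_def[symmetric] b by simp
  finally have x: "1 / fv (ee (arc_point \<theta>)) = of_real (- (4096 * (s * b ^ 24)))" .
  have nb: "norm a ^ 24 = b ^ 24" by (simp add: b power_abs[symmetric])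
  have a_lower: "exp (- (s / ((1 - s) * (1 - s)))) \<le> norm a"
    using qpoch_bounds(1)[of "of_real s" "of_real (- s)"] s0 s1' by (simp add: a_def eA_def)
  have a_upper: "norm a \<le> exp (- s + s\<^sup>2 / ((1 - s\<^sup>2) * (1 - s)))"
  proof -
    have s2: "s\<^sup>2 < 1" using s0 s1' by (simp add: power_less_one_iff)
    have "a = (1 - of_real s) * qpoch (of_real s * of_real (- s)) (of_real (- s))"
      using qpoch_rec[of "of_real s" "of_real (- s)"] s0 s1' by (simp add: a_def eA_def)
    moreover have "norm (1 - complex_of_real s) = 1 - s"
      using s1' by (metis abs_of_nonneg diff_ge_0_iff_ge less_imp_le norm_of_real of_real_1 of_real_diff)
    moreover have "norm (qpoch (of_real s * of_real (- s)) (of_real (- s))) \<le> exp (s\<^sup>2 / ((1 - s\<^sup>2) * (1 - s)))"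
      using qpoch_bounds(2)[of "of_real s * of_real (- s)" "of_real (- s)"] s0 s1' s2
      by (simp add: norm_mult power2_eq_square)
    ultimately have "norm a \<le> (1 - s) * exp (s\<^sup>2 / ((1 - s\<^sup>2) * (1 - s)))"
      using s1' by (simp add: norm_mult mult_left_mono)
    also have "\<dots> \<le> exp (- s) * exp (s\<^sup>2 / ((1 - s\<^sup>2) * (1 - s)))"
      using exp_ge_add_one_self[of "- s"] by (intro mult_right_mono) auto
    finally show ?thesis by (simp only: exp_add)
  qed
  have "- 68 \<le> - (4096 * (s * b ^ 24))"
  proof -
    have e: "s\<^sup>2 / ((1 - s\<^sup>2) * (1 - s)) \<le> (10/226)\<^sup>2 / ((1 - (10/226)\<^sup>2) * (1 - 10/226))"
    proof -
      have "s\<^sup>2 \<le> (10/226)\<^sup>2" using s0 s1 by (intro power_mono) auto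
      moreover have "(10/226)\<^sup>2 < (1 :: real)" by (simp add: power2_eq_square)
      ultimately show ?thesis using s1 by (intro frac_le mult_mono mult_pos_pos) auto
    qed
    have "norm a ^ 24 \<le> exp (- s + s\<^sup>2 / ((1 - s\<^sup>2) * (1 - s))) ^ 24"
      using a_upper by (intro power_mono) auto
    also have "\<dots> = exp (24 * (- s + s\<^sup>2 / ((1 - s\<^sup>2) * (1 - s))))" by (simp flip: exp_of_nat_mult)
    also have "\<dots> \<le> exp (- (24 * s) + 5/100)"
      using e by (simp add: power2_eq_square)
    finally have "b ^ 24 \<le> exp (- (24 * s)) * exp (5/100)" unfolding nb exp_add .
    then have "s * b ^ 24 \<le> s * (exp (- (24 * s)) * exp (5/100))" using s0 by (intro mult_left_mono) auto
    also have "\<dots> = (24 * s * exp (- (24 * s))) / 24 * exp (5/100)" by simp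
    also have "\<dots> \<le> (10/27) / 24 * (20/19)"
    proof (intro mult_mono divide_right_mono)
      have "24 * s \<le> exp (24 * s - 1)" using exp_ge_add_one_self[of "24 * s - 1"] by simp
      also have "\<dots> = exp (24 * s) / exp 1" by (rule exp_diff)
      also have "\<dots> \<le> exp (24 * s) / (27/10)" using exp_1_ge by (intro divide_left_mono) auto
      finally have "24 * s \<le> exp (24 * s) * (10/27)" by simp
      then have "24 * s * exp (- (24 * s)) \<le> exp (24 * s) * (10/27) * exp (- (24 * s))"
        by (intro mult_right_mono) auto
      also have "\<dots> = 10/27" by (simp add: exp_minus)
      finally show "24 * s * exp (- (24 * s)) \<le> 10/27" .
      have "1 - 5/100 \<le> exp (- (5/100) :: real)" using exp_ge_add_one_self[of "- (5/100)"] by simp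
      then show "exp (5/100) \<le> (20/19 :: real)" by (simp add: exp_minus field_simps)
    qed auto
    finally show ?thesis by simp
  qed
  moreover have "- (4096 * (s * b ^ 24)) \<le> - (4096 * exp (- (134/10)))"
  proof -
    have "24 * (s / ((1 - s) * (1 - s))) \<le> 24 * ((10/226) / ((1 - 10/226) * (1 - 10/226)))"
      using s0 s1 by (intro mult_left_mono frac_le mult_mono mult_pos_pos) auto
    also have "\<dots> \<le> 117/100" by simp
    finally have e: "24 * (s / ((1 - s) * (1 - s))) \<le> 117/100" .
    have "pi * y \<le> 31416/10000 * (3873/1000)" using pi_bounds y by (intro mult_mono) auto
    then have "pi * y \<le> 1217/100" by simp
    then have "exp (- (134/10)) \<le> exp (- pi * y - 24 * (s / ((1 - s) * (1 - s))))" using e by simp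
    also have "\<dots> = s * exp (- (24 * (s / ((1 - s) * (1 - s)))))"
      unfolding s_def by (simp only: diff_conv_add_uminus exp_add)
    also have "\<dots> = s * exp (- (s / ((1 - s) * (1 - s)))) ^ 24" by (simp flip: exp_of_nat_mult)
    also have "\<dots> \<le> s * norm a ^ 24" using s0 a_lower by (intro mult_left_mono power_mono) auto
    finally show ?thesis unfolding nb by simp
  qed
  ultimately show ?thesis using x by blast
qed

lemma form_of_cnj:
  assumes "Im z > 0"
  shows "form_of l e c N (- cnj z) = cnj (form_of l e c N z)"
  using norm_ee_less_1[OF assms]
  by (simp add: form_of_def ee_cnj fS_cnj fF_cnj fv_cnj hpoly_def)

text \<open>On the arc the generator acts as the reflection \<open>- cnj\<close>, which conjugates a
  form with real coefficients. Modularity then relates the value to its conjugate by a phase, and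
  half of that phase makes it real.\<close>

lemma form_of_arc_real:
  assumes "0 < \<theta>" "\<theta> < pi" and k: "k = 4 * l + 2 * int e"
  shows "cnj (form_of l e c N (arc_point \<theta>)) = exp (\<i> * of_real (of_int k * \<theta>)) * form_of l e c N (arc_point \<theta>)"
    and "exp (\<i> * of_real (of_int k * \<theta> / 2)) * form_of l e c N (arc_point \<theta>) \<in> \<real>"
proof -
  have i: "Im (arc_point \<theta>) > 0" using assms by (simp add: arc_simps sin_gt_zero)
  have "exp (\<i> * of_real \<theta>) powi k = exp (\<i> * of_real (of_int k * \<theta>))"
    by (simp add: exp_power_int mult_ac)
  then show 1: "cnj (form_of l e c N (arc_point \<theta>)) = exp (\<i> * of_real (of_int k * \<theta>)) * form_of l e c N (arc_point \<theta>)"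
    using form_of_gamma[OF i, of l e c N] form_of_cnj[OF i, of l e c N]
    unfolding arc_gamma(2) unfolding arc_gamma(1) k by simp
  have "cnj (exp (\<i> * of_real (of_int k * \<theta> / 2)) * form_of l e c N (arc_point \<theta>)) =
      exp (- (\<i> * of_real (of_int k * \<theta> / 2))) * exp (\<i> * of_real (of_int k * \<theta>)) * form_of l e c N (arc_point \<theta>)"
    by (simp add: 1 exp_cnj)
  also have "exp (- (\<i> * of_real (of_int k * \<theta> / 2))) * exp (\<i> * of_real (of_int k * \<theta>)) = exp (\<i> * of_real (of_int k * \<theta> / 2))"
    unfolding exp_add[symmetric] by (simp add: field_simps)
  finally show "exp (\<i> * of_real (of_int k * \<theta> / 2)) * form_of l e c N (arc_point \<theta>) \<in> \<real>"
    by (simp add: Reals_cnj_iff)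
qed

section \<open>Explicit constants in the approximation\<close>

lemma norm_fF_le_mono:
  assumes "norm q \<le> R" "R < 1"
  shows "norm (fF q) \<le> 1 + 24 * (R / (1 - R) + R * (1 / (1 - R)\<^sup>2 - 1) / (1 - R\<^sup>2))"
proof -
  define r where "r = norm q"
  have r: "0 \<le> r" "r \<le> R" "r < 1" using assms by (auto simp: r_def)
  have "norm (fF q) \<le> 1 + 24 * (r / (1 - r) + (r / (1 - r)\<^sup>2 - r) / (1 - r\<^sup>2))"
    using norm_fF_le[of q] r by (simp add: r_def)
  also have "r / (1 - r)\<^sup>2 - r = r * (1 / (1 - r)\<^sup>2 - 1)" by (simp add: right_diff_distrib)
  also have "1 + 24 * (r / (1 - r) + r * (1 / (1 - r)\<^sup>2 - 1) / (1 - r\<^sup>2)) \<le>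
      1 + 24 * (R / (1 - R) + R * (1 / (1 - R)\<^sup>2 - 1) / (1 - R\<^sup>2))"
  proof -
    have A: "r / (1 - r) \<le> R / (1 - R)" using r assms by (intro frac_le) auto
    have "(1 - R)\<^sup>2 \<le> 1" "(1 - r)\<^sup>2 \<le> 1" using r assms by (auto intro!: power_le_one)
    then have p: "0 \<le> 1 / (1 - R)\<^sup>2 - 1" "0 \<le> 1 / (1 - r)\<^sup>2 - 1" using r assms by simp_all
    have "1 / (1 - r)\<^sup>2 \<le> 1 / (1 - R)\<^sup>2" using r assms by (intro divide_left_mono power_mono mult_pos_pos) auto
    then have B: "r * (1 / (1 - r)\<^sup>2 - 1) \<le> R * (1 / (1 - R)\<^sup>2 - 1)" using r p by (intro mult_mono) auto
    have "r\<^sup>2 \<le> R\<^sup>2" using r by (intro power_mono) auto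
    moreover have "R\<^sup>2 < 1" using r assms by (simp add: power_less_one_iff)
    moreover have "0 \<le> R * (1 / (1 - R)\<^sup>2 - 1)" using r p by (intro mult_nonneg_nonneg) auto
    ultimately have "r * (1 / (1 - r)\<^sup>2 - 1) / (1 - r\<^sup>2) \<le> R * (1 / (1 - R)\<^sup>2 - 1) / (1 - R\<^sup>2)"
      using B by (intro frac_le) auto
    with A show ?thesis by simp
  qed
  finally show ?thesis .
qed

text \<open>The three radii bound the nome on the arc above \<pi>/6, on the arc with
  \<open>cos \<theta> \<le> 7/8\<close>, and on the circle of integration.\<close>

lemma fF_bounds:
  shows "norm q \<le> 208/1000 \<Longrightarrow> norm (fF q) \<le> 1041/100"
    and "norm q \<le> 2187/10000 \<Longrightarrow> norm (fF q) \<le> 1124/100"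
    and "norm q \<le> 8/25 \<Longrightarrow> norm (fF q) \<le> 2225/100"
  by (rule order_trans[OF norm_fF_le_mono], assumption, simp, simp add: power2_eq_square)+

lemma fG_bounds_mono:
  assumes "norm q \<le> R" "R < 1"
    and E: "R ^ 5 / ((1 - R ^ 5) * (1 - R\<^sup>2)) + R ^ 8 / ((1 - R ^ 8) * (1 - R ^ 4)) \<le> E" "E < 1"
  shows "(1 - R) * (1 - R ^ 3) * (1 - R ^ 4) * (1 - E) \<le> norm (fG q)"
    and "norm (fG q) \<le> (1 + R) * (1 + R ^ 3) * (1 + R ^ 4) * (1 / (1 - E))"
proof -
  define r where "r = norm q"
  define e where "e = r ^ 5 / ((1 - r ^ 5) * (1 - r\<^sup>2)) + r ^ 8 / ((1 - r ^ 8) * (1 - r ^ 4))"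
  have r: "0 \<le> r" "r \<le> R" "r < 1" "norm q < 1" using assms by (auto simp: r_def)
  have pm: "r ^ j \<le> R ^ j" for j using r by (intro power_mono) auto
  have p1: "R ^ j < 1" if "j > 0" for j using r assms that by (simp add: power_less_one_iff)
  have "e \<le> R ^ 5 / ((1 - R ^ 5) * (1 - R\<^sup>2)) + R ^ 8 / ((1 - R ^ 8) * (1 - R ^ 4))"
    unfolding e_def
    by (intro add_mono frac_le mult_mono mult_pos_pos diff_left_mono pm)
      (use r p1[of 5] p1[of 2] p1[of 8] p1[of 4] pm[of 2] pm[of 4] power_le_one[OF r(1), of 5] power_le_one[OF r(1), of 8] in auto)
  then have e: "e \<le> E" using E by linarith
  have "1 - E \<le> exp (- E)" using exp_ge_add_one_self[of "- E"] by simp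
  also have "\<dots> \<le> exp (- e)" using e by simp
  finally have e1: "1 - E \<le> exp (- e)" .
  have e2: "exp e \<le> 1 / (1 - E)"
  proof -
    have "exp e * (1 - E) \<le> exp e * exp (- e)" using e1 by (intro mult_left_mono) auto
    then have "exp e * (1 - E) \<le> 1" by (simp add: exp_minus)
    then show ?thesis using E(2) by (simp add: pos_le_divide_eq)
  qed
  note b = norm_fG_bounds[OF r(4), folded r_def, folded e_def]
  have "(1 - R) * (1 - R ^ 3) * (1 - R ^ 4) * (1 - E) \<le> (1 - r) * (1 - r ^ 3) * (1 - r ^ 4) * exp (- e)"
    by (intro mult_mono e1 diff_left_mono pm mult_nonneg_nonneg)
      (use r assms p1[of 3] p1[of 4] power_le_one[OF r(1), of 3] power_le_one[OF r(1), of 4] in auto)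
  then show "(1 - R) * (1 - R ^ 3) * (1 - R ^ 4) * (1 - E) \<le> norm (fG q)" using b(1) by linarith
  have "(1 + r) * (1 + r ^ 3) * (1 + r ^ 4) * exp e \<le> (1 + R) * (1 + R ^ 3) * (1 + R ^ 4) * (1 / (1 - E))"
    by (intro mult_mono e2 add_left_mono pm mult_nonneg_nonneg) (use r assms in auto)
  then show "norm (fG q) \<le> (1 + R) * (1 + R ^ 3) * (1 + R ^ 4) * (1 / (1 - E))" using b(2) by linarith
qed

lemma fG_bounds:
  shows "norm q \<le> 2187/10000 \<Longrightarrow> 7705/10000 \<le> norm (fG q) \<and> norm (fG q) \<le> 12355/10000"
    and "norm q \<le> 8/25 \<Longrightarrow> 648/1000 \<le> norm (fG q) \<and> norm (fG q) \<le> 13833/10000"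
proof -
  assume q: "norm q \<le> 2187/10000"
  have E: "(2187/10000) ^ 5 / ((1 - (2187/10000) ^ 5) * (1 - (2187/10000)\<^sup>2)) +
      (2187/10000) ^ 8 / ((1 - (2187/10000) ^ 8) * (1 - (2187/10000) ^ 4)) \<le> (54/100000 :: real)"
    by (simp add: power_divide)
  show "7705/10000 \<le> norm (fG q) \<and> norm (fG q) \<le> 12355/10000"
    using fG_bounds_mono[OF q _ E] by (auto simp: power_divide)
next
  assume q: "norm q \<le> 8/25"
  have E: "(8/25) ^ 5 / ((1 - (8/25) ^ 5) * (1 - (8/25)\<^sup>2)) +
      (8/25) ^ 8 / ((1 - (8/25) ^ 8) * (1 - (8/25) ^ 4)) \<le> (387/100000 :: real)"
    by (simp add: power_divide)
  show "648/1000 \<le> norm (fG q) \<and> norm (fG q) \<le> 13833/10000"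
    using fG_bounds_mono[OF q _ E] by (auto simp: power_divide)
qed

text \<open>The two residues are conjugate, and multiplied by the real prefactor they become twice
  the real part of the phase times \<open>q1 powi (- n)\<close>. The factor 5/2 is the inverse of
  the lower bound 2/5 from \<open>circle_lower\<close>.\<close>

lemma arc_approx:
  fixes k l n :: int and e :: nat and c :: "nat \<Rightarrow> real" and w :: "complex \<Rightarrow> complex" and \<theta> Kb :: real
  assumes k: "k = 4 * l + 2 * int e" and e: "e \<le> 1" and n: "n \<ge> - l" and w: "w holomorphic_on ball 0 1"
    and cw: "\<And>q. norm q < 1 \<Longrightarrow> q \<noteq> 0 \<Longrightarrow>
       fF q ^ e * hpoly c (nat (n + l)) (1 / fv q) = (fG q ^ 8) powi (- l) / q ^ nat (n + l) + q * w q"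
    and \<theta>: "0 < \<theta>" "\<theta> < pi / 2" "cos \<theta> \<le> 7/8" and r: "norm (ee (arc_point \<theta>)) < 8/25"
    and Kb: "\<And>q. norm q = 8/25 \<Longrightarrow> norm ((fG q ^ 8) powi (- l) * fF q ^ (1 - e)) \<le> Kb"
  shows "norm (exp (\<i> * of_real (of_int k * \<theta> / 2)) * form_of l e c (nat (n + l)) (arc_point \<theta>)
      - of_real (2 * Re (exp (\<i> * of_real (of_int k * \<theta> / 2)) * ee (arc_point \<theta>) powi (- n))))
     \<le> norm (fS (ee (arc_point \<theta>)) powi l * fF (ee (arc_point \<theta>)) ^ e) * (5/2 * Kb / (8/25) ^ nat (n + l))"
proof -
  define N where "N = nat (n + l)"
  define q1 where "q1 = ee (arc_point \<theta>)"
  define U where "U = fS q1 powi l * fF q1 ^ e"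
  define ph where "ph = exp (\<i> * of_real (of_int k * \<theta> / 2))"
  have ta: "\<theta> < pi" using \<theta> by linarith
  have i: "Im (arc_point \<theta>) > 0" using \<theta>(1) ta by (simp add: arc_simps sin_gt_zero)
  have q1: "norm q1 < 8/25" "norm q1 < 1" "q1 \<noteq> 0" using r by (auto simp: q1_def)
  obtain x where x: "- 68 \<le> x" "x \<le> - (4096 * exp (- (134/10)))" "1 / fv q1 = of_real x"
    using arc_hauptmodul[OF \<theta>(1) _ \<theta>(3)] \<theta>(2) by (auto simp: q1_def)
  have x1: "of_real x * fv q1 = 1" using x(3) q1(3) by (simp add: field_simps)
  have x2: "of_real x * fv (cnj q1) = 1"
    using arg_cong[OF x1, of cnj] fv_cnj[OF q1(2)] by simp
  \<comment> \<open>For an angle strictly below \<pi>/2 the real part of the arc point lies strictly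
    between -1/2 and 0, so its nome is not real. At \<pi>/2 the two poles would coincide.\<close>
  have ne: "q1 \<noteq> cnj q1"
  proof
    assume "q1 = cnj q1"
    then have "Im q1 = 0" by (simp add: complex_eq_iff)
    then have "sin (pi * (cos \<theta> - 1)) = 0" by (simp add: q1_def ee_def Im_exp arc_simps)
    moreover have "cos \<theta> > 0" using \<theta> by (intro cos_gt_zero) auto
    moreover have "cos \<theta> < 1" using \<theta> by linarith
    ultimately have *: "- pi < pi * (cos \<theta> - 1)" "pi * (cos \<theta> - 1) < 0" by (simp_all add: algebra_simps mult_less_0_iff)
    have "pi * (cos \<theta> - 1) < pi" by (rule less_trans[OF *(2) pi_gt_zero])
    from sin_eq_0_pi[OF *(1) this] show False using \<open>sin (pi * (cos \<theta> - 1)) = 0\<close> *(2) by linarith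
  qed
  note tz = two_zeros[OF x(1,2) ne q1(1) _ x1 x2]
  have Z: "{q1, cnj q1} = {q. norm q < 8/25 \<and> of_real x * fv q = 1}" "fF q1 \<noteq> 0"
    using tz q1(1) by auto
  have Fc: "fF (cnj q1) = cnj (fF q1)" by (rule fF_cnj[OF q1(2)])
  have Sc: "fS (cnj q1) = cnj (fS q1)" by (rule fS_cnj[OF q1(2)])
  have Kb0: "Kb \<ge> 0" by (rule order_trans[OF norm_ge_zero Kb[of "8/25"]]) simp
  have "norm (hpoly c N (of_real x) - (\<Sum>q\<in>{q1, cnj q1}. fS q powi (- l) * q powi (- n) / fF q ^ e))
      \<le> (5/2 * Kb / (8/25) ^ Suc N) * (8/25)"
    unfolding N_def
  proof (rule kernel_formula[OF e n w cw _ _ Z(1)])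
    show "fF q \<noteq> 0" if "q \<in> {q1, cnj q1}" for q using that Z(2) Fc by auto
    show "of_real x * fv q \<noteq> 1" if "norm q = 8/25" for q
      using circle_lower[OF x(1,2) that] by auto
    show "norm (form_kernel l n e (of_real x) q) \<le> 5/2 * Kb / (8/25) ^ Suc (nat (n + l))" if "norm q = 8/25" for q
    proof -
      have "norm (form_kernel l n e (of_real x) q) =
          norm ((fG q ^ 8) powi (- l) * fF q ^ (1 - e)) / (8/25) ^ Suc (nat (n + l)) / norm (1 - of_real x * fv q)"
        unfolding form_kernel_def by (simp only: norm_divide norm_power that)
      also have "\<dots> \<le> Kb / (8/25) ^ Suc (nat (n + l)) / (2/5)"
        using circle_lower[OF x(1,2) that] Kb[OF that] Kb0 by (intro frac_le divide_right_mono) auto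
      finally show ?thesis by simp
    qed
  qed (use Kb0 in auto)
  moreover have "(5/2 * Kb / (8/25) ^ Suc N) * (8/25) = 5/2 * Kb / (8/25) ^ N" by simp
  moreover have "(\<Sum>q\<in>{q1, cnj q1}. fS q powi (- l) * q powi (- n) / fF q ^ e) =
      q1 powi (- n) / U + cnj (q1 powi (- n) / U)"
    using ne by (simp add: U_def Fc Sc power_int_minus divide_inverse mult_ac)
  ultimately have h: "norm (hpoly c N (of_real x) - (q1 powi (- n) / U + cnj (q1 powi (- n) / U))) \<le> 5/2 * Kb / (8/25) ^ N"
    by simp
  have Unz: "U \<noteq> 0" using Z(2) q1(3) by (simp add: U_def)
  have f: "form_of l e c N (arc_point \<theta>) = U * hpoly c N (of_real x)"
    by (simp add: form_of_def U_def q1_def[symmetric] x(3))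
  \<comment> \<open>\<open>U\<close> is the value of the form of the same weight with constant
    polynomial 1, so \<open>form_of_arc_real\<close> makes its product with the phase real.\<close>
  have Ur: "cnj (ph * U) = ph * U"
  proof -
    have "form_of l e (\<lambda>_. 1) 0 (arc_point \<theta>) = U" by (simp add: form_of_def U_def q1_def hpoly_def)
    then have "ph * U \<in> \<real>" using form_of_arc_real(2)[OF \<theta>(1) ta k, of "\<lambda>_. 1" 0] by (simp add: ph_def)
    then show ?thesis by (simp add: Reals_cnj_iff)
  qed
  have nph: "norm ph = 1" by (simp add: ph_def norm_exp_eq_Re)
  have "ph * U * (q1 powi (- n) / U + cnj (q1 powi (- n) / U)) = of_real (2 * Re (ph * q1 powi (- n)))"
  proof -
    have "ph * U * cnj (q1 powi (- n) / U) = cnj (ph * U) * cnj (q1 powi (- n) / U)" by (simp only: Ur)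
    also have "\<dots> = cnj (ph * q1 powi (- n))" using Unz by simp
    finally have "ph * U * cnj (q1 powi (- n) / U) = cnj (ph * q1 powi (- n))" .
    moreover have "ph * U * (q1 powi (- n) / U) = ph * q1 powi (- n)" using Unz by simp
    ultimately have "ph * U * (q1 powi (- n) / U + cnj (q1 powi (- n) / U)) = ph * q1 powi (- n) + cnj (ph * q1 powi (- n))"
      by (simp only: distrib_left)
    then show ?thesis by (simp only: complex_add_cnj)
  qed
  then have "ph * form_of l e c N (arc_point \<theta>) - of_real (2 * Re (ph * q1 powi (- n))) =
      ph * U * (hpoly c N (of_real x) - (q1 powi (- n) / U + cnj (q1 powi (- n) / U)))"
    unfolding f by (simp only: right_diff_distrib mult.assoc)
  then have "norm (ph * form_of l e c N (arc_point \<theta>) - of_real (2 * Re (ph * q1 powi (- n)))) =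
      norm U * norm (hpoly c N (of_real x) - (q1 powi (- n) / U + cnj (q1 powi (- n) / U)))"
    by (simp add: norm_mult nph)
  also have "\<dots> \<le> norm U * (5/2 * Kb / (8/25) ^ N)" using h by (intro mult_left_mono) auto
  finally show ?thesis by (simp only: ph_def U_def q1_def N_def)
qed

lemma arc_main_term:
  fixes n k :: int
  shows "Re (exp (\<i> * of_real (of_int k * \<theta> / 2)) * ee (arc_point \<theta>) powi (- n)) =
    exp (pi * of_int n * sin \<theta>) * cos (pi * (of_int n * (cos \<theta> - 1) - of_int k * \<theta> / (2 * pi)))"
proof -
  have "ee (arc_point \<theta>) powi (- n) = exp (of_int (- n) * (2 * of_real pi * \<i> * arc_point \<theta>))"
    unfolding ee_def by (simp only: exp_power_int mult.commute)
  then have "exp (\<i> * of_real (of_int k * \<theta> / 2)) * ee (arc_point \<theta>) powi (- n) =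
      exp (\<i> * of_real (of_int k * \<theta> / 2) + of_int (- n) * (2 * of_real pi * \<i> * arc_point \<theta>))"
    by (simp only: exp_add)
  moreover have "Re (\<i> * of_real (of_int k * \<theta> / 2) + of_int (- n) * (2 * of_real pi * \<i> * arc_point \<theta>)) = pi * of_int n * sin \<theta>"
    by (simp add: arc_simps)
  moreover have "Im (\<i> * of_real (of_int k * \<theta> / 2) + of_int (- n) * (2 * of_real pi * \<i> * arc_point \<theta>)) =
      - (pi * (of_int n * (cos \<theta> - 1) - of_int k * \<theta> / (2 * pi)))"
    by (simp add: arc_simps field_simps)
  ultimately show ?thesis by (simp only: Re_exp cos_minus)
qed

lemma power_int_nat_abs: "(x :: real) powi l = (if l \<ge> 0 then x ^ nat \<bar>l\<bar> else (1 / x) ^ nat \<bar>l\<bar>)"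
  by (simp add: power_int_def inverse_eq_divide)

text \<open>The quotient of \<open>fG\<close> at \<open>q1\<close> and on the circle costs a
  constant to the power \<open>L\<close>. Of the \<open>nat (n + l)\<close> factors
  \<open>norm q1 * 25/8\<close>, a share of 15 per unit of \<open>l\<close>, or 14 for negative
  \<open>l\<close>, brings this below \<open>(3/5) ^ L\<close>, and \<open>M\<close> factors are
  left. In terms of \<open>n\<close> the requirement is \<open>n \<ge> 14 * l + M\<close> or
  \<open>n \<ge> 15 * \<bar>l\<bar> + M\<close>.\<close>

lemma arc_error_bound:
  fixes l n :: int and e M :: nat
  assumes r: "norm q1 \<le> 2187/10000" "q1 \<noteq> 0" and e: "e \<le> 1" and n: "n \<ge> - l"
    and M: "(l \<ge> 0 \<and> int M + 15 * l \<le> n + l) \<or> (l < 0 \<and> int M + 14 * \<bar>l\<bar> \<le> n + l)"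
  defines "L \<equiv> nat \<bar>l\<bar>"
  defines "Fs \<equiv> (if e = 0 then 2225/100 else 1 :: real)"
  defines "Kb \<equiv> (if l \<ge> 0 then (1 / (648/1000) ^ 8) ^ L else ((13833/10000) ^ 8) ^ L) * Fs"
  shows "\<And>q. norm q = 8/25 \<Longrightarrow> norm ((fG q ^ 8) powi (- l) * fF q ^ (1 - e)) \<le> Kb"
    and "norm (fS q1 powi l * fF q1 ^ e) * (5/2 * Kb / (8/25) ^ nat (n + l)) * norm q1 powi n
      \<le> 5/2 * Fs * norm (fF q1) ^ e * (norm q1 * 25/8) ^ M * (3/5) ^ L"
proof -
  have Fs: "Fs > 0" by (simp add: Fs_def)
  show "norm ((fG q ^ 8) powi (- l) * fF q ^ (1 - e)) \<le> Kb" if q: "norm q = 8/25" for q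
  proof -
    have G: "648/1000 \<le> norm (fG q)" "norm (fG q) \<le> 13833/10000" using fG_bounds(2)[of q] q by auto
    then have Gp: "norm (fG q) > 0" by simp
    have "norm (fF q ^ (1 - e)) \<le> Fs"
      using e fF_bounds(3)[of q] q by (cases "e = 0") (auto simp: Fs_def)
    moreover have "norm ((fG q ^ 8) powi (- l)) \<le> (if l \<ge> 0 then (1 / (648/1000) ^ 8) ^ L else ((13833/10000) ^ 8) ^ L)"
    proof (cases "l \<ge> 0")
      case True
      have "norm ((fG q ^ 8) powi (- l)) = (1 / norm (fG q) ^ 8) ^ L"
        using True by (simp add: norm_power_int norm_power power_int_def L_def norm_inverse norm_divide inverse_eq_divide)
      also have "\<dots> \<le> (1 / (648/1000) ^ 8) ^ L"
        using G Gp by (intro power_mono divide_left_mono mult_pos_pos zero_less_power) auto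
      finally show ?thesis using True by simp
    next
      case False
      have "norm ((fG q ^ 8) powi (- l)) = (norm (fG q) ^ 8) ^ L"
        using False by (simp add: norm_power_int norm_power power_int_def L_def)
      also have "\<dots> \<le> ((13833/10000) ^ 8) ^ L" using G by (intro power_mono) auto
      finally show ?thesis using False by simp
    qed
    ultimately show ?thesis unfolding norm_mult Kb_def by (intro mult_mono) auto
  qed
  define r1 g N where "r1 = norm q1" and "g = norm (fG q1)" and "N = nat (n + l)"
  have r1: "0 < r1" "r1 \<le> 2187/10000" using r by (auto simp: r1_def)
  have g: "7705/10000 \<le> g" "g \<le> 12355/10000" using fG_bounds(1)[OF r(1)] by (auto simp: g_def)
  have N: "r1 powi l * r1 powi n = r1 ^ N"
    using n r1 by (simp add: N_def power_int_add[symmetric]) (simp add: power_int_def add.commute)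
  define \<sigma> where "\<sigma> = r1 * 25/8"
  have \<sigma>: "0 < \<sigma>" "\<sigma> \<le> 54675/80000" using r1 by (auto simp: \<sigma>_def)
  have rN: "r1 ^ N / (8/25) ^ N = \<sigma> ^ N" by (simp add: \<sigma>_def power_divide[symmetric])
  have "norm (fS q1 powi l * fF q1 ^ e) * (5/2 * Kb / (8/25) ^ N) * r1 powi n =
     5/2 * Fs * norm (fF q1) ^ e * ((g ^ 8) powi l * (Kb / Fs) * \<sigma> ^ N)"
  proof -
    have "norm (fS q1 powi l * fF q1 ^ e) = r1 powi l * (g ^ 8) powi l * norm (fF q1) ^ e"
      by (simp add: fS_def norm_mult norm_power norm_power_int power_int_mult_distrib r1_def g_def)
    then have "norm (fS q1 powi l * fF q1 ^ e) * (5/2 * Kb / (8/25) ^ N) * r1 powi n =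
        5/2 * (norm (fF q1) ^ e * ((g ^ 8) powi l * (Kb * ((r1 powi l * r1 powi n) / (8/25) ^ N))))"
      by (simp only: times_divide_eq_left times_divide_eq_right mult_ac)
    also have "\<dots> = 5/2 * (norm (fF q1) ^ e * ((g ^ 8) powi l * (Kb * \<sigma> ^ N)))" unfolding N rN ..
    finally show ?thesis using Fs by simp
  qed
  also have "\<dots> \<le> 5/2 * Fs * norm (fF q1) ^ e * (\<sigma> ^ M * (3/5) ^ L)"
  proof (rule mult_left_mono)
    show "(g ^ 8) powi l * (Kb / Fs) * \<sigma> ^ N \<le> \<sigma> ^ M * (3/5) ^ L"
    proof (cases "l \<ge> 0")
      case True
      have NM: "M + 15 * L \<le> N" using True M by (auto simp: N_def L_def)
      have "(g ^ 8) powi l * (Kb / Fs) * \<sigma> ^ N = ((g ^ 8) * (1 / (648/1000) ^ 8)) ^ L * \<sigma> ^ N"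
      proof -
        have "(g ^ 8) powi l = (g ^ 8) ^ L" using True unfolding power_int_nat_abs L_def by simp
        moreover have "Kb / Fs = (1 / (648/1000) ^ 8) ^ L" using True Fs by (simp add: Kb_def)
        ultimately show ?thesis by (simp only: power_mult_distrib)
      qed
      also have "\<dots> \<le> ((g ^ 8) * (1 / (648/1000) ^ 8)) ^ L * \<sigma> ^ (M + 15 * L)"
        using \<sigma> g NM by (intro mult_left_mono power_decreasing) auto
      also have "\<sigma> ^ (M + 15 * L) = \<sigma> ^ M * (\<sigma> ^ 15) ^ L" by (simp only: power_add power_mult)
      also have "((g ^ 8) * (1 / (648/1000) ^ 8)) ^ L * \<dots> = \<sigma> ^ M * ((g ^ 8) * (1 / (648/1000) ^ 8) * \<sigma> ^ 15) ^ L"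
        by (simp only: power_mult_distrib mult_ac)
      also have "\<dots> \<le> \<sigma> ^ M * (3/5) ^ L"
      proof (intro mult_left_mono power_mono)
        have "(g ^ 8) * (1 / (648/1000) ^ 8) * \<sigma> ^ 15 \<le> ((12355/10000) ^ 8) * (1 / (648/1000) ^ 8) * (54675/80000) ^ 15"
          using g \<sigma> by (intro mult_mono power_mono) auto
        also have "\<dots> \<le> 3/5" by (simp add: power_divide)
        finally show "(g ^ 8) * (1 / (648/1000) ^ 8) * \<sigma> ^ 15 \<le> 3/5" .
      qed (use g \<sigma> in auto)
      finally show ?thesis .
    next
      case False
      have NM: "M + 14 * L \<le> N" using False M by (auto simp: N_def L_def)
      have "(g ^ 8) powi l * (Kb / Fs) * \<sigma> ^ N = ((1 / g ^ 8) * (13833/10000) ^ 8) ^ L * \<sigma> ^ N"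
      proof -
        have "(g ^ 8) powi l = (1 / g ^ 8) ^ L" using False unfolding power_int_nat_abs L_def by simp
        moreover have "Kb / Fs = ((13833/10000) ^ 8) ^ L" using False Fs by (simp add: Kb_def)
        ultimately show ?thesis by (simp only: power_mult_distrib)
      qed
      also have "\<dots> \<le> ((1 / g ^ 8) * (13833/10000) ^ 8) ^ L * \<sigma> ^ (M + 14 * L)"
        using \<sigma> g NM by (intro mult_left_mono power_decreasing) auto
      also have "\<sigma> ^ (M + 14 * L) = \<sigma> ^ M * (\<sigma> ^ 14) ^ L" by (simp only: power_add power_mult)
      also have "((1 / g ^ 8) * (13833/10000) ^ 8) ^ L * \<dots> = \<sigma> ^ M * ((1 / g ^ 8) * (13833/10000) ^ 8 * \<sigma> ^ 14) ^ L"
        by (simp only: power_mult_distrib mult_ac)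
      also have "\<dots> \<le> \<sigma> ^ M * (3/5) ^ L"
      proof (intro mult_left_mono power_mono)
        have "(1 / g ^ 8) * (13833/10000) ^ 8 * \<sigma> ^ 14 \<le> (1 / (7705/10000) ^ 8) * (13833/10000) ^ 8 * (54675/80000) ^ 14"
          using g \<sigma> by (intro mult_mono power_mono divide_left_mono mult_pos_pos zero_less_power) auto
        also have "\<dots> \<le> 3/5" by (simp add: power_divide)
        finally show "(1 / g ^ 8) * (13833/10000) ^ 8 * \<sigma> ^ 14 \<le> 3/5" .
      qed (use g \<sigma> in auto)
      finally show ?thesis .
    qed
  qed (use Fs in auto)
  finally show "norm (fS q1 powi l * fF q1 ^ e) * (5/2 * Kb / (8/25) ^ nat (n + l)) * norm q1 powi n
      \<le> 5/2 * Fs * norm (fF q1) ^ e * (norm q1 * 25/8) ^ M * (3/5) ^ L"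
    by (simp add: r1_def N_def \<sigma>_def mult.assoc)
qed

lemma arc_radius:
  assumes "0 < \<theta>" "\<theta> \<le> pi / 2"
  shows "cos \<theta> \<le> 7/8 \<Longrightarrow> norm (ee (arc_point \<theta>)) \<le> 2187/10000"
    and "pi / 6 \<le> \<theta> \<Longrightarrow> norm (ee (arc_point \<theta>)) \<le> 208/1000 \<and> cos \<theta> \<le> 7/8"
proof -
  have s0: "0 \<le> sin \<theta>" "0 \<le> cos \<theta>" using assms by (auto intro: sin_ge_zero cos_ge_zero)
  show "norm (ee (arc_point \<theta>)) \<le> 2187/10000" if "cos \<theta> \<le> 7/8"
  proof -
    have "(cos \<theta>)\<^sup>2 \<le> (7/8)\<^sup>2" using that s0 by (intro power_mono) auto
    then have "(4841/10000)\<^sup>2 \<le> (sin \<theta>)\<^sup>2"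
      using sin_cos_squared_add[of \<theta>] by (simp add: power2_eq_square)
    then have "4841/10000 \<le> sin \<theta>" using s0(1) by (rule power2_le_imp_le)
    then have "31415/10000 * (4841/10000) \<le> pi * sin \<theta>" using pi_bounds by (intro mult_mono) auto
    then have 1: "15207/10000 \<le> pi * sin \<theta>" by simp
    have "10000/2187 \<le> exp (15207/10000 :: real)"
      by (rule order_trans[OF _ exp_ge_Taylor[where n = 12]]) (simp_all add: eval_nat_numeral)
    from exp_minus_le[OF _ this 1] show ?thesis by (simp add: norm_ee_arc)
  qed
  show "norm (ee (arc_point \<theta>)) \<le> 208/1000 \<and> cos \<theta> \<le> 7/8" if "pi / 6 \<le> \<theta>"
  proof
    have "sin (pi / 6) \<le> sin \<theta>" using that assms by (intro sin_monotone_2pi_le) auto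
    then have "pi * (1/2) \<le> pi * sin \<theta>" by (intro mult_left_mono) (auto simp: sin_30)
    moreover have "157075/100000 \<le> pi * (1/2)" using pi_bounds by simp
    ultimately have 1: "157075/100000 \<le> pi * sin \<theta>" by (rule order_trans[rotated])
    have "1000/208 \<le> exp (157075/100000 :: real)"
      by (rule order_trans[OF _ exp_ge_Taylor[where n = 12]]) (simp_all add: eval_nat_numeral)
    from exp_minus_le[OF _ this 1] show "norm (ee (arc_point \<theta>)) \<le> 208/1000" by (simp add: norm_ee_arc)
    have "cos \<theta> \<le> cos (pi / 6)" using that assms by (intro cos_monotone_0_pi_le) auto
    moreover have "sqrt 3 \<le> 7/4" by (rule real_le_lsqrt) (simp_all add: power2_eq_square)
    ultimately show "cos \<theta> \<le> 7/8" by (simp add: cos_30)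
  qed
qed

text \<open>By \<open>arc_main_term\<close>, \<pi> times the phase is minus an argument of the main
  term; the sign makes the phase grow as the angle decreases from \<pi>/2.\<close>

definition arc_phase :: "int \<Rightarrow> int \<Rightarrow> real \<Rightarrow> real" where
  "arc_phase k n \<theta> = of_int n * (cos \<theta> - 1) - of_int k * \<theta> / (2 * pi)"

definition arc_value :: "int \<Rightarrow> int \<Rightarrow> (complex \<Rightarrow> complex) \<Rightarrow> real \<Rightarrow> real" where
  "arc_value k n f \<theta> = Re (exp (\<i> * of_real (of_int k * \<theta> / 2)) * f (arc_point \<theta>)) * exp (- pi * of_int n * sin \<theta>)"

lemma arc_estimate:
  fixes k l n :: int and e M :: nat and c :: "nat \<Rightarrow> real" and w :: "complex \<Rightarrow> complex"
  assumes k: "k = 4 * l + 2 * int e" and e: "e \<le> 1" and n: "n \<ge> - l" and w: "w holomorphic_on ball 0 1"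
    and cw: "\<And>q. norm q < 1 \<Longrightarrow> q \<noteq> 0 \<Longrightarrow>
       fF q ^ e * hpoly c (nat (n + l)) (1 / fv q) = (fG q ^ 8) powi (- l) / q ^ nat (n + l) + q * w q"
    and M: "(l \<ge> 0 \<and> int M + 15 * l \<le> n + l) \<or> (l < 0 \<and> int M + 14 * \<bar>l\<bar> \<le> n + l)"
    and \<theta>: "0 < \<theta>" "\<theta> < pi / 2" "cos \<theta> \<le> 7/8"
  shows "\<bar>arc_value k n (form_of l e c (nat (n + l))) \<theta> - 2 * cos (pi * arc_phase k n \<theta>)\<bar>
    \<le> 5/2 * (if e = 0 then 2225/100 else 1) * norm (fF (ee (arc_point \<theta>))) ^ e * (norm (ee (arc_point \<theta>)) * 25/8) ^ M * (3/5) ^ nat \<bar>l\<bar>"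
proof -
  let ?q = "ee (arc_point \<theta>)"
  let ?ph = "exp (\<i> * of_real (of_int k * \<theta> / 2))"
  define F where "F = form_of l e c (nat (n + l)) (arc_point \<theta>)"
  define E where "E = exp (- pi * of_int n * sin \<theta>)"
  have r: "norm ?q \<le> 2187/10000" using arc_radius(1)[OF \<theta>(1) _ \<theta>(3)] \<theta>(2) by simp
  have r': "norm ?q < 8/25" using r by simp
  note eb = arc_error_bound[OF r ee_nonzero e n M]
  have "norm (?ph * F - of_real (2 * Re (?ph * ?q powi (- n)))) \<le>
     norm (fS ?q powi l * fF ?q ^ e) * (5/2 * ((if l \<ge> 0 then (1 / (648/1000) ^ 8) ^ nat \<bar>l\<bar> else ((13833/10000) ^ 8) ^ nat \<bar>l\<bar>)
        * (if e = 0 then 2225/100 else 1)) / (8/25) ^ nat (n + l))" (is "?L \<le> ?R")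
    unfolding F_def by (rule arc_approx[OF k e n w cw \<theta> r' eb(1)])
  moreover have "\<bar>Re (?ph * F) - 2 * Re (?ph * ?q powi (- n))\<bar> \<le> ?L"
    using abs_Re_le_cmod[of "?ph * F - of_real (2 * Re (?ph * ?q powi (- n)))"] by simp
  ultimately have "\<bar>Re (?ph * F) - 2 * Re (?ph * ?q powi (- n))\<bar> \<le> ?R" by linarith
  then have "\<bar>Re (?ph * F) - 2 * Re (?ph * ?q powi (- n))\<bar> * E \<le> ?R * E"
    by (intro mult_right_mono) (auto simp: E_def)
  also have "E = norm ?q powi n"
    by (simp add: E_def norm_ee_arc exp_power_int mult_ac)
  also have "?R * norm ?q powi n \<le> 5/2 * (if e = 0 then 2225/100 else 1) * norm (fF ?q) ^ e * (norm ?q * 25/8) ^ M * (3/5) ^ nat \<bar>l\<bar>"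
    by (rule eb(2))
  finally have b: "\<bar>Re (?ph * F) - 2 * Re (?ph * ?q powi (- n))\<bar> * norm ?q powi n \<le>
     5/2 * (if e = 0 then 2225/100 else 1) * norm (fF ?q) ^ e * (norm ?q * 25/8) ^ M * (3/5) ^ nat \<bar>l\<bar>" .
  have "exp (pi * of_int n * sin \<theta>) * E = 1" by (simp add: E_def flip: exp_add)
  then have m: "2 * Re (?ph * ?q powi (- n)) * E = 2 * cos (pi * arc_phase k n \<theta>)"
    unfolding arc_main_term arc_phase_def by (simp add: mult_ac)
  have "arc_value k n (form_of l e c (nat (n + l))) \<theta> - 2 * cos (pi * arc_phase k n \<theta>) =
     (Re (?ph * F) - 2 * Re (?ph * ?q powi (- n))) * E"
    unfolding left_diff_distrib m by (simp only: arc_value_def F_def E_def)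
  then have "\<bar>arc_value k n (form_of l e c (nat (n + l))) \<theta> - 2 * cos (pi * arc_phase k n \<theta>)\<bar> =
     \<bar>Re (?ph * F) - 2 * Re (?ph * ?q powi (- n))\<bar> * E"
    by (simp only: abs_mult) (simp add: E_def)
  then show ?thesis using b \<open>E = norm ?q powi n\<close> by simp
qed

section \<open>Counting sign changes\<close>

lemma alternating_zeros:
  fixes G :: "real \<Rightarrow> real" and t :: "nat \<Rightarrow> real"
  assumes cont: "continuous_on {a..b} G"
    and t: "\<And>j. j \<le> J \<Longrightarrow> a \<le> t j \<and> t j \<le> b" and dec: "\<And>j. j < J \<Longrightarrow> t (Suc j) < t j"
    and alt: "\<And>j. j \<le> J \<Longrightarrow> s * (- 1) ^ j * G (t j) > 0"
  shows "\<exists>Z. finite Z \<and> card Z = J \<and> Z \<subseteq> {a<..<b} \<and> (\<forall>x\<in>Z. G x = 0)"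
proof -
  have "\<exists>x. t (Suc j) < x \<and> x < t j \<and> G x = 0" if j: "j < J" for j
  proof -
    define H where "H x = s * (- 1) ^ j * G x" for x
    have "continuous_on {t (Suc j)..t j} H"
      unfolding H_def using t[of j] t[of "Suc j"] j
      by (intro continuous_intros continuous_on_subset[OF cont]) auto
    moreover have H0: "H (t j) > 0" using alt[of j] j by (simp add: H_def)
    moreover have H1: "H (t (Suc j)) < 0" using alt[of "Suc j"] j by (simp add: H_def)
    ultimately obtain x where x: "t (Suc j) \<le> x" "x \<le> t j" "H x = 0"
      using IVT'[of H "t (Suc j)" 0 "t j"] dec[OF j] by auto
    moreover have "x \<noteq> t j" "x \<noteq> t (Suc j)" using x(3) H0 H1 by auto
    moreover have "s \<noteq> 0" using alt[of j] j by auto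
    ultimately show ?thesis by (intro exI[of _ x]) (auto simp: H_def)
  qed
  then obtain z where z: "\<And>j. j < J \<Longrightarrow> t (Suc j) < z j \<and> z j < t j \<and> G (z j) = 0" by metis
  have tmono: "t j \<le> t i" if "i \<le> j" "j \<le> J" for i j
    using that by (induction rule: dec_induct) (use dec less_eq_Suc_le in \<open>force+\<close>)
  have "inj_on z {..<J}"
  proof (rule linorder_inj_onI)
    fix i j assume ij: "i < j" "i \<in> {..<J}" "j \<in> {..<J}"
    have "z j < t j" "t j \<le> t (Suc i)" "t (Suc i) < z i" using z[of j] z[of i] tmono[of "Suc i" j] ij by auto
    then show "z i \<noteq> z j" by simp
  qed auto
  then have "card (z ` {..<J}) = J" by (simp add: card_image)
  moreover have "z ` {..<J} \<subseteq> {a<..<b}"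
  proof
    fix x assume "x \<in> z ` {..<J}"
    then obtain j where j: "j < J" "x = z j" by auto
    then show "x \<in> {a<..<b}" using z[of j] t[of j] t[of "Suc j"] by auto
  qed
  ultimately show ?thesis using z by (intro exI[of _ "z ` {..<J}"]) auto
qed

lemma arc_inj: "inj_on arc_point {0<..pi}"
proof (rule inj_onI)
  fix x y assume xy: "x \<in> {0<..pi}" "y \<in> {0<..pi}" "arc_point x = arc_point y"
  then have "cos x = cos y" using arc_simps(1)[of x] arc_simps(1)[of y] by simp
  then show "x = y" using xy cos_inj_pi[of x y] by auto
qed

lemma arc_uhp: "0 < \<theta> \<Longrightarrow> \<theta> < pi \<Longrightarrow> Im (arc_point \<theta>) > 0"
  by (simp add: arc_simps sin_gt_zero)

lemma arc_domain:
  assumes "0 < \<theta>" "\<theta> \<le> pi / 2"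
  shows "arc_point \<theta> \<in> fundamental_domain_2 \<inter> lower_boundary_2"
proof -
  have c: "cos \<theta> < 1" "0 \<le> cos \<theta>" using assms cos_monotone_0_pi[of 0 \<theta>] by (auto intro: cos_ge_zero)
  have "arc_point \<theta> + 1/2 = 1/2 * exp (\<i> * of_real \<theta>)" by (simp add: arc_point_def)
  then have 1: "norm (arc_point \<theta> + 1/2) = 1/2" by (simp only: norm_mult norm_exp_i_times) simp
  have "(norm (arc_point \<theta> - 1/2))\<^sup>2 = ((cos \<theta> - 2) / 2)\<^sup>2 + (sin \<theta> / 2)\<^sup>2"
    unfolding cmod_power2 by (simp add: arc_simps diff_divide_distrib)
  also have "\<dots> = ((sin \<theta>)\<^sup>2 + (cos \<theta>)\<^sup>2 - 4 * cos \<theta> + 4) / 4"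
    by (simp add: power_divide power2_diff field_simps)
  also have "\<dots> > (1/2)\<^sup>2" unfolding sin_cos_squared_add using c by (simp add: power2_eq_square)
  finally have 2: "norm (arc_point \<theta> - 1/2) > 1/2" by (rule power2_less_imp_less) simp
  have "arc_point \<theta> \<in> lower_boundary_2" using assms by (auto simp: lower_boundary_2_def arc_point_def)
  moreover have "arc_point \<theta> \<in> fundamental_domain_2"
    unfolding fundamental_domain_2_def using 1 2 c arc_uhp[of \<theta>] assms by (simp add: uhp_iff arc_simps)
  ultimately show ?thesis by blast
qed

lemma lower_boundary_eq: "lower_boundary_2 = arc_point ` {0<..pi/2}"
  by (simp add: lower_boundary_2_def arc_point_def[abs_def])

text \<open>A sum over an infinite set is 0, so counting zeros requires their finiteness. The arc
  runs into the cusp 0 and is not compact in the upper half plane, but its Fricke image has nomes in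
  the disc of radius \<open>exp (- pi)\<close>, where a nonzero holomorphic function has finitely
  many zeros.\<close>

lemma finite_arc_zeros:
  assumes \<theta>0: "0 < \<theta>0" "\<theta>0 \<le> pi / 2" "form_of l e c N (arc_point \<theta>0) \<noteq> 0"
  shows "finite {z \<in> lower_boundary_2. form_of l e c N z = 0}"
proof -
  define h where "h q = fF q ^ e * hpoly c N (4096 * fv q)" for q
  have hol: "h holomorphic_on ball 0 1"
    unfolding h_def[abs_def] by (intro holomorphic_intros fF_holomorphic fv_holomorphic)
  define u where "u z = ee (- 1 / (2 * z))" for z
  have iff: "form_of l e c N z = 0 \<longleftrightarrow> h (u z) = 0" if "Im z > 0" for z
  proof -
    have nz: "z \<noteq> 0" using that by auto
    have F: "fF (u z) = - 2 * z\<^sup>2 * fF (ee z)" unfolding u_def by (rule fricke_fF[OF that])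
    have v: "4096 * fv (u z) = 1 / fv (ee z)" using fricke_fv'[OF that] by (simp add: u_def)
    show ?thesis unfolding h_def F v form_of_def using nz by (simp add: power_int_eq_0_iff)
  qed
  have ub: "u z \<in> cball 0 (exp (- pi))" "Im z > 0" if "z \<in> lower_boundary_2" for z
  proof -
    obtain t where t: "0 < t" "t \<le> pi / 2" "z = arc_point t" using \<open>z \<in> lower_boundary_2\<close> by (auto simp: lower_boundary_eq)
    have tp: "t < pi" using t by linarith
    show "Im z > 0" using arc_uhp[of t] t tp by simp
    have "pi * 1 \<le> pi * (sin t / (1 - cos t))" using sin_div_bounds(1)[OF t(1,2)] by (intro mult_left_mono) auto
    then show "u z \<in> cball 0 (exp (- pi))" unfolding u_def t(3) arc_fricke[OF t(1) tp] by simp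
  qed
  have inj: "inj_on u lower_boundary_2"
  proof (rule inj_onI)
    fix z1 z2 assume z: "z1 \<in> lower_boundary_2" "z2 \<in> lower_boundary_2" "u z1 = u z2"
    then obtain t1 t2 where t: "0 < t1" "t1 \<le> pi / 2" "z1 = arc_point t1" "0 < t2" "t2 \<le> pi / 2" "z2 = arc_point t2"
      by (auto simp: lower_boundary_eq)
    have tp: "t1 < pi" "t2 < pi" using t by linarith+
    have c: "cos t1 < 1" "cos t2 < 1" using t tp cos_monotone_0_pi[of 0 t1] cos_monotone_0_pi[of 0 t2] by auto
    have "complex_of_real (- exp (- pi * (sin t1 / (1 - cos t1)))) = complex_of_real (- exp (- pi * (sin t2 / (1 - cos t2))))"
      using z(3) unfolding u_def t(3,6) arc_fricke[OF t(1) tp(1)] arc_fricke[OF t(4) tp(2)] .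
    then have "exp (- pi * (sin t1 / (1 - cos t1))) = exp (- pi * (sin t2 / (1 - cos t2)))"
      by (simp only: of_real_eq_iff neg_equal_iff_equal)
    then have "- pi * (sin t1 / (1 - cos t1)) = - pi * (sin t2 / (1 - cos t2))" by (simp only: exp_inj_iff)
    then have y: "sin t1 / (1 - cos t1) = sin t2 / (1 - cos t2)" unfolding mult_cancel_left by simp
    have sq: "(sin t / (1 - cos t))\<^sup>2 = 2 / (1 - cos t) - 1" if "cos t < 1" for t :: real
    proof -
      have "(sin t)\<^sup>2 = (1 - cos t) * (1 + cos t)"
        using sin_cos_squared_add[of t] by (simp add: power2_eq_square algebra_simps)
      then have "(sin t / (1 - cos t))\<^sup>2 = (1 + cos t) / (1 - cos t)"
        using that by (simp add: power_divide power2_eq_square)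
      also have "\<dots> = 2 / (1 - cos t) - 1" using that by (simp add: field_simps)
      finally show ?thesis .
    qed
    have "2 / (1 - cos t1) = 2 / (1 - cos t2)" using y sq[OF c(1)] sq[OF c(2)] by simp
    then have "cos t1 = cos t2" using c by (simp add: field_simps)
    then have "t1 = t2" using t tp cos_inj_pi[of t1 t2] by auto
    then show "z1 = z2" using t by simp
  qed
  have fin: "finite {q \<in> cball 0 (exp (- pi)). h q = 0}"
  proof (cases "h constant_on ball 0 1")
    case True
    have "arc_point \<theta>0 \<in> lower_boundary_2" using \<theta>0 by (auto simp: lower_boundary_eq)
    then have q0: "u (arc_point \<theta>0) \<in> cball 0 (exp (- pi))" "h (u (arc_point \<theta>0)) \<noteq> 0"
      using ub[of "arc_point \<theta>0"] iff[of "arc_point \<theta>0"] \<theta>0(3) by auto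
    have "exp (- pi) < (1::real)" by simp
    then have sub: "cball 0 (exp (- pi)) \<subseteq> ball (0::complex) 1" by (simp add: cball_subset_ball_iff)
    have "h q \<noteq> 0" if "q \<in> cball 0 (exp (- pi))" for q
      using True q0 sub that unfolding constant_on_def by (metis subsetD)
    then have "{q \<in> cball 0 (exp (- pi)). h q = 0} = {}" by blast
    then show ?thesis by (simp only: finite.emptyI)
  next
    case False
    have "exp (- pi) < (1::real)" by simp
    then show ?thesis
      by (intro holomorphic_compact_finite_zeros[OF hol _ _ _ _ False]) (auto simp: cball_subset_ball_iff)
  qed
  have "u ` {z \<in> lower_boundary_2. form_of l e c N z = 0} \<subseteq> {q \<in> cball 0 (exp (- pi)). h q = 0}"
    using ub iff by auto
  then have "finite (u ` {z \<in> lower_boundary_2. form_of l e c N z = 0})" using fin finite_subset by blast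
  then show ?thesis by (rule finite_imageD) (rule inj_on_subset[OF inj], auto)
qed

lemma count_lower_bound:
  assumes hol: "f holomorphic_on upper_half_plane" and f: "\<And>z. Im z > 0 \<Longrightarrow> f z = form_of l e c N z"
    and Z: "finite Z" "Z \<subseteq> {0<..<pi/2}" "\<And>\<theta>. \<theta> \<in> Z \<Longrightarrow> f (arc_point \<theta>) = 0"
    and \<theta>0: "0 < \<theta>0" "\<theta>0 \<le> pi / 2" "f (arc_point \<theta>0) \<noteq> 0"
  shows "nontrivial_zeros_count k f lower_boundary_2 \<ge> int (card Z)"
proof -
  define A where "A = {z. z \<in> fundamental_domain_2 \<inter> lower_boundary_2 \<and> f z = 0}"
  have "\<theta>0 < pi" using \<theta>0 by linarith
  then have u0: "Im (arc_point \<theta>0) > 0" using arc_uhp \<theta>0 by auto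
  have "finite {z \<in> lower_boundary_2. form_of l e c N z = 0}"
    using \<theta>0 f[OF u0] by (intro finite_arc_zeros[of \<theta>0]) auto
  then have finA: "finite A"
    by (rule finite_subset[rotated]) (auto simp: A_def f fundamental_domain_2_def uhp_iff)
  have ord: "zorder f z \<ge> 1" if "z \<in> A" for z
  proof -
    have z: "z \<in> upper_half_plane" "f z = 0" using that by (auto simp: A_def fundamental_domain_2_def)
    have "\<exists>w\<in>upper_half_plane. f w \<noteq> 0" using u0 \<theta>0(3) by (auto simp: uhp_iff)
    then have "if f z = 0 then zorder f z > 0 else zorder f z = 0"
      using zorder_exist_zero[OF hol open_uhp connected_uhp z(1)] by blast
    then show ?thesis using z(2) by simp
  qed
  \<comment> \<open>At the elliptic point the order is at least 1, so after removing a possible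
    forced zero and halving, the result is still nonnegative.\<close>
  have nn: "nontrivial_multiplicity k f z \<ge> 0" if "z \<in> A" for z
    using ord[OF that] unfolding nontrivial_multiplicity_def by auto
  have sub: "arc_point ` Z \<subseteq> A"
  proof
    fix z assume "z \<in> arc_point ` Z"
    then obtain t where t: "t \<in> Z" "z = arc_point t" by auto
    then show "z \<in> A" using Z(2,3) arc_domain[of t] by (auto simp: A_def)
  qed
  \<comment> \<open>The zeros found have angles strictly below \<pi>/2 and so avoid the elliptic
    point, where the halved multiplicity could be 0.\<close>
  have ge1: "nontrivial_multiplicity k f z \<ge> 1" if "z \<in> arc_point ` Z" for z
  proof -
    obtain t where t: "t \<in> Z" "z = arc_point t" using \<open>z \<in> arc_point ` Z\<close> by auto
    then have "cos t > 0" using Z(2) by (intro cos_gt_zero) auto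
    then have "Re z \<noteq> Re elliptic_point" by (simp add: t arc_simps elliptic_point_def)
    then have "z \<noteq> elliptic_point" by auto
    then show ?thesis using ord[of z] sub that by (auto simp: nontrivial_multiplicity_def)
  qed
  have "inj_on arc_point Z" by (rule inj_on_subset[OF arc_inj]) (use Z(2) in auto)
  then have "int (card Z) = int (card (arc_point ` Z))" by (simp add: card_image)
  also have "\<dots> \<le> (\<Sum>z\<in>arc_point ` Z. nontrivial_multiplicity k f z)"
    using sum_bounded_below[of "arc_point ` Z" 1 "nontrivial_multiplicity k f"] ge1 by simp
  also have "\<dots> \<le> (\<Sum>z\<in>A. nontrivial_multiplicity k f z)"
    using finA sub nn by (intro sum_mono2) auto
  also have "\<dots> = nontrivial_zeros_count k f lower_boundary_2"
    by (simp add: nontrivial_zeros_count_def A_def)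
  finally show ?thesis .
qed

text \<open>The derivative is \<open>- n sin t - k / (2 * pi)\<close>. With
  \<open>k \<ge> - n\<close> the second part is at most \<open>n / 6\<close>, while
  \<open>cos t \<le> 7/8\<close> gives \<open>sin t \<ge> 1/5\<close>.\<close>

lemma arc_phase_strict_antimono:
  assumes n: "0 < n" and k: "- n \<le> k" and c: "0 < a" "cos a \<le> 7/8"
    and xy: "a \<le> x" "x < y" "y \<le> pi / 2"
  shows "arc_phase k n y < arc_phase k n x"
proof (rule DERIV_neg_imp_decreasing[OF xy(2)])
  fix t assume t: "x \<le> t" "t \<le> y"
  have tb: "0 < t" "a \<le> t" "t \<le> pi / 2" using t xy c by linarith+
  have "cos t \<le> cos a" using tb c by (intro cos_monotone_0_pi_le) auto
  then have ct: "cos t \<le> 7/8" "0 \<le> cos t" using c tb by (auto intro: cos_ge_zero)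
  have "(cos t)\<^sup>2 \<le> (7/8)\<^sup>2" using ct by (intro power_mono) auto
  then have "(1/5)\<^sup>2 \<le> (sin t)\<^sup>2" using sin_cos_squared_add[of t] by (simp add: power2_eq_square)
  moreover have "0 \<le> sin t" using tb by (intro sin_ge_zero) auto
  ultimately have st: "1/5 \<le> sin t" by (rule power2_le_imp_le)
  have n': "0 < real_of_int n" using n by simp
  have k': "- real_of_int n \<le> of_int k" using k by (metis of_int_le_iff of_int_minus)
  have "real_of_int n * (1/5) \<le> of_int n * sin t" using st n' by (intro mult_left_mono) auto
  moreover have "- (real_of_int n * (1/6)) \<le> of_int k / (2 * pi)"
  proof -
    have "- of_int k / (2 * pi) \<le> of_int n / (2 * pi)" using k' by (intro divide_right_mono) auto
    also have "\<dots> \<le> of_int n / 6" using n' pi_gt3 by (intro divide_left_mono) auto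
    finally show ?thesis by simp
  qed
  ultimately have "- (of_int n * sin t) - of_int k / (2 * pi) < 0" using n' by argo
  moreover have "(arc_phase k n has_real_derivative (- (of_int n * sin t) - of_int k / (2 * pi))) (at t)"
    unfolding arc_phase_def[abs_def] by (auto intro!: derivative_eq_intros)
  ultimately show "\<exists>d. (arc_phase k n has_real_derivative d) (at t) \<and> d < 0" by blast
qed

lemma arc_value_continuous:
  assumes "f holomorphic_on upper_half_plane" "0 < a"
  shows "continuous_on {a..pi/2} (arc_value k n f)"
proof -
  have "continuous_on {a..pi/2} (\<lambda>\<theta>. f (arc_point \<theta>))"
  proof (rule continuous_on_compose2[where f = arc_point, OF holomorphic_on_imp_continuous_on[OF assms(1)]])
    show "continuous_on {a..pi/2} arc_point" unfolding arc_point_def[abs_def] by (intro continuous_intros)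
    show "arc_point ` {a..pi/2} \<subseteq> upper_half_plane"
    proof
      fix z assume "z \<in> arc_point ` {a..pi/2}"
      then obtain t where t: "a \<le> t" "t \<le> pi/2" "z = arc_point t" by auto
      have "0 < t" "t < pi" using t assms(2) pi_gt_zero by linarith+
      then show "z \<in> upper_half_plane" using arc_uhp[of t] t by (simp add: uhp_iff)
    qed
  qed
  then show ?thesis unfolding arc_value_def[abs_def] by (intro continuous_intros) auto
qed

text \<open>The samples are the angles where the phase is one of the \<open>J + 1\<close> integers
  from \<open>- l - n\<close> upwards; the cosine alternates there. A phase up to
  \<open>1/2 - \<delta>\<close> short of its integer still leaves the cosine with the right sign and
  modulus at least \<open>sin (pi * \<delta>)\<close>, which is what \<open>E\<close> is compared
  with.\<close>

lemma count_from_estimate: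
  fixes k l n J :: int and e :: nat
  assumes k: "k = 4 * l + 2 * int e" and e: "e \<le> 1" and n: "0 < n" and kn: "- n \<le> k" and J: "0 \<le> J"
    and hol: "f holomorphic_on upper_half_plane" and f: "\<And>z. Im z > 0 \<Longrightarrow> f z = form_of l e c N z"
    and a: "0 < a" "a < pi / 2" "cos a \<le> 7/8"
    and est: "\<And>\<theta>. a \<le> \<theta> \<Longrightarrow> \<theta> < pi / 2 \<Longrightarrow> \<bar>arc_value k n f \<theta> - 2 * cos (pi * arc_phase k n \<theta>)\<bar> \<le> E"
    and \<delta>: "0 < \<delta>" "\<delta> \<le> 1/2" "E < 2 * sin (pi * \<delta>)"
    and Ja: "of_int J - of_int l - of_int n \<le> arc_phase k n a + 1/2 - \<delta>"
  shows "nontrivial_zeros_count k f lower_boundary_2 \<ge> J"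
proof -
  let ?G = "arc_value k n f" and ?p = "arc_phase k n"
  have pc: "continuous_on A ?p" for A unfolding arc_phase_def[abs_def] by (intro continuous_intros) auto
  note Gc = arc_value_continuous[OF hol a(1), of k n]
  note mono = arc_phase_strict_antimono[OF n kn a(1,3)]
  \<comment> \<open>The estimate extends to \<pi>/2 by continuity, which matters for
    \<open>e = 0\<close>, where the first sample is that endpoint.\<close>
  have est': "\<bar>?G \<theta> - 2 * cos (pi * ?p \<theta>)\<bar> \<le> E" if "a \<le> \<theta>" "\<theta> \<le> pi / 2" for \<theta>
  proof -
    have cl: "closure {a..<pi/2} = {a..pi/2}" using a by (intro closure_atLeastLessThan) auto
    have "norm (?G \<theta> - 2 * cos (pi * ?p \<theta>)) \<le> E"
    proof (rule continuous_on_closure_norm_le[where f = "\<lambda>\<theta>. ?G \<theta> - 2 * cos (pi * ?p \<theta>)" and s = "{a..<pi/2}"])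
      show "continuous_on (closure {a..<pi/2}) (\<lambda>\<theta>. ?G \<theta> - 2 * cos (pi * ?p \<theta>))"
        unfolding cl by (intro continuous_intros Gc pc)
      show "\<theta> \<in> closure {a..<pi/2}" unfolding cl using that by simp
    qed (use est in auto)
    then show ?thesis by simp
  qed
  have pend: "?p (pi / 2) \<le> - of_int l - of_int n" by (simp add: arc_phase_def k)
  define N' where "N' = nat J"
  have N': "real N' = of_int J" using J by (simp add: N'_def)
  \<comment> \<open>If the last integer is not reached before the angle \<open>a\<close>, the phase
    at \<open>a\<close> replaces it. By \<open>Ja\<close> the earlier integers all lie below that
    phase, so the samples stay distinct.\<close>
  define b where "b j = min (real j - of_int l - of_int n) (?p a)" for j
  have "\<exists>x. a \<le> x \<and> x \<le> pi / 2 \<and> ?p x = b j" for j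
  proof -
    have "?p (pi / 2) < ?p a" using a by (intro mono) auto
    then have "?p (pi / 2) \<le> b j" "b j \<le> ?p a" using pend by (auto simp: b_def)
    then show ?thesis using a pc by (intro IVT2') auto
  qed
  then obtain t where t: "\<And>j. a \<le> t j \<and> t j \<le> pi / 2 \<and> ?p (t j) = b j" by metis
  define s :: real where "s = cos (pi * of_int (l + n))"
  have dec: "t (Suc j) < t j" if "j < N'" for j
  proof (rule ccontr)
    assume "\<not> t (Suc j) < t j"
    then consider "t j = t (Suc j)" | "t j < t (Suc j)" by linarith
    then have "b (Suc j) \<le> b j"
    proof cases
      case 1 then show ?thesis using t[of j] t[of "Suc j"] by simp
    next
      case 2 then show ?thesis using mono[of "t j" "t (Suc j)"] t[of j] t[of "Suc j"] by simp
    qed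
    moreover have "real j + 1 \<le> of_int J" using that N' by linarith
    then have "real j - of_int l - of_int n < ?p a" using Ja \<delta> by linarith
    then have "b j < b (Suc j)" unfolding b_def by auto
    ultimately show False by simp
  qed
  have alt: "s * (- 1) ^ j * ?G (t j) > 0" if "j \<le> N'" for j
  proof -
    define i where "i = int j - l - n"
    define d where "d = of_int i - b j"
    have jJ: "real j \<le> of_int J" using that N' by linarith
    have i: "of_int i = real j - of_int l - of_int n" by (simp add: i_def)
    have d: "0 \<le> d" "d \<le> 1/2 - \<delta>" using jJ Ja \<delta> unfolding d_def i b_def by linarith+
    define \<sigma> :: real where "\<sigma> = cos (pi * of_int i)"
    have \<sigma>: "s * (- 1) ^ j = \<sigma>" "\<sigma> = 1 \<or> \<sigma> = - 1"
      unfolding s_def \<sigma>_def i_def cos_npi_int by (cases "even j"; auto)+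
    have bj: "b j = of_int i - d" by (simp add: d_def)
    have "cos (pi * b j) = cos (pi * of_int i - pi * d)" unfolding bj right_diff_distrib ..
    then have cb: "cos (pi * b j) = \<sigma> * cos (pi * d)" by (simp add: cos_diff \<sigma>_def)
    have "sin (pi * \<delta>) = cos (pi / 2 - pi * \<delta>)" by (simp add: cos_diff)
    also have "\<dots> \<le> cos (pi * d)"
    proof (rule cos_monotone_0_pi_le)
      show "0 \<le> pi * d" using d by simp
      have "pi * d \<le> pi * (1/2 - \<delta>)" using d by (intro mult_left_mono) auto
      then show "pi * d \<le> pi / 2 - pi * \<delta>" by (simp add: algebra_simps)
      have "0 < pi * \<delta>" using \<delta> by simp
      then show "pi / 2 - pi * \<delta> \<le> pi" using pi_gt_zero by linarith
    qed
    finally have "E < 2 * cos (pi * d)" using \<delta> by linarith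
    moreover have "\<bar>?G (t j) - 2 * (\<sigma> * cos (pi * d))\<bar> \<le> E" using est'[of "t j"] t[of j] cb by simp
    ultimately show ?thesis unfolding \<sigma>(1) using \<sigma>(2) by (elim disjE) (auto simp: abs_le_iff)
  qed
  obtain Z where Z: "finite Z" "card Z = N'" "Z \<subseteq> {a<..<pi/2}" "\<And>x. x \<in> Z \<Longrightarrow> ?G x = 0"
    using alternating_zeros[OF Gc, of N' t s] t dec alt by blast
  have "?G (t 0) \<noteq> 0" using alt[of 0] by auto
  then have nz: "f (arc_point (t 0)) \<noteq> 0" by (auto simp: arc_value_def)
  have "int (card Z) \<le> nontrivial_zeros_count k f lower_boundary_2"
  proof (rule count_lower_bound[OF hol f Z(1) _ _ _ _ nz])
    show "Z \<subseteq> {0<..<pi/2}" using Z(3) a by auto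
    show "0 < t 0" "t 0 \<le> pi / 2" using t[of 0] a by auto
    fix x assume x: "x \<in> Z"
    then have xb: "0 < x" "x < pi" using Z(3) a pi_gt_zero by force+
    let ?X = "exp (\<i> * of_real (of_int k * x / 2)) * f (arc_point x)"
    have "?X \<in> \<real>" using form_of_arc_real(2)[OF xb k] f[OF arc_uhp[OF xb]] by simp
    moreover have "Re ?X = 0" using Z(4)[OF x] by (simp add: arc_value_def)
    ultimately have "?X = 0" by (auto simp: complex_is_Real_iff complex_eq_iff)
    then show "f (arc_point x) = 0" by simp
  qed
  then show ?thesis using Z(2) J by (simp add: N'_def)
qed

text \<open>Between the two angles the cosine changes by \<open>7/8 - sqrt 3 / 2\<close> and its
  slope is at least 48/100 in modulus, so the angles differ by at most 2/100.\<close>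

lemma arccos_7_8:
  defines "a \<equiv> arccos (7/8)"
  shows "cos a = 7/8" "0 < a" "a < pi / 2" "a \<le> pi / 6" "pi / 6 - a \<le> 2/100"
proof -
  show c: "cos a = 7/8" unfolding a_def by (rule cos_arccos) auto
  have ab: "0 \<le> a" "a \<le> pi" unfolding a_def by (auto intro: arccos_lbound arccos_ubound)
  show a0: "0 < a" using ab c by (cases "a = 0") auto
  have s3: "1732/1000 \<le> sqrt 3" "sqrt 3 \<le> 7/4" by (rule real_le_rsqrt real_le_lsqrt; simp add: power2_eq_square)+
  have "cos (pi / 6) \<le> cos a" unfolding c cos_30 using s3 by simp
  then show 6: "a \<le> pi / 6" using ab cos_mono_le_eq[of "pi / 6" a] by simp
  then show "a < pi / 2" using pi_gt_zero by linarith
  show "pi / 6 - a \<le> 2/100"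
  proof (cases "a < pi / 6")
    case True
    obtain z where z: "a < z" "z < pi / 6" "cos (pi / 6) - cos a = (pi / 6 - a) * (- sin z)"
      using MVT2[OF True, of cos "\<lambda>x. - sin x"] by (auto intro!: derivative_eq_intros)
    have sa: "sin a \<le> sin z" using z a0 pi_gt_zero by (intro sin_monotone_2pi_le) auto
    have "(48/100)\<^sup>2 \<le> (sin a)\<^sup>2"
      using sin_cos_squared_add[of a] unfolding c by (simp add: power2_eq_square)
    then have "48/100 \<le> sin a" using sin_ge_zero[OF ab] by (rule power2_le_imp_le)
    then have "48/100 \<le> sin z" using sa by (rule order_trans)
    then have "(pi / 6 - a) * (48/100) \<le> (pi / 6 - a) * sin z" using True by (intro mult_left_mono) auto
    moreover have "(pi / 6 - a) * sin z = 7/8 - sqrt 3 / 2" using z(3) unfolding c cos_30 by simp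
    ultimately show ?thesis using s3 by argo
  qed (use 6 in simp)
qed

theorem theorem1:
  fixes k l k' n :: int and f :: "complex \<Rightarrow> complex"
  assumes "even k" and "k = 4 * l + k'" and "k' \<in> {0, 2}"
    and "n \<ge> - l"
    and "f \<in> M_sharp k" and "has_leading_form f n l"
    and "(l \<ge> 0 \<and> n \<ge> 14 * l + 8) \<or> (l < 0 \<and> n \<ge> 15 * \<bar>l\<bar> + 8)"
  shows "nontrivial_zeros_count k f lower_boundary_2
           \<ge> \<lfloor>sqrt 3 / 2 * real_of_int n + real_of_int k / 6\<rfloor>"
proof -
  define e :: nat where "e = (if k' = 0 then 0 else 1)"
  have e: "e \<le> 1" and k: "k = 4 * l + 2 * int e" using assms(2,3) by (auto simp: e_def)
  obtain c w where cf: "\<And>z. Im z > 0 \<Longrightarrow> f z = form_of l e c (nat (n + l)) z"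
    and w: "w holomorphic_on ball 0 1"
    and cw: "\<And>q. norm q < 1 \<Longrightarrow> q \<noteq> 0 \<Longrightarrow>
       fF q ^ e * hpoly c (nat (n + l)) (1 / fv q) = (fG q ^ 8) powi (- l) / q ^ nat (n + l) + q * w q"
    using form_structure[OF k e assms(4-6)] by blast
  have hol: "f holomorphic_on upper_half_plane"
    using assms(5) by (simp add: M_sharp_def weakly_holomorphic_forms_def)
  \<comment> \<open>The bound \<open>- 4 * n \<le> 15 * k\<close> is critical for negative
    \<open>l\<close>, where \<open>n \<ge> 15 * \<bar>l\<bar> + 8\<close>; the value 22 is
    \<open>14 + 8\<close>, attained for \<open>l = 1\<close>.\<close>
  have n: "0 < n" "8 \<le> n" "- n \<le> k" "- 4 * n \<le> 15 * k" "l \<noteq> 0 \<Longrightarrow> 22 \<le> n" using assms(7) k e by auto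
  have s3: "1732/1000 \<le> sqrt 3" "sqrt 3 \<le> 173206/100000"
    by (rule real_le_rsqrt real_le_lsqrt; simp add: power2_eq_square)+
  define J where "J = \<lfloor>sqrt 3 / 2 * real_of_int n + real_of_int k / 6\<rfloor>"
  have Jle: "of_int J \<le> sqrt 3 / 2 * real_of_int n + real_of_int k / 6" unfolding J_def by simp
  have J0: "0 \<le> J"
  proof -
    have "1/2 * real_of_int n \<le> sqrt 3 / 2 * real_of_int n" using s3 n by (intro mult_right_mono) auto
    moreover have "- real_of_int n \<le> of_int k" "0 < real_of_int n" using n by linarith+
    ultimately have "0 \<le> sqrt 3 / 2 * real_of_int n + of_int k / 6" by argo
    then show ?thesis unfolding J_def zero_le_floor .
  qed
  have bnd: "\<bar>arc_value k n f \<theta> - 2 * cos (pi * arc_phase k n \<theta>)\<bar>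
      \<le> 5/2 * (if e = 0 then 2225/100 else 1) * B ^ e * (R * 25/8) ^ M * D"
    if M: "(l \<ge> 0 \<and> int M + 15 * l \<le> n + l) \<or> (l < 0 \<and> int M + 14 * \<bar>l\<bar> \<le> n + l)"
      and \<theta>: "0 < \<theta>" "\<theta> < pi / 2" "cos \<theta> \<le> 7/8"
      and R: "norm (ee (arc_point \<theta>)) \<le> R" and B: "norm (fF (ee (arc_point \<theta>))) \<le> B" and D: "(3/5) ^ nat \<bar>l\<bar> \<le> D"
    for \<theta> R B D :: real and M :: nat
  proof -
    have "\<theta> < pi" using \<theta> by linarith
    then have "arc_value k n f \<theta> = arc_value k n (form_of l e c (nat (n + l))) \<theta>"
      using cf[OF arc_uhp[OF \<theta>(1)]] by (simp add: arc_value_def)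
    then have "\<bar>arc_value k n f \<theta> - 2 * cos (pi * arc_phase k n \<theta>)\<bar>
      \<le> 5/2 * (if e = 0 then 2225/100 else 1) * norm (fF (ee (arc_point \<theta>))) ^ e * (norm (ee (arc_point \<theta>)) * 25/8) ^ M * (3/5) ^ nat \<bar>l\<bar>"
      using arc_estimate[OF k e assms(4) w cw M \<theta>] by simp
    also have "\<dots> \<le> 5/2 * (if e = 0 then 2225/100 else 1) * B ^ e * (R * 25/8) ^ M * D"
    proof -
      define C :: real where "C = 5/2 * (if e = 0 then 2225/100 else 1)"
      have C: "0 \<le> C" by (simp add: C_def)
      have RB: "0 \<le> R" "0 \<le> B" using order_trans[OF norm_ge_zero R] order_trans[OF norm_ge_zero B] by auto
      have "norm (fF (ee (arc_point \<theta>))) ^ e \<le> B ^ e" using B by (intro power_mono) auto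
      moreover have "(norm (ee (arc_point \<theta>)) * 25/8) ^ M \<le> (R * 25/8) ^ M" using R by (intro power_mono) auto
      ultimately show ?thesis unfolding C_def[symmetric] using C RB D
        by (intro mult_mono mult_left_mono mult_nonneg_nonneg zero_le_power) simp_all
    qed
    finally show ?thesis .
  qed
  have D1: "(3/5::real) ^ nat \<bar>l\<bar> \<le> 1" by (rule power_le_one) auto
  note count = count_from_estimate[OF k e n(1,3) J0 hol cf]
  have rk: "real_of_int k = 4 * of_int l + 2 * real e" by (simp add: k)
  have "arc_phase k n (pi / 6) = of_int n * (sqrt 3 / 2 - 1) - of_int k / 12"
    by (simp add: arc_phase_def cos_30)
  then have p6: "arc_phase k n (pi / 6) = of_int n * (sqrt 3 / 2 - 1) - of_int l / 3 - real e / 6"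
    unfolding rk by (simp add: add_divide_distrib)
  have c6: "cos (pi / 6) \<le> 7/8" unfolding cos_30 using s3 by simp
  have b6: "norm (ee (arc_point \<theta>)) \<le> 208/1000 \<and> cos \<theta> \<le> 7/8 \<and> norm (fF (ee (arc_point \<theta>))) \<le> 1041/100 \<and> 0 < \<theta>"
    if "pi / 6 \<le> \<theta>" "\<theta> < pi / 2" for \<theta>
  proof -
    have "0 < \<theta>" using that pi_gt_zero by linarith
    then show ?thesis using arc_radius(2)[of \<theta>] fF_bounds(1) that by auto
  qed
  define a where "a = arccos (7/8 :: real)"
  note a = arccos_7_8[folded a_def]
  have ba: "norm (ee (arc_point \<theta>)) \<le> 2187/10000 \<and> cos \<theta> \<le> 7/8 \<and> norm (fF (ee (arc_point \<theta>))) \<le> 1124/100 \<and> 0 < \<theta>"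
    if "a \<le> \<theta>" "\<theta> < pi / 2" for \<theta>
  proof -
    have "cos \<theta> \<le> cos a" using that a by (intro cos_monotone_0_pi_le) auto
    then show ?thesis using arc_radius(1)[of \<theta>] fF_bounds(2) that a by auto
  qed
  have split7: "real_of_int n * (7/8 - sqrt 3 / 2) = 7/8 * of_int n - sqrt 3 / 2 * of_int n" by (simp add: algebra_simps)
  have sin8: "35/100 \<le> sin (pi * (1/8))"
  proof -
    have "sqrt 2 / 2 = sin (2 * (pi * (1/8)))" by (simp add: sin_45)
    also have "\<dots> = 2 * sin (pi * (1/8)) * cos (pi * (1/8))" by (rule sin_double)
    also have "\<dots> \<le> 2 * sin (pi * (1/8)) * 1"
      using pi_gt_zero by (intro mult_left_mono cos_le_one mult_nonneg_nonneg sin_ge_zero) linarith+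
    finally have "sqrt 2 / 2 \<le> 2 * sin (pi * (1/8))" by simp
    moreover have "14/10 \<le> sqrt 2" by (rule real_le_rsqrt) (simp add: power2_eq_square)
    ultimately show ?thesis by argo
  qed
  have sin6: "sin (pi * (1/6)) = 1/2" using sin_30 by simp
  have M8: "(l \<ge> 0 \<and> int 8 + 15 * l \<le> n + l) \<or> (l < 0 \<and> int 8 + 14 * \<bar>l\<bar> \<le> n + l)" using assms(7) by auto
  \<comment> \<open>For \<open>e = 0\<close> the phase at \<pi>/6 reaches the last sample and
    \<delta> = 1/2 is allowed. For \<open>e = 1\<close> it falls short by up to 1/2, and a further
    \<delta> is needed for the error. If \<open>l = 0\<close> and \<open>n\<close> is small, the
    fractional part lost by the floor provides \<delta>; for larger \<open>n\<close> the phase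
    gained between \<pi>/6 and \<open>a\<close> does. If \<open>l \<noteq> 0\<close>, the gain is
    available since \<open>n \<ge> 22\<close>, and the factor 3/5 compensates for the larger nome on
    the longer arc.\<close>
  consider "e = 0" | "e = 1" "l = 0" "n = 8" | "e = 1" "l = 0" "9 \<le> n" "n \<le> 13" | "e = 1" "l = 0" "14 \<le> n" | "e = 1" "l \<noteq> 0"
    using e n(2) by linarith
  then have "nontrivial_zeros_count k f lower_boundary_2 \<ge> J"
  proof cases
    case 1
    show ?thesis
    proof (rule count[where a = "pi / 6" and \<delta> = "1/2"])
      fix \<theta> assume "pi / 6 \<le> \<theta>" "\<theta> < pi / 2"
      then show "\<bar>arc_value k n f \<theta> - 2 * cos (pi * arc_phase k n \<theta>)\<bar> \<le> 5/2 * (2225/100) * (208/1000 * 25/8) ^ 8"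
        using bnd[OF M8, of \<theta> "208/1000" "1041/100" 1] b6[of \<theta>] D1 1 by simp
    next
      show "5/2 * (2225/100) * (208/1000 * 25/8) ^ 8 < 2 * sin (pi * (1/2))" by (simp add: power_divide)
      show "of_int J - of_int l - of_int n \<le> arc_phase k n (pi / 6) + 1/2 - 1/2"
        using Jle unfolding p6 rk 1 by (simp add: algebra_simps)
    qed (use c6 in auto)
  next
    case 2
    show ?thesis
    proof (rule count[where a = "pi / 6" and \<delta> = "1/6"])
      fix \<theta> assume "pi / 6 \<le> \<theta>" "\<theta> < pi / 2"
      then show "\<bar>arc_value k n f \<theta> - 2 * cos (pi * arc_phase k n \<theta>)\<bar> \<le> 5/2 * (1041/100) * (208/1000 * 25/8) ^ 8"
        using bnd[OF M8, of \<theta> "208/1000" "1041/100" 1] b6[of \<theta>] D1 2 by simp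
    next
      show "5/2 * (1041/100) * (208/1000 * 25/8) ^ 8 < 2 * sin (pi * (1/6))" unfolding sin6 by (simp add: power_divide)
      \<comment> \<open>For \<open>n = 8\<close> the number under the floor is about 7.26, so
        rounding down to 7 gives away more than 1/6.\<close>
      have "real_of_int J < 8" using Jle s3 unfolding rk 2 by simp
      then have "real_of_int J \<le> 7" by simp
      then show "of_int J - of_int l - of_int n \<le> arc_phase k n (pi / 6) + 1/2 - 1/6"
        using s3 unfolding p6 unfolding 2 of_int_numeral of_int_0 of_nat_1 by argo
    qed (use c6 in auto)
  next
    case 3
    have M: "(l \<ge> 0 \<and> int 9 + 15 * l \<le> n + l) \<or> (l < 0 \<and> int 9 + 14 * \<bar>l\<bar> \<le> n + l)" using 3 by auto
    show ?thesis
    proof (rule count[where a = "pi / 6" and \<delta> = "1/8"])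
      fix \<theta> assume "pi / 6 \<le> \<theta>" "\<theta> < pi / 2"
      then show "\<bar>arc_value k n f \<theta> - 2 * cos (pi * arc_phase k n \<theta>)\<bar> \<le> 5/2 * (1041/100) * (208/1000 * 25/8) ^ 9"
        using bnd[OF M, of \<theta> "208/1000" "1041/100" 1] b6[of \<theta>] D1 3 by simp
    next
      have "5/2 * (1041/100) * (208/1000 * 25/8) ^ 9 < (7/10 :: real)" by (simp add: power_divide)
      then show "5/2 * (1041/100) * (208/1000 * 25/8) ^ 9 < 2 * sin (pi * (1/8))" using sin8 by linarith
      \<comment> \<open>For these \<open>n\<close> the fractional part of
        \<open>sqrt 3 / 2 * n + 1/3\<close> is at least 1/8; the tightest case is 9, with about
        0.127.\<close>
      have n5: "n = 9 \<or> n = 10 \<or> n = 11 \<or> n = 12 \<or> n = 13" using 3 by auto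
      have "J \<le> (if n = 9 then 8 else n - 2)"
      proof -
        have "real_of_int J < of_int ((if n = 9 then 8 else n - 2) + 1)"
          using n5 Jle s3 unfolding rk 3(1,2) by (elim disjE) auto
        then show ?thesis by linarith
      qed
      then have "real_of_int J \<le> of_int (if n = 9 then 8 else n - 2)" by (rule of_int_le_iff[THEN iffD2])
      also have "\<dots> \<le> sqrt 3 / 2 * of_int n + 5/24" using n5 s3 by (elim disjE) auto
      finally show "of_int J - of_int l - of_int n \<le> arc_phase k n (pi / 6) + 1/2 - 1/8"
        unfolding p6 unfolding 3(1,2) of_int_0 of_nat_1 by argo
    qed (use c6 in auto)
  next
    case 4
    have M: "(l \<ge> 0 \<and> int 14 + 15 * l \<le> n + l) \<or> (l < 0 \<and> int 14 + 14 * \<bar>l\<bar> \<le> n + l)" using 4 by auto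
    show ?thesis
    proof (rule count[where a = a and \<delta> = "1/8"])
      fix \<theta> assume "a \<le> \<theta>" "\<theta> < pi / 2"
      then show "\<bar>arc_value k n f \<theta> - 2 * cos (pi * arc_phase k n \<theta>)\<bar> \<le> 5/2 * (1124/100) * (2187/10000 * 25/8) ^ 14"
        using bnd[OF M, of \<theta> "2187/10000" "1124/100" 1] ba[of \<theta>] D1 4 by simp
    next
      have "5/2 * (1124/100) * (2187/10000 * 25/8) ^ 14 < (7/10 :: real)" by (simp add: power_divide)
      then show "5/2 * (1124/100) * (2187/10000 * 25/8) ^ 14 < 2 * sin (pi * (1/8))" using sin8 by linarith
      \<comment> \<open>Going from \<pi>/6 down to \<open>a\<close> raises the cosine by at least
        897/100000, and 14 times this exceeds \<delta> = 1/8.\<close>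
      have "14 * (897/100000) \<le> real_of_int n * (7/8 - sqrt 3 / 2)" using 4 s3 by (intro mult_mono) auto
      moreover have "a / pi \<le> 1/6" using a by (simp add: field_simps)
      moreover have "arc_phase k n a = - (of_int n / 8) - a / pi"
        by (simp add: arc_phase_def a(1) rk 4(1,2))
      moreover have "of_int J \<le> sqrt 3 / 2 * real_of_int n + 1/3" using Jle unfolding rk 4(1,2) by simp
      ultimately show "of_int J - of_int l - of_int n \<le> arc_phase k n a + 1/2 - 1/8"
        unfolding 4(2) of_int_0 split7 by argo
    qed (use a in auto)
  next
    case 5
    have D: "(3/5::real) ^ nat \<bar>l\<bar> \<le> 3/5" using power_decreasing[of 1 "nat \<bar>l\<bar>" "3/5::real"] 5 by simp
    show ?thesis
    proof (rule count[where a = a and \<delta> = "1/6"])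
      fix \<theta> assume "a \<le> \<theta>" "\<theta> < pi / 2"
      then show "\<bar>arc_value k n f \<theta> - 2 * cos (pi * arc_phase k n \<theta>)\<bar> \<le> 5/2 * (1124/100) * (2187/10000 * 25/8) ^ 8 * (3/5)"
        using bnd[OF M8, of \<theta> "2187/10000" "1124/100" "3/5"] ba[of \<theta>] D 5 by simp
    next
      show "5/2 * (1124/100) * (2187/10000 * 25/8) ^ 8 * (3/5) < 2 * sin (pi * (1/6))" unfolding sin6 by (simp add: power_divide)
      \<comment> \<open>\<open>k * u\<close> is the change of the weight term of the phase between
        \<pi>/6 and \<open>a\<close>; for negative \<open>k\<close> it is a loss, at most
        \<open>n * (4/15) / 300\<close>. Against the gain \<open>n * (897/100000)\<close> from the
        cosine at least 1/6 remains once \<open>n \<ge> 22\<close>.\<close>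
      define u where "u = (pi / 6 - a) / (2 * pi)"
      have "(pi / 6 - a) / (2 * pi) \<le> (2/100) / (2 * 3)" using a pi_gt3 by (intro frac_le) auto
      then have u: "0 \<le> u" "u \<le> 1/300" using a by (auto simp: u_def)
      have n': "22 \<le> real_of_int n" "- real_of_int n * (4/15) \<le> of_int k" using n 5 by linarith+
      have "real_of_int n * (897/100000) \<le> real_of_int n * (7/8 - sqrt 3 / 2)" using n' s3 by (intro mult_left_mono) auto
      moreover have "- (real_of_int n * (4/15) * (1/300)) \<le> of_int k * u"
      proof -
        have "real_of_int n * (4/15) * u \<le> real_of_int n * (4/15) * (1/300)" using n' u by (intro mult_left_mono) auto
        moreover have "- real_of_int n * (4/15) * u \<le> of_int k * u" using n' u by (intro mult_right_mono) auto
        then have "- (real_of_int n * (4/15) * u) \<le> of_int k * u" by (simp only: mult_minus_left)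
        ultimately show ?thesis by (meson le_minus_iff neg_le_iff_le order_trans)
      qed
      ultimately have main: "1/6 \<le> real_of_int n * (7/8 - sqrt 3 / 2) + of_int k * u" using n'(1) unfolding split7 by argo
      have "of_int k * a / (2 * pi) = of_int k / 12 - of_int k * u" by (simp add: u_def field_simps)
      moreover have "real_of_int l = (of_int k - 2) / 4" unfolding rk 5 by simp
      moreover have "arc_phase k n a = - (of_int n / 8) - of_int k * a / (2 * pi)"
        by (simp add: arc_phase_def a(1))
      ultimately show "of_int J - of_int l - of_int n \<le> arc_phase k n a + 1/2 - 1/6"
        using Jle main unfolding split7 by argo
    qed (use a in auto)
  qed
  then show ?thesis by (simp add: J_def)
qed

end
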